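(* Let $G$ be a group which is the central product of normal subgroups $H$ and $K$ (so $G=HK$, $[H,K]=1$), with $A=H\cap K$ and $Z=H'\cap K'$, and let $D$ be a divisible abelian group with trivial $G$-action. Let $L$ be the kernel of the inflation map $\operatorname{H}^2(H/A,D)\to\operatorname{H}^2(H/Z,D)$ and $M$ the kernel of the inflation map $\operatorname{H}^2(K/A,D)\to\operatorname{H}^2(K/Z,D)$; then $L\cong\operatorname{Hom}((A\cap H')/Z,D)$ and $M\cong \operatorname{Hom}((A\cap K')/Z,D)$. Then: (i) there is a subgroup $N$ of $\operatorname{H}^2(H/A,D)/L\oplus \operatorname{H}^2(K/A,D)/M$ with $N\cong \operatorname{Hom}(Z,D)$ such that $$\big(\operatorname{H}^2(H/A,D)/L\oplus \operatorname{H}^2(K/A,D)/M\big)/N\;\oplus\;\operatorname{Hom}(H/A\otimes K/A,D)$$ embeds (as a subgroup) in $\operatorname{H}^2(G,D)$; (ii) there is a subgroup $N'$ of $\operatorname{H}^2(H/Z,D)\oplus \operatorname{H}^2(K/Z,D)$ with $N'\cong\operatorname{Hom}(Z,D)$ such that $\operatorname{H}^2(G,D)$ embeds in $$\big(\operatorname{H}^2(H/Z,D)\oplus \operatorname{H}^2(K/Z,D)\big)/N'\;\oplus\;\operatorname{Hom}(H\otimes K,D).$$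
   Context: $X'$ denotes the commutator subgroup of $X$. For groups $X,Y$, $X\otimes Y$ denotes the abelian tensor product $X/X'\otimes_{\mathbb{Z}} Y/Y'$. $\operatorname{H}^2(X,D)$ is the second cohomology group with trivial coefficients $D$; inflation maps are the standard ones induced by quotient maps. *)

theory Defs
  imports "HOL-Algebra.Algebra"
begin

definition cocycle_group :: "('x, 'm) monoid_scheme \<Rightarrow> ('d, 'n) monoid_scheme \<Rightarrow> ('x \<times> 'x \<Rightarrow> 'd) monoid" where
  "cocycle_group P D = \<lparr>
     carrier = {f \<in> (carrier P \<times> carrier P) \<rightarrow>\<^sub>E carrier D.
                 \<forall>x\<in>carrier P. \<forall>y\<in>carrier P. \<forall>z\<in>carrier P.
                   f (y, z) \<otimes>\<^bsub>D\<^esub> f (x, y \<otimes>\<^bsub>P\<^esub> z) = f (x \<otimes>\<^bsub>P\<^esub> y, z) \<otimes>\<^bsub>D\<^esub> f (x, y)},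
     monoid.mult = (\<lambda>f g. \<lambda>p\<in>carrier P \<times> carrier P. f p \<otimes>\<^bsub>D\<^esub> g p),
     one = (\<lambda>p\<in>carrier P \<times> carrier P. \<one>\<^bsub>D\<^esub>) \<rparr>"

definition coboundaries :: "('x, 'm) monoid_scheme \<Rightarrow> ('d, 'n) monoid_scheme \<Rightarrow> ('x \<times> 'x \<Rightarrow> 'd) set" where
  "coboundaries P D = {(\<lambda>p\<in>carrier P \<times> carrier P.
        g (fst p) \<otimes>\<^bsub>D\<^esub> g (snd p) \<otimes>\<^bsub>D\<^esub> inv\<^bsub>D\<^esub> (g (fst p \<otimes>\<^bsub>P\<^esub> snd p))) | g. g \<in> carrier P \<rightarrow> carrier D}"

definition H2 :: "('x, 'm) monoid_scheme \<Rightarrow> ('d, 'n) monoid_scheme \<Rightarrow> ('x \<times> 'x \<Rightarrow> 'd) set monoid" where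
  "H2 P D = cocycle_group P D Mod coboundaries P D"

definition infl :: "('x, 'm) monoid_scheme \<Rightarrow> ('y, 'k) monoid_scheme \<Rightarrow> ('d, 'n) monoid_scheme
                    \<Rightarrow> ('x \<Rightarrow> 'y) \<Rightarrow> ('y \<times> 'y \<Rightarrow> 'd) set \<Rightarrow> ('x \<times> 'x \<Rightarrow> 'd) set" where
  "infl P Q D \<phi> = (\<lambda>c\<in>carrier (H2 Q D).
      coboundaries P D #>\<^bsub>cocycle_group P D\<^esub>
        (\<lambda>p\<in>carrier P \<times> carrier P. (SOME f. f \<in> c) (\<phi> (fst p), \<phi> (snd p))))"

definition hom_group :: "('x, 'm) monoid_scheme \<Rightarrow> ('d, 'n) monoid_scheme \<Rightarrow> ('x \<Rightarrow> 'd) monoid" where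
  "hom_group P D = \<lparr>
     carrier = {f \<in> hom P D. f \<in> extensional (carrier P)},
     monoid.mult = (\<lambda>f g. \<lambda>x\<in>carrier P. f x \<otimes>\<^bsub>D\<^esub> g x),
     one = (\<lambda>x\<in>carrier P. \<one>\<^bsub>D\<^esub>) \<rparr>"

definition abelianization :: "('x, 'm) monoid_scheme \<Rightarrow> 'x set monoid" where
  "abelianization P = P Mod derived P (carrier P)"

definition tensor_rels :: "('a, 'm) monoid_scheme \<Rightarrow> ('b, 'n) monoid_scheme \<Rightarrow> ('a \<times> 'b \<Rightarrow>\<^sub>0 int) set" where
  "tensor_rels P Q =
     {frag_of (a1 \<otimes>\<^bsub>P\<^esub> a2, b) - frag_of (a1, b) - frag_of (a2, b) | a1 a2 b.
        a1 \<in> carrier P \<and> a2 \<in> carrier P \<and> b \<in> carrier Q}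
   \<union> {frag_of (a, b1 \<otimes>\<^bsub>Q\<^esub> b2) - frag_of (a, b1) - frag_of (a, b2) | a b1 b2.
        a \<in> carrier P \<and> b1 \<in> carrier Q \<and> b2 \<in> carrier Q}"

definition tensor_Z :: "('a, 'm) monoid_scheme \<Rightarrow> ('b, 'n) monoid_scheme \<Rightarrow> ('a \<times> 'b \<Rightarrow>\<^sub>0 int) set monoid" where
  "tensor_Z P Q = free_Abelian_group (carrier P \<times> carrier Q)
      Mod generate (free_Abelian_group (carrier P \<times> carrier Q)) (tensor_rels P Q)"

definition ab_tensor :: "('x, 'm) monoid_scheme \<Rightarrow> ('y, 'n) monoid_scheme \<Rightarrow> ('x set \<times> 'y set \<Rightarrow>\<^sub>0 int) set monoid" where
  "ab_tensor P Q = tensor_Z (abelianization P) (abelianization Q)"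

definition embeds :: "('a, 'm) monoid_scheme \<Rightarrow> ('b, 'n) monoid_scheme \<Rightarrow> bool" where
  "embeds P Q \<longleftrightarrow> (\<exists>\<phi>. \<phi> \<in> hom P Q \<and> inj_on \<phi> (carrier P))"

definition divisible_group :: "('d, 'm) monoid_scheme \<Rightarrow> bool" where
  "divisible_group D \<longleftrightarrow> (\<forall>d\<in>carrier D. \<forall>n::nat. n > 0 \<longrightarrow> (\<exists>e\<in>carrier D. e [^]\<^bsub>D\<^esub> n = d))"

(* natural quotient map H/Z \<rightarrow> H/A for Z \<subseteq> A, sending Z h to A h *)
definition quot_map :: "('g, 'm) monoid_scheme \<Rightarrow> 'g set \<Rightarrow> 'g set \<Rightarrow> 'g set \<Rightarrow> 'g set \<Rightarrow> 'g set" where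
  "quot_map G H Z A = (\<lambda>C\<in>carrier ((G\<lparr>carrier := H\<rparr>) Mod Z). A <#>\<^bsub>G\<^esub> C)"

end

theory Submission
  imports Defs
begin

text \<open>
  For a central subgroup \<open>B\<close> of \<open>P\<close>, a class in \<open>H\<^sup>2(P/B, D)\<close> dies in \<open>H\<^sup>2(P, D)\<close> iff it is the
  transgression of a character \<open>\<chi>\<close> of \<open>B\<close>; as \<open>D\<close> is divisible, the transgression of \<open>\<chi>\<close> vanishes iff
  \<open>\<chi>\<close> is trivial on \<open>B \<inter> P'\<close>. This computes \<open>L\<close> and \<open>M\<close>.

  For (i), \<open>G/A = H/A \<times> K/A\<close>, and the cocycles \<open>f(h, h') g(k, k') \<beta>(h, k')\<close> with \<open>\<beta>\<close> bimultiplicative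
  are inflated to \<open>G\<close>. Such a cocycle is a coboundary iff \<open>\<beta> = 1\<close> and \<open>f\<close>, \<open>g\<close> are transgressions of a
  common character of \<open>A\<close>. Since \<open>L\<close> and \<open>M\<close> consist of the transgressions of characters of \<open>A\<close> that
  are trivial on \<open>Z\<close>, the pairs of transgressions of a common character form, modulo \<open>L \<oplus> M\<close>, a copy of
  \<open>Hom(Z, D)\<close>.

  For (ii), the commutator pairing \<open>H \<times> K \<rightarrow> D\<close> of a central extension of \<open>G\<close> is bimultiplicative, so it
  kills \<open>H \<times> K'\<close> and \<open>H' \<times> K\<close>, and \<open>Z\<close> stays central in the extension. Hence every class of
  \<open>H\<^sup>2(G, D)\<close> is inflated from \<open>G/Z\<close>. It is determined by the commutator pairing and by the restrictions
  to \<open>H/Z\<close> and \<open>K/Z\<close>, the latter up to the transgressions of a common character of \<open>Z\<close>: splittings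
  over \<open>H\<close> and \<open>K\<close> that agree on \<open>Z\<close> can be corrected to agree on \<open>A\<close>, because a character of \<open>A\<close> that
  is trivial on \<open>Z = H' \<inter> K'\<close> is the product of restrictions of characters of \<open>H\<close> and \<open>K\<close>.
\<close>

section \<open>Homomorphisms into divisible groups\<close>

text \<open>Every map in the statement depends on choices: a cocycle in a class, a trivialization of
  it, a character extending a given one. None of them is made canonically. Each isomorphism and
  embedding is given by a relation closed under division, and well-definedness and injectivity are
  the two directions of one equivalence, \<open>y = 1\<close> iff \<open>w = 1\<close>. The work
  then lies in deciding when a cocycle assembled from data on \<open>H\<close> and \<open>K\<close>
  is a coboundary on \<open>G\<close>. The obstacle is that a function on \<open>G = HK\<close>
  cannot be prescribed freely on \<open>H\<close> and \<open>K\<close>: the prescriptions meet in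
  \<open>A\<close>, and trivializations over \<open>H\<close> and \<open>K\<close> match on
  \<open>A\<close> only up to a character. Divisibility of \<open>D\<close> enters through a single
  fact: a character of a subgroup \<open>S\<close> of a possibly nonabelian \<open>P\<close> extends
  to \<open>P\<close> if it is trivial on the intersection of \<open>S\<close> and
  \<open>P'\<close>. Applied to the diagonal copy of \<open>A\<close> in \<open>H x K\<close>, it
  explains why \<open>Z\<close>, and not \<open>A\<close>, carries the obstruction. Cocycles are not
  normalized, which accounts for the constants \<open>f (1, 1)\<close> and \<open>u 1\<close>
  throughout.\<close>

lemma
  assumes Y: "group Y" and W: "group W"
    and dom: "\<And>y. y \<in> carrier Y \<Longrightarrow> \<exists>w. R y w"
    and car: "\<And>y w. R y w \<Longrightarrow> y \<in> carrier Y \<and> w \<in> carrier W"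
    and div: "\<And>y w y' w'. R y w \<Longrightarrow> R y' w' \<Longrightarrow>
                R (y \<otimes>\<^bsub>Y\<^esub> inv\<^bsub>Y\<^esub> y') (w \<otimes>\<^bsub>W\<^esub> inv\<^bsub>W\<^esub> w')"
    and ker: "\<And>y w. R y w \<Longrightarrow> y = \<one>\<^bsub>Y\<^esub> \<longleftrightarrow> w = \<one>\<^bsub>W\<^esub>"
  shows embeds_by_relation: "embeds Y W"
    and iso_by_relation: "(\<And>w. w \<in> carrier W \<Longrightarrow> \<exists>y. R y w) \<Longrightarrow> Y \<cong> W"
proof -
  interpret Y: group Y by fact
  interpret W: group W by fact
  \<comment> \<open>From left to right this makes \<open>R\<close> single-valued, from right to left
    it makes the resulting map injective.\<close>
  have eq: "y = y' \<longleftrightarrow> w = w'" if "R y w" "R y' w'" for y w y' w'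
    using ker[OF div[OF that]] car[OF that(1)] car[OF that(2)]
    by (metis Y.inv_closed Y.inv_equality Y.inv_inv Y.r_inv W.inv_closed W.inv_equality W.inv_inv W.r_inv)
  have one: "R \<one>\<^bsub>Y\<^esub> \<one>\<^bsub>W\<^esub>"
    using dom[OF Y.one_closed] div car by (metis Y.r_inv W.r_inv)
  have inv: "R (inv\<^bsub>Y\<^esub> y) (inv\<^bsub>W\<^esub> w)" if "R y w" for y w
    using div[OF one that] car[OF that] by simp
  have mult: "R (y \<otimes>\<^bsub>Y\<^esub> y') (w \<otimes>\<^bsub>W\<^esub> w')" if "R y w" "R y' w'" for y w y' w'
    using div[OF that(1) inv[OF that(2)]] car[OF that(2)] by simp
  define \<phi> where "\<phi> y = (SOME w. R y w)" for y
  have \<phi>: "R y (\<phi> y)" if "y \<in> carrier Y" for y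
    unfolding \<phi>_def by (rule someI_ex[OF dom[OF that]])
  have hom: "\<phi> \<in> hom Y W"
  proof (rule homI)
    fix x y assume xy: "x \<in> carrier Y" "y \<in> carrier Y"
    show "\<phi> (x \<otimes>\<^bsub>Y\<^esub> y) = \<phi> x \<otimes>\<^bsub>W\<^esub> \<phi> y"
      using eq[OF \<phi>[OF Y.m_closed[OF xy]] mult[OF \<phi>[OF xy(1)] \<phi>[OF xy(2)]]] by simp
  qed (use car[OF \<phi>] in simp)
  have inj: "inj_on \<phi> (carrier Y)"
    using eq[OF \<phi> \<phi>] by (auto intro!: inj_onI)
  show "embeds Y W" unfolding embeds_def using hom inj by blast
  show "Y \<cong> W" if onto: "\<And>w. w \<in> carrier W \<Longrightarrow> \<exists>y. R y w"
  proof -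
    have "\<phi> ` carrier Y = carrier W"
    proof
      show "\<phi> ` carrier Y \<subseteq> carrier W" using car[OF \<phi>] by auto
      show "carrier W \<subseteq> \<phi> ` carrier Y"
      proof
        fix w assume "w \<in> carrier W"
        then obtain y where y: "R y w" using onto by blast
        then show "w \<in> \<phi> ` carrier Y" using eq[OF y \<phi>] car[OF y] by auto
      qed
    qed
    then show ?thesis
      unfolding is_iso_def iso_def bij_betw_def using hom inj by blast
  qed
qed

lemma (in group) inv_cancel_left:
  assumes "x \<in> carrier G" "y \<in> carrier G"
  shows "inv x \<otimes> (x \<otimes> y) = y" and "x \<otimes> (inv x \<otimes> y) = y"
  using assms by (simp_all add: m_assoc[symmetric])

lemma (in group) commutator_in_derived:
  assumes "x \<in> carrier G" "y \<in> carrier G"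
  shows "x \<otimes> y \<otimes> inv x \<otimes> inv y \<in> derived G (carrier G)"
  unfolding derived_def using assms by (intro generate.incl) blast

text \<open>A partial homomorphism is represented by its graph, a subgroup of \<open>P \<times>\<times> D\<close>. A maximal
  graph contains \<open>P' \<times> {1}\<close>, hence is normal, and can be enlarged by a cyclic group.\<close>

lemma divisible_extension:
  fixes P :: "('p, 'm) monoid_scheme" and D :: "('d, 'n) monoid_scheme"
  assumes "group P" "comm_group D" "divisible_group D" and S: "subgroup S P"
    and \<chi>: "\<chi> \<in> hom (P\<lparr>carrier := S\<rparr>) D"
    and triv: "\<And>s. s \<in> S \<Longrightarrow> s \<in> derived P (carrier P) \<Longrightarrow> \<chi> s = \<one>\<^bsub>D\<^esub>"
  shows "\<exists>\<psi>\<in>hom P D. \<forall>s\<in>S. \<psi> s = \<chi> s"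
proof -
  interpret P: group P by fact
  interpret D: comm_group D by fact
  let ?X = "P \<times>\<times> D"
  interpret X: group ?X using DirProd_group P.is_group D.is_group by blast
  let ?P' = "derived P (carrier P)"
  interpret P': normal ?P' P using P.derived_self_is_normal .
  \<comment> \<open>At \<open>p = 1\<close> the last condition says that the graph is single-valued.
    It is demanded on all of \<open>P'\<close> because every total graph satisfies it,
    \<open>D\<close> being abelian.\<close>
  define \<G> where "\<G> = {\<Gamma>. subgroup \<Gamma> ?X \<and> (\<lambda>s. (s, \<chi> s)) ` S \<subseteq> \<Gamma>
     \<and> (\<forall>p d. (p, d) \<in> \<Gamma> \<longrightarrow> p \<in> ?P' \<longrightarrow> d = \<one>\<^bsub>D\<^esub>)}"
  interpret S: group "P\<lparr>carrier := S\<rparr>" using P.subgroup_imp_group S .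
  interpret \<chi>: group_hom "P\<lparr>carrier := S\<rparr>" D \<chi>
    by unfold_locales (rule \<chi>)
  have graph: "(\<lambda>s. (s, \<chi> s)) ` S \<in> \<G>"
  proof -
    have "subgroup ((\<lambda>s. (s, \<chi> s)) ` S) ?X"
    proof (rule X.subgroupI)
      show "(\<lambda>s. (s, \<chi> s)) ` S \<subseteq> carrier ?X"
        using subgroup.subset[OF S] \<chi>.hom_closed by auto
      show "(\<lambda>s. (s, \<chi> s)) ` S \<noteq> {}" using subgroup.one_closed[OF S] by auto
    next
      fix a assume "a \<in> (\<lambda>s. (s, \<chi> s)) ` S"
      then obtain s where s: "s \<in> S" "a = (s, \<chi> s)" by auto
      have "inv\<^bsub>?X\<^esub> a = (inv\<^bsub>P\<^esub> s, \<chi> (inv\<^bsub>P\<^esub> s))"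
        using \<chi>.hom_inv[of s] \<chi>.hom_closed[of s] s subgroup.subset[OF S] P.m_inv_consistent[OF S]
        by (auto simp: inv_DirProd[OF P.is_group D.is_group])
      then show "inv\<^bsub>?X\<^esub> a \<in> (\<lambda>s. (s, \<chi> s)) ` S"
        using subgroup.m_inv_closed[OF S s(1)] by auto
    next
      fix a b assume "a \<in> (\<lambda>s. (s, \<chi> s)) ` S" "b \<in> (\<lambda>s. (s, \<chi> s)) ` S"
      then obtain s t where s: "s \<in> S" "a = (s, \<chi> s)" "t \<in> S" "b = (t, \<chi> t)" by auto
      have "a \<otimes>\<^bsub>?X\<^esub> b = (s \<otimes>\<^bsub>P\<^esub> t, \<chi> (s \<otimes>\<^bsub>P\<^esub> t))"
        using \<chi>.hom_mult[of s t] s by simp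
      then show "a \<otimes>\<^bsub>?X\<^esub> b \<in> (\<lambda>s. (s, \<chi> s)) ` S"
        using subgroup.m_closed[OF S s(1) s(3)] by auto
    qed
    then show ?thesis unfolding \<G>_def using triv by auto
  qed
  have "\<exists>\<Gamma>\<in>\<G>. \<forall>\<Delta>\<in>\<G>. \<Gamma> \<subseteq> \<Delta> \<longrightarrow> \<Delta> = \<Gamma>"
  proof (rule subset_Zorn_nonempty)
    show "\<G> \<noteq> {}" using graph by auto
    fix \<C> assume ne: "\<C> \<noteq> {}" and ch: "subset.chain \<G> \<C>"
    then have sub: "\<And>c. c \<in> \<C> \<Longrightarrow> c \<in> \<G>" and tot: "\<And>c d. c \<in> \<C> \<Longrightarrow> d \<in> \<C> \<Longrightarrow> c \<subseteq> d \<or> d \<subseteq> c"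
      by (auto simp: subset.chain_def)
    have sg: "\<And>c. c \<in> \<C> \<Longrightarrow> subgroup c ?X" using sub \<G>_def by auto
    have "subgroup (\<Union>\<C>) ?X"
    proof (rule X.subgroupI)
      show "\<Union>\<C> \<subseteq> carrier ?X" using subgroup.subset[OF sg] by blast
      show "\<Union>\<C> \<noteq> {}" using ne subgroup.one_closed[OF sg] by auto
      show "inv\<^bsub>?X\<^esub> a \<in> \<Union>\<C>" if "a \<in> \<Union>\<C>" for a
        using that subgroup.m_inv_closed[OF sg] by blast
      show "a \<otimes>\<^bsub>?X\<^esub> b \<in> \<Union>\<C>" if ab: "a \<in> \<Union>\<C>" "b \<in> \<Union>\<C>" for a b
      proof -
        obtain c d where cd: "c \<in> \<C>" "a \<in> c" "d \<in> \<C>" "b \<in> d" using ab by blast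
        then obtain c where "c \<in> \<C>" "a \<in> c" "b \<in> c" using tot[OF cd(1) cd(3)] by blast
        then show ?thesis using subgroup.m_closed[OF sg] by blast
      qed
    qed
    moreover have "(\<lambda>s. (s, \<chi> s)) ` S \<subseteq> \<Union>\<C>" using ne sub unfolding \<G>_def by blast
    moreover have "\<forall>p d. (p, d) \<in> \<Union>\<C> \<longrightarrow> p \<in> ?P' \<longrightarrow> d = \<one>\<^bsub>D\<^esub>" using sub unfolding \<G>_def by blast
    ultimately show "\<Union>\<C> \<in> \<G>" unfolding \<G>_def by blast
  qed
  then obtain \<Gamma> where \<Gamma>: "\<Gamma> \<in> \<G>" and max: "\<And>\<Delta>. \<Delta> \<in> \<G> \<Longrightarrow> \<Gamma> \<subseteq> \<Delta> \<Longrightarrow> \<Delta> = \<Gamma>" by metis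
  then have sg: "subgroup \<Gamma> ?X" and S\<Gamma>: "(\<lambda>s. (s, \<chi> s)) ` S \<subseteq> \<Gamma>"
    and tr: "\<And>p d. (p, d) \<in> \<Gamma> \<Longrightarrow> p \<in> ?P' \<Longrightarrow> d = \<one>\<^bsub>D\<^esub>" unfolding \<G>_def by auto
  interpret \<Gamma>: subgroup \<Gamma> ?X by (rule sg)
  have car: "p \<in> carrier P \<and> d \<in> carrier D" if "(p, d) \<in> \<Gamma>" for p d
    using \<Gamma>.subset that by auto
  have one: "(\<one>\<^bsub>P\<^esub>, \<one>\<^bsub>D\<^esub>) \<in> \<Gamma>" using \<Gamma>.one_closed by simp
  have mul: "(p \<otimes>\<^bsub>P\<^esub> q, d \<otimes>\<^bsub>D\<^esub> e) \<in> \<Gamma>" if "(p, d) \<in> \<Gamma>" "(q, e) \<in> \<Gamma>" for p q d e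
    using \<Gamma>.m_closed[OF that] by simp
  have inv: "(inv\<^bsub>P\<^esub> p, inv\<^bsub>D\<^esub> d) \<in> \<Gamma>" if "(p, d) \<in> \<Gamma>" for p d
    using \<Gamma>.m_inv_closed[OF that] car[OF that] inv_DirProd[OF P.is_group D.is_group] by simp
  \<comment> \<open>By maximality: multiplying by the normal subgroup \<open>P' x {1}\<close> stays
    in the family, because \<open>r q\<close> and \<open>r\<close> in \<open>P'\<close> force
    \<open>q\<close> into \<open>P'\<close>.\<close>
  have P'\<Gamma>: "(p, \<one>\<^bsub>D\<^esub>) \<in> \<Gamma>" if p: "p \<in> ?P'" for p
  proof -
    have nN: "(?P' \<times> {\<one>\<^bsub>D\<^esub>}) \<lhd> ?X"
      using P.DirProd_normal[OF D.is_group P'.normal_axioms D.one_is_normal] .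
    let ?\<Delta> = "(?P' \<times> {\<one>\<^bsub>D\<^esub>}) <#>\<^bsub>?X\<^esub> \<Gamma>"
    have sub: "\<Gamma> \<subseteq> ?\<Delta>"
    proof
      fix a assume a: "a \<in> \<Gamma>"
      then have "a = (\<one>\<^bsub>P\<^esub>, \<one>\<^bsub>D\<^esub>) \<otimes>\<^bsub>?X\<^esub> a" using car by (cases a) auto
      then show "a \<in> ?\<Delta>" unfolding set_mult_def using a P'.one_closed by blast
    qed
    have "?\<Delta> \<in> \<G>"
    proof -
      have "d = \<one>\<^bsub>D\<^esub>" if "(x, d) \<in> ?\<Delta>" "x \<in> ?P'" for x d
      proof -
        obtain r q e where r: "r \<in> ?P'" "(q, e) \<in> \<Gamma>" "x = r \<otimes>\<^bsub>P\<^esub> q" "d = \<one>\<^bsub>D\<^esub> \<otimes>\<^bsub>D\<^esub> e"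
          using \<open>(x, d) \<in> ?\<Delta>\<close> unfolding set_mult_def by auto
        have "q = inv\<^bsub>P\<^esub> r \<otimes>\<^bsub>P\<^esub> x" using r car[OF r(2)] P'.mem_carrier[OF r(1)]
          by (simp add: P.m_assoc[symmetric])
        then have "q \<in> ?P'" using r(1) \<open>x \<in> ?P'\<close> by auto
        then have "e = \<one>\<^bsub>D\<^esub>" by (rule tr[OF r(2)])
        then show ?thesis unfolding r(4) by simp
      qed
      moreover have "subgroup ?\<Delta> ?X" using X.mult_norm_subgroup[OF nN sg] .
      ultimately show ?thesis unfolding \<G>_def using sub S\<Gamma> by blast
    qed
    then have "?\<Delta> = \<Gamma>" using max sub by blast
    moreover have "(p, \<one>\<^bsub>D\<^esub>) \<otimes>\<^bsub>?X\<^esub> (\<one>\<^bsub>P\<^esub>, \<one>\<^bsub>D\<^esub>) \<in> ?\<Delta>"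
      unfolding set_mult_def using p one by blast
    ultimately show ?thesis using P'.mem_carrier[OF p] by simp
  qed
  \<comment> \<open>Conjugation changes \<open>p\<close> by a commutator, to which
    \<open>\<Gamma>\<close> assigns \<open>1\<close>, so the value is kept. This replaces
    commutativity of \<open>P\<close> when powers of \<open>g\<close> are adjoined.\<close>
  have conj: "(x \<otimes>\<^bsub>P\<^esub> p \<otimes>\<^bsub>P\<^esub> inv\<^bsub>P\<^esub> x, d) \<in> \<Gamma>" if x: "x \<in> carrier P" and p: "(p, d) \<in> \<Gamma>" for x p d
  proof -
    have "(x \<otimes>\<^bsub>P\<^esub> p \<otimes>\<^bsub>P\<^esub> inv\<^bsub>P\<^esub> x \<otimes>\<^bsub>P\<^esub> inv\<^bsub>P\<^esub> p, \<one>\<^bsub>D\<^esub>) \<in> \<Gamma>"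
      using P'\<Gamma> P.commutator_in_derived x car[OF p] by blast
    from mul[OF this p] show ?thesis using x car[OF p] by (simp add: P.m_assoc)
  qed
  have total: "\<exists>d. (g, d) \<in> \<Gamma>" if g: "g \<in> carrier P" for g
  proof -
    \<comment> \<open>The value \<open>e\<close> for \<open>g\<close> must be compatible with every
      power of \<open>g\<close> on which \<open>\<Gamma>\<close> is already defined. If no positive
      power is, \<open>e = 1\<close> serves. Otherwise \<open>e\<close> is an \<open>n\<close>-th
      root of the value at the least such exponent \<open>n\<close>; this is where divisibility
      enters.\<close>
    have "\<exists>e\<in>carrier D. \<forall>k::int. \<forall>d. (g [^]\<^bsub>P\<^esub> k, d) \<in> \<Gamma> \<longrightarrow> (g [^]\<^bsub>P\<^esub> k, e [^]\<^bsub>D\<^esub> k) \<in> \<Gamma>"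
    proof (cases "\<exists>n::nat. n > 0 \<and> (\<exists>d. (g [^]\<^bsub>P\<^esub> n, d) \<in> \<Gamma>)")
      case False
      have "k = 0" if "(g [^]\<^bsub>P\<^esub> k, d) \<in> \<Gamma>" for k :: int and d
      proof (rule ccontr)
        assume "k \<noteq> 0"
        then consider "k > 0" | "k < 0" by linarith
        then show False
        proof cases
          case 1
          then obtain m where m: "m > 0" "k = int m" using zero_less_imp_eq_int by blast
          have "(g [^]\<^bsub>P\<^esub> m, d) \<in> \<Gamma>" using that unfolding m(2) int_pow_int .
          then show False using False m(1) by blast
        next
          case 2
          then obtain m where m: "m > 0" "- k = int m" using zero_less_imp_eq_int[of "- k"] by auto
          have "inv\<^bsub>P\<^esub> (g [^]\<^bsub>P\<^esub> k) = g [^]\<^bsub>P\<^esub> m"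
            unfolding P.int_pow_neg[OF g, of k, symmetric] m(2) int_pow_int ..
          then have "(g [^]\<^bsub>P\<^esub> m, inv\<^bsub>D\<^esub> d) \<in> \<Gamma>" using inv[OF that] by simp
          then show False using False m(1) by blast
        qed
      qed
      then have "\<forall>k::int. \<forall>d. (g [^]\<^bsub>P\<^esub> k, d) \<in> \<Gamma> \<longrightarrow> (g [^]\<^bsub>P\<^esub> k, \<one>\<^bsub>D\<^esub> [^]\<^bsub>D\<^esub> k) \<in> \<Gamma>"
        using one by fastforce
      then show ?thesis using D.one_closed by blast
    next
      case True
      define n where "n = (LEAST n::nat. n > 0 \<and> (\<exists>d. (g [^]\<^bsub>P\<^esub> n, d) \<in> \<Gamma>))"
      from LeastI_ex[OF True] obtain d where n: "n > 0" "(g [^]\<^bsub>P\<^esub> n, d) \<in> \<Gamma>" unfolding n_def by blast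
      have least: "m = 0" if "m < n" "(g [^]\<^bsub>P\<^esub> m, d') \<in> \<Gamma>" for m d'
        using not_less_Least[of m "\<lambda>n. n > 0 \<and> (\<exists>d. (g [^]\<^bsub>P\<^esub> n, d) \<in> \<Gamma>)"] that unfolding n_def by auto
      obtain e where e: "e \<in> carrier D" "e [^]\<^bsub>D\<^esub> n = d"
        using \<open>divisible_group D\<close> n car[OF n(2)] unfolding divisible_group_def by blast
      have npow: "(g [^]\<^bsub>P\<^esub> (int n * q), e [^]\<^bsub>D\<^esub> (int n * q)) \<in> \<Gamma>" for q :: int
      proof -
        have nat: "(g [^]\<^bsub>P\<^esub> (int n * int q), e [^]\<^bsub>D\<^esub> (int n * int q)) \<in> \<Gamma>" for q :: nat
        proof (induction q)
          case 0 then show ?case using one by simp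
        next
          case (Suc q)
          have "(g [^]\<^bsub>P\<^esub> int n, e [^]\<^bsub>D\<^esub> int n) \<in> \<Gamma>" using n e by (simp add: int_pow_int)
          from mul[OF this Suc] show ?case
            using g e by (simp add: P.int_pow_mult[symmetric] D.int_pow_mult[symmetric] algebra_simps)
        qed
        show ?thesis
        proof (cases "q \<ge> 0")
          case True then show ?thesis using nat[of "nat q"] by simp
        next
          case False
          then show ?thesis using inv[OF nat[of "nat (- q)"]] g e
            by (simp add: P.int_pow_neg[symmetric] D.int_pow_neg[symmetric])
        qed
      qed
      have "(g [^]\<^bsub>P\<^esub> k, e [^]\<^bsub>D\<^esub> k) \<in> \<Gamma>" if k: "(g [^]\<^bsub>P\<^esub> k, d') \<in> \<Gamma>" for k :: int and d'
      proof -
        \<comment> \<open>Division with remainder: by leastness of \<open>n\<close>, every exponent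
          that occurs is a multiple of \<open>n\<close>.\<close>
        let ?q = "k div int n" let ?r = "nat (k mod int n)"
        have kr: "k + - (int n * ?q) = int ?r" using n(1) by (simp add: minus_mult_div_eq_mod)
        have "(g [^]\<^bsub>P\<^esub> (k + - (int n * ?q)), d' \<otimes>\<^bsub>D\<^esub> inv\<^bsub>D\<^esub> (e [^]\<^bsub>D\<^esub> (int n * ?q))) \<in> \<Gamma>"
          using mul[OF k inv[OF npow[of ?q]]] g by (simp add: P.int_pow_diff)
        then have "?r = 0" using least[of ?r] n(1) unfolding kr by (simp add: int_pow_int nat_less_iff)
        then have "k = int n * ?q" using kr by simp
        then show ?thesis using npow[of ?q] by simp
      qed
      then show ?thesis using e(1) by blast
    qed
    then obtain e where e: "e \<in> carrier D"
      and ek: "\<And>k::int. \<And>d. (g [^]\<^bsub>P\<^esub> k, d) \<in> \<Gamma> \<Longrightarrow> (g [^]\<^bsub>P\<^esub> k, e [^]\<^bsub>D\<^esub> k) \<in> \<Gamma>" by blast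
    let ?\<Delta> = "{(p \<otimes>\<^bsub>P\<^esub> g [^]\<^bsub>P\<^esub> k, d \<otimes>\<^bsub>D\<^esub> e [^]\<^bsub>D\<^esub> k) | p d k. (p, d) \<in> \<Gamma> \<and> (k::int) \<in> UNIV}"
    have "subgroup ?\<Delta> ?X"
    proof (rule X.subgroupI)
      show "?\<Delta> \<subseteq> carrier ?X" using car g e by auto
      show "?\<Delta> \<noteq> {}" using one by blast
    next
      fix a assume "a \<in> ?\<Delta>"
      then obtain p d k where a: "(p, d) \<in> \<Gamma>" "a = (p \<otimes>\<^bsub>P\<^esub> g [^]\<^bsub>P\<^esub> k, d \<otimes>\<^bsub>D\<^esub> e [^]\<^bsub>D\<^esub> (k::int))" by blast
      have "(g [^]\<^bsub>P\<^esub> (-k) \<otimes>\<^bsub>P\<^esub> inv\<^bsub>P\<^esub> p \<otimes>\<^bsub>P\<^esub> inv\<^bsub>P\<^esub> (g [^]\<^bsub>P\<^esub> (-k)), inv\<^bsub>D\<^esub> d) \<in> \<Gamma>"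
        using conj inv a(1) g by simp
      moreover have "inv\<^bsub>?X\<^esub> a = ((g [^]\<^bsub>P\<^esub> (-k) \<otimes>\<^bsub>P\<^esub> inv\<^bsub>P\<^esub> p \<otimes>\<^bsub>P\<^esub> inv\<^bsub>P\<^esub> (g [^]\<^bsub>P\<^esub> (-k))) \<otimes>\<^bsub>P\<^esub> g [^]\<^bsub>P\<^esub> (-k),
           inv\<^bsub>D\<^esub> d \<otimes>\<^bsub>D\<^esub> e [^]\<^bsub>D\<^esub> (-k))"
        using a(2) car[OF a(1)] g e
        by (simp add: inv_DirProd[OF P.is_group D.is_group] P.inv_mult_group D.inv_mult P.m_assoc P.int_pow_neg D.int_pow_neg)
      ultimately show "inv\<^bsub>?X\<^esub> a \<in> ?\<Delta>" by blast
    next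
      fix a b assume "a \<in> ?\<Delta>" "b \<in> ?\<Delta>"
      then obtain p d k q c l where a: "(p, d) \<in> \<Gamma>" "a = (p \<otimes>\<^bsub>P\<^esub> g [^]\<^bsub>P\<^esub> k, d \<otimes>\<^bsub>D\<^esub> e [^]\<^bsub>D\<^esub> (k::int))"
        "(q, c) \<in> \<Gamma>" "b = (q \<otimes>\<^bsub>P\<^esub> g [^]\<^bsub>P\<^esub> l, c \<otimes>\<^bsub>D\<^esub> e [^]\<^bsub>D\<^esub> (l::int))" by blast
      have "(p \<otimes>\<^bsub>P\<^esub> (g [^]\<^bsub>P\<^esub> k \<otimes>\<^bsub>P\<^esub> q \<otimes>\<^bsub>P\<^esub> inv\<^bsub>P\<^esub> (g [^]\<^bsub>P\<^esub> k)), d \<otimes>\<^bsub>D\<^esub> c) \<in> \<Gamma>"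
        using mul conj a(1,3) g by simp
      moreover have "a \<otimes>\<^bsub>?X\<^esub> b = ((p \<otimes>\<^bsub>P\<^esub> (g [^]\<^bsub>P\<^esub> k \<otimes>\<^bsub>P\<^esub> q \<otimes>\<^bsub>P\<^esub> inv\<^bsub>P\<^esub> (g [^]\<^bsub>P\<^esub> k))) \<otimes>\<^bsub>P\<^esub> g [^]\<^bsub>P\<^esub> (k + l),
          (d \<otimes>\<^bsub>D\<^esub> c) \<otimes>\<^bsub>D\<^esub> e [^]\<^bsub>D\<^esub> (k + l))"
        using a(2,4) car[OF a(1)] car[OF a(3)] g e
        by (simp add: P.m_assoc D.m_ac P.int_pow_mult D.int_pow_mult P.inv_cancel_left)
      ultimately show "a \<otimes>\<^bsub>?X\<^esub> b \<in> ?\<Delta>" by blast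
    qed
    moreover have sub: "\<Gamma> \<subseteq> ?\<Delta>"
    proof
      fix a assume a: "a \<in> \<Gamma>"
      then have "a = (fst a \<otimes>\<^bsub>P\<^esub> g [^]\<^bsub>P\<^esub> (0::int), snd a \<otimes>\<^bsub>D\<^esub> e [^]\<^bsub>D\<^esub> (0::int))" using car by (cases a) auto
      then show "a \<in> ?\<Delta>" using a by (metis (mono_tags, lifting) UNIV_I mem_Collect_eq prod.collapse)
    qed
    \<comment> \<open>The condition on \<open>P'\<close> survives: \<open>g [^] k\<close> differs
      from \<open>x\<close> in \<open>P'\<close> by an element of the domain of
      \<open>\<Gamma>\<close>, so by the choice of \<open>e\<close> the pair \<open>(x, d)\<close>
      already lies in \<open>\<Gamma>\<close>.\<close>
    moreover have "d = \<one>\<^bsub>D\<^esub>" if xd: "(x, d) \<in> ?\<Delta>" and x: "x \<in> ?P'" for x d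
    proof -
      obtain p c k where a: "(p, c) \<in> \<Gamma>" "x = p \<otimes>\<^bsub>P\<^esub> g [^]\<^bsub>P\<^esub> (k::int)" "d = c \<otimes>\<^bsub>D\<^esub> e [^]\<^bsub>D\<^esub> k"
        using xd by blast
      have "g [^]\<^bsub>P\<^esub> k = inv\<^bsub>P\<^esub> p \<otimes>\<^bsub>P\<^esub> x" using a car[OF a(1)] g by (simp add: P.m_assoc[symmetric])
      then have "(g [^]\<^bsub>P\<^esub> k, inv\<^bsub>D\<^esub> c \<otimes>\<^bsub>D\<^esub> \<one>\<^bsub>D\<^esub>) \<in> \<Gamma>"
        using mul[OF inv[OF a(1)] P'\<Gamma>[OF x]] by simp
      from mul[OF a(1) ek[OF this]] have "(x, d) \<in> \<Gamma>" using a by simp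
      then show ?thesis using tr x by blast
    qed
    ultimately have "?\<Delta> \<in> \<G>" unfolding \<G>_def using S\<Gamma> by blast
    then have "?\<Delta> = \<Gamma>" using max sub by blast
    moreover have "(\<one>\<^bsub>P\<^esub> \<otimes>\<^bsub>P\<^esub> g [^]\<^bsub>P\<^esub> (1::int), \<one>\<^bsub>D\<^esub> \<otimes>\<^bsub>D\<^esub> e [^]\<^bsub>D\<^esub> (1::int)) \<in> ?\<Delta>" using one by blast
    ultimately show ?thesis using g by auto
  qed
  have uniq: "d = e" if d: "(g, d) \<in> \<Gamma>" and e: "(g, e) \<in> \<Gamma>" for g d e
  proof -
    have "d \<otimes>\<^bsub>D\<^esub> inv\<^bsub>D\<^esub> e = \<one>\<^bsub>D\<^esub>"
      using mul[OF d inv[OF e]] tr[of "\<one>\<^bsub>P\<^esub>"] P'.one_closed car[OF e] by simp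
    then show ?thesis using car[OF d] car[OF e] by (metis D.inv_closed D.inv_equality D.inv_inv)
  qed
  define \<psi> where "\<psi> g = (SOME d. (g, d) \<in> \<Gamma>)" for g
  have \<psi>: "(g, \<psi> g) \<in> \<Gamma>" if "g \<in> carrier P" for g
    unfolding \<psi>_def by (rule someI_ex[OF total[OF that]])
  have "\<psi> \<in> hom P D"
    using car[OF \<psi>] uniq[OF \<psi> mul[OF \<psi> \<psi>]] by (auto intro!: homI)
  moreover have "\<forall>s\<in>S. \<psi> s = \<chi> s"
    using S\<Gamma> uniq[OF \<psi>] subgroup.subset[OF S] by blast
  ultimately show ?thesis by blast
qed

section \<open>Second cohomology with trivial coefficients\<close>

lemma (in normal) rcos_eq_self_iff:
  assumes "x \<in> carrier G" shows "H #> x = H \<longleftrightarrow> x \<in> H"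
  using coset_join1[OF _ assms subgroup_axioms] coset_join2[OF assms subgroup_axioms] by blast

lemma (in normal) rcos_div:
  assumes "x \<in> carrier G" "y \<in> carrier G"
  shows "(H #> x) \<otimes>\<^bsub>G Mod H\<^esub> inv\<^bsub>G Mod H\<^esub> (H #> y) = H #> (x \<otimes> inv y)"
proof -
  interpret h: group_hom G "G Mod H" "\<lambda>a. H #> a"
    using r_coset_hom_Mod factorgroup_is_group is_group
    by (simp add: group_hom_def group_hom_axioms_def)
  show ?thesis using assms by (metis h.hom_mult h.hom_inv inv_closed)
qed

lemma (in normal) rcos_one: "H #> \<one> = H"
  using rcos_eq_self_iff by auto

text \<open>The function \<open>u\<close> is kept as explicit data, since its values on central
  subgroups are what counts later. Only values of \<open>f\<close> on the carrier enter, so the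
  notion also applies to a cocycle of \<open>G\<close> restricted to a subgroup.\<close>

definition cobounds :: "('x, 'm) monoid_scheme \<Rightarrow> ('d, 'n) monoid_scheme \<Rightarrow> ('x \<times> 'x \<Rightarrow> 'd) \<Rightarrow> ('x \<Rightarrow> 'd) \<Rightarrow> bool" where
  "cobounds P D f u \<longleftrightarrow> u \<in> carrier P \<rightarrow> carrier D \<and>
     (\<forall>x\<in>carrier P. \<forall>y\<in>carrier P. f (x, y) \<otimes>\<^bsub>D\<^esub> u (x \<otimes>\<^bsub>P\<^esub> y) = u x \<otimes>\<^bsub>D\<^esub> u y)"

definition H2_class :: "('x, 'm) monoid_scheme \<Rightarrow> ('d, 'n) monoid_scheme \<Rightarrow> ('x \<times> 'x \<Rightarrow> 'd) \<Rightarrow> ('x \<times> 'x \<Rightarrow> 'd) set" where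
  "H2_class P D f = coboundaries P D #>\<^bsub>cocycle_group P D\<^esub> f"

definition pullback :: "('x, 'm) monoid_scheme \<Rightarrow> ('x \<Rightarrow> 'y) \<Rightarrow> ('y \<times> 'y \<Rightarrow> 'd) \<Rightarrow> ('x \<times> 'x \<Rightarrow> 'd)" where
  "pullback P \<phi> f = (\<lambda>p\<in>carrier P \<times> carrier P. f (\<phi> (fst p), \<phi> (snd p)))"

lemma pullback_apply [simp]:
  "x \<in> carrier P \<Longrightarrow> y \<in> carrier P \<Longrightarrow> pullback P \<phi> f (x, y) = f (\<phi> x, \<phi> y)"
  by (simp add: pullback_def)

lemma (in comm_group) div_mult_div:
  assumes "a \<in> carrier G" "b \<in> carrier G" "c \<in> carrier G" "d \<in> carrier G"
  shows "(a \<otimes> inv b) \<otimes> (c \<otimes> inv d) = (a \<otimes> c) \<otimes> inv (b \<otimes> d)"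
  using assms by (simp add: inv_mult m_ac)

lemma (in comm_group) mult_mult_swap:
  assumes "a \<in> carrier G" "b \<in> carrier G" "c \<in> carrier G" "d \<in> carrier G"
  shows "(a \<otimes> b) \<otimes> (c \<otimes> d) = (a \<otimes> c) \<otimes> (b \<otimes> d)"
  using assms by (simp add: m_ac)

lemma (in group) div_eq_iff:
  assumes "a \<in> carrier G" "b \<in> carrier G" "c \<in> carrier G"
  shows "a = b \<otimes> inv c \<longleftrightarrow> a \<otimes> c = b"
  using assms by (metis inv_closed inv_inv inv_solve_right m_closed)

locale cohomology = P: group P + D: comm_group D
  for P :: "('x, 'm) monoid_scheme" and D :: "('d, 'n) monoid_scheme"
begin

abbreviation Z2 where "Z2 \<equiv> carrier (cocycle_group P D)"

lemma Z2I:
  assumes "f \<in> extensional (carrier P \<times> carrier P)"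
    and "\<And>x y. x \<in> carrier P \<Longrightarrow> y \<in> carrier P \<Longrightarrow> f (x, y) \<in> carrier D"
    and "\<And>x y z. x \<in> carrier P \<Longrightarrow> y \<in> carrier P \<Longrightarrow> z \<in> carrier P \<Longrightarrow>
       f (y, z) \<otimes>\<^bsub>D\<^esub> f (x, y \<otimes>\<^bsub>P\<^esub> z) = f (x \<otimes>\<^bsub>P\<^esub> y, z) \<otimes>\<^bsub>D\<^esub> f (x, y)"
  shows "f \<in> Z2"
  using assms by (auto simp: cocycle_group_def PiE_def)

lemma Z2_closed [simp]: "f \<in> Z2 \<Longrightarrow> x \<in> carrier P \<Longrightarrow> y \<in> carrier P \<Longrightarrow> f (x, y) \<in> carrier D"
  by (auto simp: cocycle_group_def)

lemma Z2_cocycle: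
  "f \<in> Z2 \<Longrightarrow> x \<in> carrier P \<Longrightarrow> y \<in> carrier P \<Longrightarrow> z \<in> carrier P \<Longrightarrow>
     f (y, z) \<otimes>\<^bsub>D\<^esub> f (x, y \<otimes>\<^bsub>P\<^esub> z) = f (x \<otimes>\<^bsub>P\<^esub> y, z) \<otimes>\<^bsub>D\<^esub> f (x, y)"
  by (auto simp: cocycle_group_def)

lemma Z2_extensional: "f \<in> Z2 \<Longrightarrow> f \<in> extensional (carrier P \<times> carrier P)"
  by (auto simp: cocycle_group_def PiE_def)

lemma Z2_eqI:
  assumes "f \<in> Z2" "g \<in> Z2"
    and "\<And>x y. x \<in> carrier P \<Longrightarrow> y \<in> carrier P \<Longrightarrow> f (x, y) = g (x, y)"
  shows "f = g"
  using assms by (intro extensionalityI[of _ "carrier P \<times> carrier P"] Z2_extensional) auto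

text \<open>Cocycles are not normalized. The identity at a triple with two trivial entries shows,
  here and in the mirror image, that the value is constant as soon as one argument is trivial; this
  takes the place of normalization.\<close>

lemma Z2_one_left: assumes "f \<in> Z2" "x \<in> carrier P" shows "f (\<one>\<^bsub>P\<^esub>, x) = f (\<one>\<^bsub>P\<^esub>, \<one>\<^bsub>P\<^esub>)"
proof -
  have "f (\<one>\<^bsub>P\<^esub>, x) \<otimes>\<^bsub>D\<^esub> f (\<one>\<^bsub>P\<^esub>, x) = f (\<one>\<^bsub>P\<^esub>, x) \<otimes>\<^bsub>D\<^esub> f (\<one>\<^bsub>P\<^esub>, \<one>\<^bsub>P\<^esub>)"
    using Z2_cocycle[of f "\<one>\<^bsub>P\<^esub>" "\<one>\<^bsub>P\<^esub>" x] assms by simp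
  then show ?thesis using assms by simp
qed

lemma Z2_one_right: assumes "f \<in> Z2" "x \<in> carrier P" shows "f (x, \<one>\<^bsub>P\<^esub>) = f (\<one>\<^bsub>P\<^esub>, \<one>\<^bsub>P\<^esub>)"
proof -
  have "f (\<one>\<^bsub>P\<^esub>, \<one>\<^bsub>P\<^esub>) \<otimes>\<^bsub>D\<^esub> f (x, \<one>\<^bsub>P\<^esub>) = f (x, \<one>\<^bsub>P\<^esub>) \<otimes>\<^bsub>D\<^esub> f (x, \<one>\<^bsub>P\<^esub>)"
    using Z2_cocycle[of f x "\<one>\<^bsub>P\<^esub>" "\<one>\<^bsub>P\<^esub>"] assms by simp
  then show ?thesis using assms by simp
qed

lemma mult_cocycle_group:
  "x \<in> carrier P \<Longrightarrow> y \<in> carrier P \<Longrightarrow> (f \<otimes>\<^bsub>cocycle_group P D\<^esub> g) (x, y) = f (x, y) \<otimes>\<^bsub>D\<^esub> g (x, y)"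
  by (simp add: cocycle_group_def)

lemma one_cocycle_group:
  "x \<in> carrier P \<Longrightarrow> y \<in> carrier P \<Longrightarrow> \<one>\<^bsub>cocycle_group P D\<^esub> (x, y) = \<one>\<^bsub>D\<^esub>"
  by (simp add: cocycle_group_def)

lemma Z2_mult: assumes "f \<in> Z2" "g \<in> Z2" shows "f \<otimes>\<^bsub>cocycle_group P D\<^esub> g \<in> Z2"
proof (rule Z2I)
  show "f \<otimes>\<^bsub>cocycle_group P D\<^esub> g \<in> extensional (carrier P \<times> carrier P)"
    by (simp add: cocycle_group_def)
  fix x y z assume xyz: "x \<in> carrier P" "y \<in> carrier P" "z \<in> carrier P"
  show "(f \<otimes>\<^bsub>cocycle_group P D\<^esub> g) (y, z) \<otimes>\<^bsub>D\<^esub> (f \<otimes>\<^bsub>cocycle_group P D\<^esub> g) (x, y \<otimes>\<^bsub>P\<^esub> z)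
      = (f \<otimes>\<^bsub>cocycle_group P D\<^esub> g) (x \<otimes>\<^bsub>P\<^esub> y, z) \<otimes>\<^bsub>D\<^esub> (f \<otimes>\<^bsub>cocycle_group P D\<^esub> g) (x, y)"
    using xyz assms
      D.mult_mult_swap[of "f (y, z)" "g (y, z)" "f (x, y \<otimes>\<^bsub>P\<^esub> z)" "g (x, y \<otimes>\<^bsub>P\<^esub> z)"]
      D.mult_mult_swap[of "f (x \<otimes>\<^bsub>P\<^esub> y, z)" "g (x \<otimes>\<^bsub>P\<^esub> y, z)" "f (x, y)" "g (x, y)"]
    by (simp add: mult_cocycle_group Z2_cocycle)
qed (use assms in \<open>simp add: mult_cocycle_group\<close>)

lemma Z2_inverse: assumes "f \<in> Z2" shows "(\<lambda>p\<in>carrier P \<times> carrier P. inv\<^bsub>D\<^esub> (f p)) \<in> Z2"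
proof (rule Z2I)
  fix x y z assume xyz: "x \<in> carrier P" "y \<in> carrier P" "z \<in> carrier P"
  then show "(\<lambda>p\<in>carrier P \<times> carrier P. inv\<^bsub>D\<^esub> (f p)) (y, z) \<otimes>\<^bsub>D\<^esub> (\<lambda>p\<in>carrier P \<times> carrier P. inv\<^bsub>D\<^esub> (f p)) (x, y \<otimes>\<^bsub>P\<^esub> z)
      = (\<lambda>p\<in>carrier P \<times> carrier P. inv\<^bsub>D\<^esub> (f p)) (x \<otimes>\<^bsub>P\<^esub> y, z) \<otimes>\<^bsub>D\<^esub> (\<lambda>p\<in>carrier P \<times> carrier P. inv\<^bsub>D\<^esub> (f p)) (x, y)"
    using assms by (simp add: D.inv_mult[symmetric] Z2_cocycle)
qed (use assms in simp_all)

lemma Z2_one: "\<one>\<^bsub>cocycle_group P D\<^esub> \<in> Z2"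
  by (rule Z2I) (simp_all add: one_cocycle_group, simp add: cocycle_group_def)

sublocale C: comm_group "cocycle_group P D"
proof (rule comm_groupI)
  fix f g h assume fgh: "f \<in> Z2" "g \<in> Z2" "h \<in> Z2"
  then show "f \<otimes>\<^bsub>cocycle_group P D\<^esub> g \<otimes>\<^bsub>cocycle_group P D\<^esub> h = f \<otimes>\<^bsub>cocycle_group P D\<^esub> (g \<otimes>\<^bsub>cocycle_group P D\<^esub> h)"
    by (intro Z2_eqI) (simp_all add: Z2_mult mult_cocycle_group D.m_assoc)
next
  fix f g assume fgh: "f \<in> Z2" "g \<in> Z2"
  then show "f \<otimes>\<^bsub>cocycle_group P D\<^esub> g = g \<otimes>\<^bsub>cocycle_group P D\<^esub> f"
    by (intro Z2_eqI) (simp_all add: Z2_mult mult_cocycle_group D.m_comm)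
next
  fix f assume f: "f \<in> Z2"
  then show "\<one>\<^bsub>cocycle_group P D\<^esub> \<otimes>\<^bsub>cocycle_group P D\<^esub> f = f"
    by (intro Z2_eqI) (simp_all add: Z2_mult Z2_one mult_cocycle_group one_cocycle_group)
  show "\<exists>g\<in>Z2. g \<otimes>\<^bsub>cocycle_group P D\<^esub> f = \<one>\<^bsub>cocycle_group P D\<^esub>"
    using f by (intro bexI[OF _ Z2_inverse[OF f]] Z2_eqI)
      (simp_all add: Z2_mult Z2_one Z2_inverse mult_cocycle_group one_cocycle_group)
qed (simp_all add: Z2_mult Z2_one)

lemma inv_cocycle_group:
  assumes "f \<in> Z2" "x \<in> carrier P" "y \<in> carrier P"
  shows "(inv\<^bsub>cocycle_group P D\<^esub> f) (x, y) = inv\<^bsub>D\<^esub> (f (x, y))"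
proof -
  have "inv\<^bsub>cocycle_group P D\<^esub> f = (\<lambda>p\<in>carrier P \<times> carrier P. inv\<^bsub>D\<^esub> (f p))"
    using assms by (intro C.inv_equality Z2_eqI)
      (simp_all add: Z2_inverse Z2_mult mult_cocycle_group one_cocycle_group)
  then show ?thesis using assms by simp
qed

lemma div_cocycle_group:
  assumes "f \<in> Z2" "g \<in> Z2" "x \<in> carrier P" "y \<in> carrier P"
  shows "(f \<otimes>\<^bsub>cocycle_group P D\<^esub> inv\<^bsub>cocycle_group P D\<^esub> g) (x, y) = f (x, y) \<otimes>\<^bsub>D\<^esub> inv\<^bsub>D\<^esub> (g (x, y))"
  using assms by (simp add: mult_cocycle_group inv_cocycle_group)

lemma coboundsI:
  "u \<in> carrier P \<rightarrow> carrier D \<Longrightarrow>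
   (\<And>x y. x \<in> carrier P \<Longrightarrow> y \<in> carrier P \<Longrightarrow> f (x, y) \<otimes>\<^bsub>D\<^esub> u (x \<otimes>\<^bsub>P\<^esub> y) = u x \<otimes>\<^bsub>D\<^esub> u y) \<Longrightarrow> cobounds P D f u"
  by (simp add: cobounds_def)

lemma cobounds_closed: "cobounds P D f u \<Longrightarrow> x \<in> carrier P \<Longrightarrow> u x \<in> carrier D"
  by (auto simp: cobounds_def)

lemma coboundsD: "cobounds P D f u \<Longrightarrow> x \<in> carrier P \<Longrightarrow> y \<in> carrier P \<Longrightarrow>
    f (x, y) \<otimes>\<^bsub>D\<^esub> u (x \<otimes>\<^bsub>P\<^esub> y) = u x \<otimes>\<^bsub>D\<^esub> u y"
  by (auto simp: cobounds_def)

lemma cobounds_eq: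
  assumes "cobounds P D f u" "f (x, y) \<in> carrier D" "x \<in> carrier P" "y \<in> carrier P"
  shows "f (x, y) = u x \<otimes>\<^bsub>D\<^esub> u y \<otimes>\<^bsub>D\<^esub> inv\<^bsub>D\<^esub> (u (x \<otimes>\<^bsub>P\<^esub> y))"
  using assms coboundsD[OF assms(1)] cobounds_closed[OF assms(1)] by (simp add: D.div_eq_iff)

lemma coboundary_in_Z2:
  assumes u: "u \<in> carrier P \<rightarrow> carrier D"
  shows "(\<lambda>p\<in>carrier P \<times> carrier P. u (fst p) \<otimes>\<^bsub>D\<^esub> u (snd p) \<otimes>\<^bsub>D\<^esub> inv\<^bsub>D\<^esub> (u (fst p \<otimes>\<^bsub>P\<^esub> snd p))) \<in> Z2" (is "?f \<in> Z2")
    and "cobounds P D (\<lambda>p\<in>carrier P \<times> carrier P. u (fst p) \<otimes>\<^bsub>D\<^esub> u (snd p) \<otimes>\<^bsub>D\<^esub> inv\<^bsub>D\<^esub> (u (fst p \<otimes>\<^bsub>P\<^esub> snd p))) u"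
proof -
  have uc: "\<And>x. x \<in> carrier P \<Longrightarrow> u x \<in> carrier D" using u by auto
  show "cobounds P D ?f u" by (rule coboundsI[OF u]) (simp add: uc D.m_assoc)
  show "?f \<in> Z2"
  proof (rule Z2I)
    fix x y z assume xyz: "x \<in> carrier P" "y \<in> carrier P" "z \<in> carrier P"
    let ?d = "inv\<^bsub>D\<^esub> (u (x \<otimes>\<^bsub>P\<^esub> (y \<otimes>\<^bsub>P\<^esub> z)))"
    have 1: "?f (y, z) \<otimes>\<^bsub>D\<^esub> ?f (x, y \<otimes>\<^bsub>P\<^esub> z) = (u x \<otimes>\<^bsub>D\<^esub> u y \<otimes>\<^bsub>D\<^esub> u z \<otimes>\<^bsub>D\<^esub> ?d) \<otimes>\<^bsub>D\<^esub> (u (y \<otimes>\<^bsub>P\<^esub> z) \<otimes>\<^bsub>D\<^esub> inv\<^bsub>D\<^esub> u (y \<otimes>\<^bsub>P\<^esub> z))"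
      using xyz by (simp add: uc D.m_ac D.inv_cancel_left)
    have 2: "?f (x \<otimes>\<^bsub>P\<^esub> y, z) \<otimes>\<^bsub>D\<^esub> ?f (x, y) = (u x \<otimes>\<^bsub>D\<^esub> u y \<otimes>\<^bsub>D\<^esub> u z \<otimes>\<^bsub>D\<^esub> ?d) \<otimes>\<^bsub>D\<^esub> (u (x \<otimes>\<^bsub>P\<^esub> y) \<otimes>\<^bsub>D\<^esub> inv\<^bsub>D\<^esub> u (x \<otimes>\<^bsub>P\<^esub> y))"
      using xyz by (simp add: uc D.m_ac P.m_assoc D.inv_cancel_left)
    show "?f (y, z) \<otimes>\<^bsub>D\<^esub> ?f (x, y \<otimes>\<^bsub>P\<^esub> z) = ?f (x \<otimes>\<^bsub>P\<^esub> y, z) \<otimes>\<^bsub>D\<^esub> ?f (x, y)"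
      unfolding 1 2 using xyz by (simp add: uc)
  qed (simp_all add: uc)
qed

lemma coboundaries_iff: "f \<in> coboundaries P D \<longleftrightarrow> f \<in> Z2 \<and> (\<exists>u. cobounds P D f u)"
proof
  assume "f \<in> coboundaries P D"
  then show "f \<in> Z2 \<and> (\<exists>u. cobounds P D f u)" unfolding coboundaries_def using coboundary_in_Z2 by blast
next
  assume "f \<in> Z2 \<and> (\<exists>u. cobounds P D f u)"
  then obtain u where f: "f \<in> Z2" and u: "cobounds P D f u" by blast
  then have u': "u \<in> carrier P \<rightarrow> carrier D" by (simp add: cobounds_def)
  have "f = (\<lambda>p\<in>carrier P \<times> carrier P. u (fst p) \<otimes>\<^bsub>D\<^esub> u (snd p) \<otimes>\<^bsub>D\<^esub> inv\<^bsub>D\<^esub> (u (fst p \<otimes>\<^bsub>P\<^esub> snd p)))"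
    using f u by (intro Z2_eqI coboundary_in_Z2 u') (simp_all add: cobounds_eq)
  then show "f \<in> coboundaries P D" unfolding coboundaries_def using u' by blast
qed

lemma cobounds_div:
  assumes "f \<in> Z2" "g \<in> Z2" and u: "cobounds P D f u" and v: "cobounds P D g v"
  shows "cobounds P D (f \<otimes>\<^bsub>cocycle_group P D\<^esub> inv\<^bsub>cocycle_group P D\<^esub> g) (\<lambda>x. u x \<otimes>\<^bsub>D\<^esub> inv\<^bsub>D\<^esub> (v x))"
  using assms cobounds_closed[OF u] cobounds_closed[OF v] coboundsD[OF u] coboundsD[OF v]
  by (intro coboundsI) (auto simp: div_cocycle_group D.div_mult_div)

lemma cobounds_mult:
  assumes "f \<in> Z2" "g \<in> Z2" and u: "cobounds P D f u" and v: "cobounds P D g v"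
  shows "cobounds P D (f \<otimes>\<^bsub>cocycle_group P D\<^esub> g) (\<lambda>x. u x \<otimes>\<^bsub>D\<^esub> v x)"
proof (rule coboundsI)
  fix x y assume xy: "x \<in> carrier P" "y \<in> carrier P"
  note c = cobounds_closed[OF u] cobounds_closed[OF v] assms(1,2) xy
  show "(f \<otimes>\<^bsub>cocycle_group P D\<^esub> g) (x, y) \<otimes>\<^bsub>D\<^esub> (u (x \<otimes>\<^bsub>P\<^esub> y) \<otimes>\<^bsub>D\<^esub> v (x \<otimes>\<^bsub>P\<^esub> y))
      = u x \<otimes>\<^bsub>D\<^esub> v x \<otimes>\<^bsub>D\<^esub> (u y \<otimes>\<^bsub>D\<^esub> v y)"
    using D.mult_mult_swap[of "f (x, y)" "g (x, y)" "u (x \<otimes>\<^bsub>P\<^esub> y)" "v (x \<otimes>\<^bsub>P\<^esub> y)"]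
      D.mult_mult_swap[of "u x" "v x" "u y" "v y"] coboundsD[OF u xy] coboundsD[OF v xy]
    by (simp add: c mult_cocycle_group)
qed (use cobounds_closed[OF u] cobounds_closed[OF v] in auto)

lemma cobounds_one: "cobounds P D \<one>\<^bsub>cocycle_group P D\<^esub> (\<lambda>_. \<one>\<^bsub>D\<^esub>)"
  by (rule coboundsI) (simp_all add: one_cocycle_group)

sublocale B: normal "coboundaries P D" "cocycle_group P D"
proof (rule C.subgroup_imp_normal, rule C.subgroupI)
  show "coboundaries P D \<subseteq> Z2" using coboundaries_iff by auto
  show "coboundaries P D \<noteq> {}" using cobounds_one Z2_one coboundaries_iff by blast
  fix f assume f: "f \<in> coboundaries P D"
  then obtain u where u: "f \<in> Z2" "cobounds P D f u" using coboundaries_iff by auto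
  show "inv\<^bsub>cocycle_group P D\<^esub> f \<in> coboundaries P D"
    using cobounds_div[OF Z2_one u(1) cobounds_one u(2)] u(1) coboundaries_iff by (auto simp: C.l_one)
  fix g assume "g \<in> coboundaries P D"
  then show "f \<otimes>\<^bsub>cocycle_group P D\<^esub> g \<in> coboundaries P D"
    using u cobounds_mult[OF u(1) _ u(2)] Z2_mult[OF u(1)] by (auto simp: coboundaries_iff)
qed

sublocale H: comm_group "H2 P D"
  unfolding H2_def by (rule C.abelian_FactGroup[OF B.is_subgroup])

lemma H2_class_carrier: "f \<in> Z2 \<Longrightarrow> H2_class P D f \<in> carrier (H2 P D)"
  by (auto simp: H2_class_def H2_def carrier_FactGroup)

lemma H2_cases: assumes "c \<in> carrier (H2 P D)" obtains f where "f \<in> Z2" "c = H2_class P D f"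
  using assms by (auto simp: H2_class_def H2_def carrier_FactGroup)

lemma H2_class_div:
  "f \<in> Z2 \<Longrightarrow> g \<in> Z2 \<Longrightarrow> H2_class P D f \<otimes>\<^bsub>H2 P D\<^esub> inv\<^bsub>H2 P D\<^esub> H2_class P D g
     = H2_class P D (f \<otimes>\<^bsub>cocycle_group P D\<^esub> inv\<^bsub>cocycle_group P D\<^esub> g)"
  unfolding H2_class_def H2_def by (rule B.rcos_div)

lemma H2_class_mult:
  "f \<in> Z2 \<Longrightarrow> g \<in> Z2 \<Longrightarrow> H2_class P D f \<otimes>\<^bsub>H2 P D\<^esub> H2_class P D g = H2_class P D (f \<otimes>\<^bsub>cocycle_group P D\<^esub> g)"
  unfolding H2_class_def H2_def by (simp add: B.rcos_sum)

lemma H2_class_one_iff: "f \<in> Z2 \<Longrightarrow> H2_class P D f = \<one>\<^bsub>H2 P D\<^esub> \<longleftrightarrow> (\<exists>u. cobounds P D f u)"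
  unfolding H2_class_def H2_def by (simp add: B.rcos_eq_self_iff coboundaries_iff)

lemma H2_class_eq_iff:
  assumes "f \<in> Z2" "g \<in> Z2"
  shows "H2_class P D f = H2_class P D g \<longleftrightarrow> (\<exists>u. cobounds P D (f \<otimes>\<^bsub>cocycle_group P D\<^esub> inv\<^bsub>cocycle_group P D\<^esub> g) u)"
proof -
  have "H2_class P D f = H2_class P D g \<longleftrightarrow> H2_class P D f \<otimes>\<^bsub>H2 P D\<^esub> inv\<^bsub>H2 P D\<^esub> H2_class P D g = \<one>\<^bsub>H2 P D\<^esub>"
    using H.div_eq_iff[of "\<one>\<^bsub>H2 P D\<^esub>" "H2_class P D f" "H2_class P D g"] H2_class_carrier[OF assms(1)] H2_class_carrier[OF assms(2)]
    by auto
  then show ?thesis using assms by (simp add: H2_class_div H2_class_one_iff)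
qed

lemma pullback_Z2:
  assumes "group Q" "\<phi> \<in> hom P Q" "f \<in> carrier (cocycle_group Q D)"
  shows "pullback P \<phi> f \<in> Z2"
proof -
  interpret Q: cohomology Q D by (intro cohomology.intro assms D.comm_group_axioms)
  have \<phi>: "\<And>x. x \<in> carrier P \<Longrightarrow> \<phi> x \<in> carrier Q" using assms(2) by (auto simp: hom_def)
  show ?thesis
    by (rule Z2I) (use assms in \<open>simp_all add: \<phi> Q.Z2_cocycle hom_mult[OF assms(2)]\<close>,
       simp add: pullback_def)
qed

lemma pullback_mult:
  assumes "group Q" "\<phi> \<in> hom P Q" "f \<in> carrier (cocycle_group Q D)" "g \<in> carrier (cocycle_group Q D)"
  shows "pullback P \<phi> (f \<otimes>\<^bsub>cocycle_group Q D\<^esub> g) = pullback P \<phi> f \<otimes>\<^bsub>cocycle_group P D\<^esub> pullback P \<phi> g"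
proof -
  interpret Q: cohomology Q D by (intro cohomology.intro assms D.comm_group_axioms)
  have \<phi>: "\<And>x. x \<in> carrier P \<Longrightarrow> \<phi> x \<in> carrier Q" using assms(2) by (auto simp: hom_def)
  show ?thesis
    by (rule Z2_eqI) (use assms(3,4) in \<open>simp_all add: pullback_Z2[OF assms(1,2)] \<phi> mult_cocycle_group Q.mult_cocycle_group\<close>)
qed

lemma pullback_cob:
  assumes "\<phi> \<in> hom P Q" "cobounds Q D f u"
  shows "cobounds P D (pullback P \<phi> f) (\<lambda>x. u (\<phi> x))"
  using assms(2) hom_mult[OF assms(1)] hom_in_carrier[OF assms(1)]
  by (intro coboundsI) (auto simp: cobounds_def)

text \<open>\<open>infl\<close> evaluates a representative picked by choice. Two representatives
  differ by a coboundary, and the pullback of a coboundary is a coboundary, so any representative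
  may be used instead.\<close>

lemma infl_cls:
  assumes "group Q" "\<phi> \<in> hom P Q" "f \<in> carrier (cocycle_group Q D)"
  shows "infl P Q D \<phi> (H2_class Q D f) = H2_class P D (pullback P \<phi> f)"
proof -
  interpret Q: cohomology Q D by (intro cohomology.intro assms D.comm_group_axioms)
  define g where "g = (SOME g. g \<in> H2_class Q D f)"
  have "f \<in> H2_class Q D f"
    unfolding H2_class_def using Q.C.rcos_self[OF assms(3) Q.B.is_subgroup] .
  then have "g \<in> H2_class Q D f" unfolding g_def by (rule someI[of "\<lambda>g. g \<in> H2_class Q D f"])
  then obtain b where b: "b \<in> coboundaries Q D" "g = b \<otimes>\<^bsub>cocycle_group Q D\<^esub> f"
    unfolding H2_class_def r_coset_def by auto
  have bZ: "b \<in> carrier (cocycle_group Q D)" using b Q.coboundaries_iff by auto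
  have pb: "pullback P \<phi> b \<in> coboundaries P D"
    using b(1) bZ pullback_cob[OF assms(2)] pullback_Z2[OF assms(1,2)]
    by (auto simp: Q.coboundaries_iff coboundaries_iff)
  have "infl P Q D \<phi> (H2_class Q D f) = coboundaries P D #>\<^bsub>cocycle_group P D\<^esub> pullback P \<phi> g"
    using Q.H2_class_carrier[OF assms(3)] unfolding infl_def g_def pullback_def by simp
  also have "\<dots> = coboundaries P D #>\<^bsub>cocycle_group P D\<^esub> (pullback P \<phi> b \<otimes>\<^bsub>cocycle_group P D\<^esub> pullback P \<phi> f)"
    unfolding b(2) by (simp add: pullback_mult[OF assms(1,2) bZ assms(3)])
  also have "\<dots> = coboundaries P D #>\<^bsub>cocycle_group P D\<^esub> pullback P \<phi> f"
    using C.coset_mult_assoc[OF B.subset B.mem_carrier[OF pb] pullback_Z2[OF assms]]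
      C.coset_join2[OF B.mem_carrier[OF pb] B.is_subgroup pb] by simp
  finally show ?thesis unfolding H2_class_def .
qed

lemma infl_hom:
  assumes "group Q" "\<phi> \<in> hom P Q"
  shows "group_hom (H2 Q D) (H2 P D) (infl P Q D \<phi>)"
proof -
  interpret Q: cohomology Q D by (intro cohomology.intro assms D.comm_group_axioms)
  have "infl P Q D \<phi> \<in> hom (H2 Q D) (H2 P D)"
  proof (rule homI)
    fix c assume "c \<in> carrier (H2 Q D)"
    then show "infl P Q D \<phi> c \<in> carrier (H2 P D)"
      by (rule Q.H2_cases) (simp add: infl_cls[OF assms] H2_class_carrier pullback_Z2[OF assms])
  next
    fix c d assume "c \<in> carrier (H2 Q D)" "d \<in> carrier (H2 Q D)"
    then obtain f g where "f \<in> Q.Z2" "c = H2_class Q D f" "g \<in> Q.Z2" "d = H2_class Q D g"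
      by (elim Q.H2_cases)
    then show "infl P Q D \<phi> (c \<otimes>\<^bsub>H2 Q D\<^esub> d) = infl P Q D \<phi> c \<otimes>\<^bsub>H2 P D\<^esub> infl P Q D \<phi> d"
      by (simp add: Q.H2_class_mult H2_class_mult infl_cls[OF assms] pullback_mult[OF assms] pullback_Z2[OF assms])
  qed
  then show ?thesis by (simp add: group_hom_def group_hom_axioms_def)
qed

end

section \<open>Homomorphism groups and tensor products\<close>

lemma (in comm_group) mult_inv_inv:
  assumes "a \<in> carrier G" "b \<in> carrier G"
  shows "a \<otimes> (b \<otimes> (inv a \<otimes> inv b)) = \<one>"
  using assms by (simp add: m_lcomm[of b] inv_cancel_left)

lemma hom_group_carrier_iff:
  "\<theta> \<in> carrier (hom_group P D) \<longleftrightarrow> \<theta> \<in> hom P D \<and> \<theta> \<in> extensional (carrier P)"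
  by (auto simp: hom_group_def)

lemma hom_group_mult_apply:
  "x \<in> carrier P \<Longrightarrow> (\<theta> \<otimes>\<^bsub>hom_group P D\<^esub> \<eta>) x = \<theta> x \<otimes>\<^bsub>D\<^esub> \<eta> x"
  by (simp add: hom_group_def)

lemma hom_group_one_apply:
  "x \<in> carrier P \<Longrightarrow> \<one>\<^bsub>hom_group P D\<^esub> x = \<one>\<^bsub>D\<^esub>"
  by (simp add: hom_group_def)

lemma hom_group_eqI:
  assumes "\<theta> \<in> carrier (hom_group P D)" "\<eta> \<in> carrier (hom_group P D)" "\<And>x. x \<in> carrier P \<Longrightarrow> \<theta> x = \<eta> x"
  shows "\<theta> = \<eta>"
  using assms by (auto simp: hom_group_carrier_iff intro: extensionalityI)

context
  fixes P :: "('x, 'm) monoid_scheme" and D :: "('d, 'n) monoid_scheme"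
  assumes P: "group P" and D: "comm_group D"
begin

interpretation P: group P by (rule P)
interpretation D: comm_group D by (rule D)

lemma restrict_in_hom_group:
  assumes "\<phi> \<in> hom P D" shows "restrict \<phi> (carrier P) \<in> carrier (hom_group P D)"
  using assms by (auto simp: hom_group_carrier_iff hom_def)

lemma hom_mult_closed:
  assumes "\<theta> \<in> hom P D" "\<eta> \<in> hom P D" shows "(\<lambda>x. \<theta> x \<otimes>\<^bsub>D\<^esub> \<eta> x) \<in> hom P D"
proof (rule homI)
  fix x y assume xy: "x \<in> carrier P" "y \<in> carrier P"
  then show "\<theta> (x \<otimes>\<^bsub>P\<^esub> y) \<otimes>\<^bsub>D\<^esub> \<eta> (x \<otimes>\<^bsub>P\<^esub> y) = \<theta> x \<otimes>\<^bsub>D\<^esub> \<eta> x \<otimes>\<^bsub>D\<^esub> (\<theta> y \<otimes>\<^bsub>D\<^esub> \<eta> y)"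
    using D.mult_mult_swap[of "\<theta> x" "\<theta> y" "\<eta> x" "\<eta> y"] hom_mult[OF assms(1)] hom_mult[OF assms(2)]
      hom_in_carrier[OF assms(1)] hom_in_carrier[OF assms(2)] by simp
qed (use assms in \<open>simp add: hom_in_carrier\<close>)

lemma hom_inv_closed:
  assumes "\<theta> \<in> hom P D" shows "(\<lambda>x. inv\<^bsub>D\<^esub> \<theta> x) \<in> hom P D"
  using hom_mult[OF assms] hom_in_carrier[OF assms] by (intro homI) (simp_all add: D.inv_mult)

lemma hom_div_closed:
  assumes "\<theta> \<in> hom P D" "\<eta> \<in> hom P D" shows "(\<lambda>x. \<theta> x \<otimes>\<^bsub>D\<^esub> inv\<^bsub>D\<^esub> \<eta> x) \<in> hom P D"
  using hom_mult_closed[OF assms(1) hom_inv_closed[OF assms(2)]] .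

lemma hom_group_mult_closed:
  assumes "\<theta> \<in> carrier (hom_group P D)" "\<eta> \<in> carrier (hom_group P D)"
  shows "\<theta> \<otimes>\<^bsub>hom_group P D\<^esub> \<eta> \<in> carrier (hom_group P D)"
  using restrict_in_hom_group[OF hom_mult_closed, of \<theta> \<eta>] assms by (simp add: hom_group_def)

lemma hom_group_one_closed: "\<one>\<^bsub>hom_group P D\<^esub> \<in> carrier (hom_group P D)"
  using restrict_in_hom_group[of "\<lambda>_. \<one>\<^bsub>D\<^esub>"] by (simp add: hom_group_def hom_def)

lemma hom_group_closed: "\<theta> \<in> carrier (hom_group P D) \<Longrightarrow> x \<in> carrier P \<Longrightarrow> \<theta> x \<in> carrier D"
  by (auto simp: hom_group_carrier_iff hom_def)

lemma comm_group_hom_group: "comm_group (hom_group P D)"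
proof (rule comm_groupI)
  fix \<theta> assume t: "\<theta> \<in> carrier (hom_group P D)"
  then have i: "(\<lambda>x\<in>carrier P. inv\<^bsub>D\<^esub> \<theta> x) \<in> carrier (hom_group P D)"
    using restrict_in_hom_group hom_inv_closed by (simp add: hom_group_carrier_iff)
  show "\<exists>\<eta>\<in>carrier (hom_group P D). \<eta> \<otimes>\<^bsub>hom_group P D\<^esub> \<theta> = \<one>\<^bsub>hom_group P D\<^esub>"
    using t i by (intro bexI[OF _ i] hom_group_eqI[of _ P D])
      (simp_all add: hom_group_mult_closed hom_group_one_closed hom_group_mult_apply hom_group_one_apply hom_group_closed)
  show "\<one>\<^bsub>hom_group P D\<^esub> \<otimes>\<^bsub>hom_group P D\<^esub> \<theta> = \<theta>"
    using t by (intro hom_group_eqI[of _ P D])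
      (simp_all add: hom_group_mult_closed hom_group_one_closed hom_group_mult_apply hom_group_one_apply hom_group_closed)
next
  fix \<theta> \<eta> \<zeta> assume "\<theta> \<in> carrier (hom_group P D)" "\<eta> \<in> carrier (hom_group P D)" "\<zeta> \<in> carrier (hom_group P D)"
  then show "\<theta> \<otimes>\<^bsub>hom_group P D\<^esub> \<eta> \<otimes>\<^bsub>hom_group P D\<^esub> \<zeta> = \<theta> \<otimes>\<^bsub>hom_group P D\<^esub> (\<eta> \<otimes>\<^bsub>hom_group P D\<^esub> \<zeta>)"
    by (intro hom_group_eqI[of _ P D]) (simp_all add: hom_group_mult_closed hom_group_mult_apply hom_group_closed D.m_assoc)
next
  fix \<theta> \<eta> assume "\<theta> \<in> carrier (hom_group P D)" "\<eta> \<in> carrier (hom_group P D)"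
  then show "\<theta> \<otimes>\<^bsub>hom_group P D\<^esub> \<eta> = \<eta> \<otimes>\<^bsub>hom_group P D\<^esub> \<theta>"
    by (intro hom_group_eqI[of _ P D]) (simp_all add: hom_group_mult_closed hom_group_mult_apply hom_group_closed D.m_comm)
qed (simp_all add: hom_group_mult_closed hom_group_one_closed)

lemma hom_group_div_apply:
  assumes "\<theta> \<in> carrier (hom_group P D)" "\<eta> \<in> carrier (hom_group P D)" "x \<in> carrier P"
  shows "(\<theta> \<otimes>\<^bsub>hom_group P D\<^esub> inv\<^bsub>hom_group P D\<^esub> \<eta>) x = \<theta> x \<otimes>\<^bsub>D\<^esub> inv\<^bsub>D\<^esub> \<eta> x"
proof -
  interpret comm_group "hom_group P D" by (rule comm_group_hom_group)
  let ?\<zeta> = "\<theta> \<otimes>\<^bsub>hom_group P D\<^esub> inv\<^bsub>hom_group P D\<^esub> \<eta>"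
  have "?\<zeta> \<otimes>\<^bsub>hom_group P D\<^esub> \<eta> = \<theta>" using assms by (simp add: m_assoc)
  then have "?\<zeta> x \<otimes>\<^bsub>D\<^esub> \<eta> x = \<theta> x" using hom_group_mult_apply[OF assms(3)] by metis
  then show ?thesis using assms hom_group_closed[of _ x] by (simp add: D.div_eq_iff)
qed

lemma hom_group_one_iff:
  "\<theta> \<in> carrier (hom_group P D) \<Longrightarrow> \<theta> = \<one>\<^bsub>hom_group P D\<^esub> \<longleftrightarrow> (\<forall>x\<in>carrier P. \<theta> x = \<one>\<^bsub>D\<^esub>)"
  using hom_group_eqI[of \<theta> P D, OF _ hom_group_one_closed] hom_group_one_apply[of _ P D] by auto

end

section \<open>Bimultiplicative maps and the universal property of the tensor product\<close>

definition bimult where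
  "bimult P Q D \<beta> \<longleftrightarrow> (\<forall>a\<in>carrier P. \<forall>b\<in>carrier Q. \<beta> a b \<in> carrier D) \<and>
     (\<forall>a\<in>carrier P. \<forall>a'\<in>carrier P. \<forall>b\<in>carrier Q. \<beta> (a \<otimes>\<^bsub>P\<^esub> a') b = \<beta> a b \<otimes>\<^bsub>D\<^esub> \<beta> a' b) \<and>
     (\<forall>a\<in>carrier P. \<forall>b\<in>carrier Q. \<forall>b'\<in>carrier Q. \<beta> a (b \<otimes>\<^bsub>Q\<^esub> b') = \<beta> a b \<otimes>\<^bsub>D\<^esub> \<beta> a b')"

text \<open>The elementary tensor of \<open>a\<close> and \<open>b\<close>: the class of a free
  generator.\<close>

definition tens where
  "tens P Q a b = generate (free_Abelian_group (carrier P \<times> carrier Q)) (tensor_rels P Q)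
      #>\<^bsub>free_Abelian_group (carrier P \<times> carrier Q)\<^esub> frag_of (a, b)"

context
  fixes P :: "('x, 'm) monoid_scheme" and Q :: "('y, 'k) monoid_scheme"
  assumes P: "group P" and Q: "group Q"
begin

interpretation P: group P by (rule P)
interpretation Q: group Q by (rule Q)

abbreviation (input) "FA \<equiv> free_Abelian_group (carrier P \<times> carrier Q)"
abbreviation (input) "RL \<equiv> generate FA (tensor_rels P Q)"

lemma tensor_rels_subset: "tensor_rels P Q \<subseteq> carrier FA"
proof -
  have "x - y - z \<in> carrier FA" if "x \<in> carrier FA" "y \<in> carrier FA" "z \<in> carrier FA"
    for x y z :: "('x \<times> 'y) \<Rightarrow>\<^sub>0 int"
    using that keys_diff[of "x - y" z] keys_diff[of x y]
    unfolding carrier_free_Abelian_group_iff by blast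
  moreover have "frag_of (a, b) \<in> carrier FA" if "a \<in> carrier P" "b \<in> carrier Q" for a b
    using that by (simp add: keys_frag_of)
  ultimately show ?thesis unfolding tensor_rels_def by auto
qed

interpretation F: comm_group FA by (rule abelian_free_Abelian_group)
interpretation R: normal RL FA
  by (rule F.subgroup_imp_normal[OF F.generate_is_subgroup[OF tensor_rels_subset]])

lemma comm_group_tensor_Z: "comm_group (tensor_Z P Q)"
  unfolding tensor_Z_def by (rule F.abelian_FactGroup[OF R.is_subgroup])

lemma bimult_tens: "bimult P Q (tensor_Z P Q) (tens P Q)"
proof -
  have fr: "frag_of (a, b) \<in> carrier FA" if "a \<in> carrier P" "b \<in> carrier Q" for a b
    using that by (simp add: keys_frag_of)
  have eq: "RL #>\<^bsub>FA\<^esub> x = (RL #>\<^bsub>FA\<^esub> y) <#>\<^bsub>FA\<^esub> (RL #>\<^bsub>FA\<^esub> z)"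
    if "x - y - z \<in> tensor_rels P Q" and c: "x \<in> carrier FA" "y \<in> carrier FA" "z \<in> carrier FA" for x y z
  proof -
    have r: "x - y - z \<in> RL" using that(1) by (rule generate.incl)
    have "RL #>\<^bsub>FA\<^esub> x = RL #>\<^bsub>FA\<^esub> ((x - y - z) \<otimes>\<^bsub>FA\<^esub> (y \<otimes>\<^bsub>FA\<^esub> z))" by simp
    also have "\<dots> = RL #>\<^bsub>FA\<^esub> (y \<otimes>\<^bsub>FA\<^esub> z)"
      using F.coset_mult_assoc[OF R.subset R.mem_carrier[OF r] F.m_closed[OF c(2,3)]]
        F.coset_join2[OF R.mem_carrier[OF r] R.is_subgroup r] by simp
    also have "\<dots> = (RL #>\<^bsub>FA\<^esub> y) <#>\<^bsub>FA\<^esub> (RL #>\<^bsub>FA\<^esub> z)" using R.rcos_sum c(2,3) by simp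
    finally show ?thesis .
  qed
  show ?thesis
    unfolding bimult_def tens_def tensor_Z_def mult_FactGroup carrier_FactGroup
  proof (intro conjI ballI eq imageI fr)
    fix a a' b assume "a \<in> carrier P" "a' \<in> carrier P" "b \<in> carrier Q"
    then show "frag_of (a \<otimes>\<^bsub>P\<^esub> a', b) - frag_of (a, b) - frag_of (a', b) \<in> tensor_rels P Q"
      unfolding tensor_rels_def by blast
  next
    fix a b b' assume "a \<in> carrier P" "b \<in> carrier Q" "b' \<in> carrier Q"
    then show "frag_of (a, b \<otimes>\<^bsub>Q\<^esub> b') - frag_of (a, b) - frag_of (a, b') \<in> tensor_rels P Q"
      unfolding tensor_rels_def by blast
  qed auto
qed

text \<open>The linear extension of \<open>\<beta>\<close> to the free abelian group kills both
  families of relations, which correspond to the two halves of \<open>bimult\<close>.\<close>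

lemma tens_universal:
  fixes D :: "('d, 'n) monoid_scheme"
  assumes "comm_group D" "bimult P Q D \<beta>"
  shows "\<exists>\<theta>\<in>hom (tensor_Z P Q) D. \<forall>a\<in>carrier P. \<forall>b\<in>carrier Q. \<theta> (tens P Q a b) = \<beta> a b"
proof -
  interpret D: comm_group D by fact
  obtain h where h: "h \<in> hom FA D" "\<And>x. x \<in> carrier P \<times> carrier Q \<Longrightarrow> h (frag_of x) = case_prod \<beta> x"
    by (rule D.free_Abelian_group_universal[of "case_prod \<beta>" "carrier P \<times> carrier Q"])
       (use assms(2) in \<open>auto simp: bimult_def\<close>)
  interpret h: group_hom FA D h by unfold_locales (rule h(1))
  have fr: "frag_of (a, b) \<in> carrier FA" if "a \<in> carrier P" "b \<in> carrier Q" for a b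
    using that by (simp add: keys_frag_of)
  have hdiff: "h (x - y - z) = h x \<otimes>\<^bsub>D\<^esub> inv\<^bsub>D\<^esub> h y \<otimes>\<^bsub>D\<^esub> inv\<^bsub>D\<^esub> h z"
    if "x \<in> carrier FA" "y \<in> carrier FA" "z \<in> carrier FA" for x y z
  proof -
    have "x - y - z = x \<otimes>\<^bsub>FA\<^esub> inv\<^bsub>FA\<^esub> y \<otimes>\<^bsub>FA\<^esub> inv\<^bsub>FA\<^esub> z" using that by simp
    then show ?thesis using that by (simp only: h.hom_mult h.hom_inv F.m_closed F.inv_closed)
  qed
  have "tensor_rels P Q \<subseteq> kernel FA D h"
  proof
    fix t assume t: "t \<in> tensor_rels P Q"
    have "h t = \<one>\<^bsub>D\<^esub>"
      using t assms(2) unfolding tensor_rels_def bimult_def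
      by (auto simp: hdiff fr h(2) D.m_assoc D.mult_inv_inv simp del: carrier_free_Abelian_group_iff)
    then show "t \<in> kernel FA D h" unfolding kernel_def using t tensor_rels_subset by blast
  qed
  then have ker: "RL \<subseteq> kernel FA D h"
    by (rule F.generate_subgroup_incl[OF _ h.subgroup_kernel])
  have "h x = h y" if xy: "x \<in> carrier FA" "y \<in> carrier FA" "RL #>\<^bsub>FA\<^esub> x = RL #>\<^bsub>FA\<^esub> y" for x y
  proof -
    have "x \<in> RL #>\<^bsub>FA\<^esub> y" using F.rcos_self[OF xy(1) R.is_subgroup] xy(3) by simp
    then obtain r where r: "r \<in> RL" "x = r \<otimes>\<^bsub>FA\<^esub> y" unfolding r_coset_def by blast
    then show ?thesis using ker xy(2) h.hom_mult[of r y] h.hom_closed[OF xy(2)] unfolding kernel_def by auto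
  qed
  then obtain \<theta> where "\<theta> \<in> hom (FA Mod RL) D" "\<And>x. x \<in> carrier FA \<Longrightarrow> \<theta> (RL #>\<^bsub>FA\<^esub> x) = h x"
    using FactGroup_universal[OF h(1) R.normal_axioms] by blast
  then show ?thesis unfolding tens_def tensor_Z_def using h(2) fr by (intro bexI[of _ \<theta>]) auto
qed

text \<open>Elementary tensors generate. The form chosen is the one in which this is used: a
  homomorphism is known through its pairing, and a trivial pairing has to yield the trivial
  homomorphism.\<close>

lemma tens_generate:
  fixes D :: "('d, 'n) monoid_scheme"
  assumes "group D" "\<theta> \<in> hom (tensor_Z P Q) D"
    and triv: "\<And>a b. a \<in> carrier P \<Longrightarrow> b \<in> carrier Q \<Longrightarrow> \<theta> (tens P Q a b) = \<one>\<^bsub>D\<^esub>"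
    and t: "t \<in> carrier (tensor_Z P Q)"
  shows "\<theta> t = \<one>\<^bsub>D\<^esub>"
proof -
  interpret D: group D by fact
  interpret T: comm_group "tensor_Z P Q" by (rule comm_group_tensor_Z)
  obtain x where x: "x \<in> carrier FA" "t = RL #>\<^bsub>FA\<^esub> x"
    using t by (auto simp: tensor_Z_def carrier_FactGroup)
  have "(\<theta> \<circ> (\<lambda>x. RL #>\<^bsub>FA\<^esub> x)) \<in> hom FA D"
    using hom_compose[OF R.r_coset_hom_Mod] assms(2) unfolding tensor_Z_def by blast
  then interpret h: group_hom FA D "\<lambda>x. \<theta> (RL #>\<^bsub>FA\<^esub> x)"
    by unfold_locales (simp add: comp_def)
  have "x \<in> carrier FA \<and> \<theta> (RL #>\<^bsub>FA\<^esub> x) = \<one>\<^bsub>D\<^esub>"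
  proof (rule free_Abelian_group_induct[of x "carrier P \<times> carrier Q"])
    show "Poly_Mapping.keys x \<subseteq> carrier P \<times> carrier Q" using x(1) by simp
    show "0 \<in> carrier FA \<and> \<theta> (RL #>\<^bsub>FA\<^esub> 0) = \<one>\<^bsub>D\<^esub>" using h.hom_one by simp
  next
    fix y z
    assume yz: "y \<in> carrier FA \<and> \<theta> (RL #>\<^bsub>FA\<^esub> y) = \<one>\<^bsub>D\<^esub>" "z \<in> carrier FA \<and> \<theta> (RL #>\<^bsub>FA\<^esub> z) = \<one>\<^bsub>D\<^esub>"
    have "y - z = y \<otimes>\<^bsub>FA\<^esub> inv\<^bsub>FA\<^esub> z" using yz by simp
    then show "y - z \<in> carrier FA \<and> \<theta> (RL #>\<^bsub>FA\<^esub> (y - z)) = \<one>\<^bsub>D\<^esub>"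
      using yz by (simp only: h.hom_mult h.hom_inv F.m_closed F.inv_closed D.inv_one D.r_one D.one_closed)
  next
    fix p assume "p \<in> carrier P \<times> carrier Q"
    then show "frag_of p \<in> carrier FA \<and> \<theta> (RL #>\<^bsub>FA\<^esub> frag_of p) = \<one>\<^bsub>D\<^esub>"
      using triv by (auto simp: tens_def keys_frag_of)
  qed
  then show ?thesis using x by simp
qed

end

text \<open>An elementary tensor of the abelianizations, but indexed by elements of the groups
  themselves, so that it can be compared directly with pairings of nonabelian groups.\<close>

definition ab_tens where
  "ab_tens P Q a b = tens (abelianization P) (abelianization Q)
     (derived P (carrier P) #>\<^bsub>P\<^esub> a) (derived Q (carrier Q) #>\<^bsub>Q\<^esub> b)"

text \<open>Commutators go to commutators of the abelian group \<open>D\<close>, and the kernel is a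
  subgroup. This is the necessity half of the extension criterion.\<close>

lemma hom_trivial_on_derived:
  assumes "group P" "comm_group D" "\<phi> \<in> hom P D" "x \<in> derived P (carrier P)"
  shows "\<phi> x = \<one>\<^bsub>D\<^esub>"
proof -
  interpret P: group P by fact
  interpret D: comm_group D by fact
  interpret h: group_hom P D \<phi> by unfold_locales fact
  have "derived P (carrier P) \<subseteq> kernel P D \<phi>"
    unfolding derived_def
  proof (rule P.generate_subgroup_incl[OF _ h.subgroup_kernel])
    show "derived_set P (carrier P) \<subseteq> kernel P D \<phi>"
      by (auto simp: kernel_def D.m_assoc D.mult_inv_inv)
  qed
  then show ?thesis using assms(4) by (auto simp: kernel_def)
qed

context
  fixes P :: "('x, 'm) monoid_scheme" and Q :: "('y, 'k) monoid_scheme"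
  assumes P: "group P" and Q: "group Q"
begin

interpretation P: group P by (rule P)
interpretation Q: group Q by (rule Q)
interpretation P': normal "derived P (carrier P)" P by (rule P.derived_self_is_normal)
interpretation Q': normal "derived Q (carrier Q)" Q by (rule Q.derived_self_is_normal)
interpretation aP: group "abelianization P" unfolding abelianization_def by (rule P.derived_quot_is_group)
interpretation aQ: group "abelianization Q" unfolding abelianization_def by (rule Q.derived_quot_is_group)

lemma comm_group_ab_tensor: "comm_group (ab_tensor P Q)"
  unfolding ab_tensor_def by (rule comm_group_tensor_Z[OF aP.is_group aQ.is_group])

lemma abelianization_cosets:
  "a \<in> carrier P \<Longrightarrow> derived P (carrier P) #>\<^bsub>P\<^esub> a \<in> carrier (abelianization P)"
  "b \<in> carrier Q \<Longrightarrow> derived Q (carrier Q) #>\<^bsub>Q\<^esub> b \<in> carrier (abelianization Q)"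
  by (auto simp: abelianization_def carrier_FactGroup)

lemma bimult_ab_tens: "bimult P Q (ab_tensor P Q) (ab_tens P Q)"
proof -
  have P_mult: "derived P (carrier P) #>\<^bsub>P\<^esub> (a \<otimes>\<^bsub>P\<^esub> a')
      = (derived P (carrier P) #>\<^bsub>P\<^esub> a) \<otimes>\<^bsub>abelianization P\<^esub> (derived P (carrier P) #>\<^bsub>P\<^esub> a')"
    if "a \<in> carrier P" "a' \<in> carrier P" for a a'
    using that by (simp add: abelianization_def P'.rcos_sum)
  have Q_mult: "derived Q (carrier Q) #>\<^bsub>Q\<^esub> (a \<otimes>\<^bsub>Q\<^esub> a')
      = (derived Q (carrier Q) #>\<^bsub>Q\<^esub> a) \<otimes>\<^bsub>abelianization Q\<^esub> (derived Q (carrier Q) #>\<^bsub>Q\<^esub> a')"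
    if "a \<in> carrier Q" "a' \<in> carrier Q" for a a'
    using that by (simp add: abelianization_def Q'.rcos_sum)
  show ?thesis
    using bimult_tens[OF aP.is_group aQ.is_group] abelianization_cosets P_mult Q_mult
    unfolding bimult_def ab_tensor_def ab_tens_def by simp
qed

lemma ab_tens_generate:
  fixes D :: "('d, 'n) monoid_scheme"
  assumes "group D" "\<theta> \<in> hom (ab_tensor P Q) D"
    and triv: "\<And>a b. a \<in> carrier P \<Longrightarrow> b \<in> carrier Q \<Longrightarrow> \<theta> (ab_tens P Q a b) = \<one>\<^bsub>D\<^esub>"
    and "t \<in> carrier (ab_tensor P Q)"
  shows "\<theta> t = \<one>\<^bsub>D\<^esub>"
proof (rule tens_generate[OF aP.is_group aQ.is_group \<open>group D\<close>])
  fix a b assume "a \<in> carrier (abelianization P)" "b \<in> carrier (abelianization Q)"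
  then show "\<theta> (tens (abelianization P) (abelianization Q) a b) = \<one>\<^bsub>D\<^esub>"
    using triv by (auto simp: abelianization_def carrier_FactGroup ab_tens_def)
qed (use assms in \<open>simp_all add: ab_tensor_def\<close>)

text \<open>For a fixed second argument a pairing is a homomorphism into the abelian group
  \<open>D\<close>, hence kills the derived subgroup, and likewise in the other argument. So it
  factors through the abelianizations, where the universal property applies.\<close>

lemma ab_tens_universal:
  fixes D :: "('d, 'n) monoid_scheme"
  assumes D: "comm_group D" and \<beta>: "bimult P Q D \<beta>"
  shows "\<exists>\<theta>\<in>hom (ab_tensor P Q) D. \<forall>a\<in>carrier P. \<forall>b\<in>carrier Q. \<theta> (ab_tens P Q a b) = \<beta> a b"
proof -
  interpret D: comm_group D by fact
  let ?P' = "derived P (carrier P)" and ?Q' = "derived Q (carrier Q)"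
  have cl: "\<beta> a b \<in> carrier D" if "a \<in> carrier P" "b \<in> carrier Q" for a b
    using that \<beta> by (auto simp: bimult_def)
  have P_hom: "(\<lambda>a. \<beta> a b) \<in> hom P D" if "b \<in> carrier Q" for b
    using that \<beta> by (auto simp: bimult_def hom_def)
  have Q_hom: "(\<lambda>b. \<beta> a b) \<in> hom Q D" if "a \<in> carrier P" for a
    using that \<beta> by (auto simp: bimult_def hom_def)
  have P_eq: "\<beta> a b = \<beta> a' b" if ab: "a \<in> carrier P" "a' \<in> carrier P" "b \<in> carrier Q" "?P' #>\<^bsub>P\<^esub> a = ?P' #>\<^bsub>P\<^esub> a'" for a a' b
  proof -
    have "a \<in> ?P' #>\<^bsub>P\<^esub> a'" using P.rcos_self[OF ab(1) P'.is_subgroup] ab(4) by simp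
    then obtain r where r: "r \<in> ?P'" "a = r \<otimes>\<^bsub>P\<^esub> a'" unfolding r_coset_def by blast
    then show ?thesis using hom_mult[OF P_hom[OF ab(3)], of r a'] P'.mem_carrier[OF r(1)] ab cl
        hom_trivial_on_derived[OF P D P_hom[OF ab(3)] r(1)] by simp
  qed
  have Q_eq: "\<beta> b a = \<beta> b a'" if ab: "a \<in> carrier Q" "a' \<in> carrier Q" "b \<in> carrier P" "?Q' #>\<^bsub>Q\<^esub> a = ?Q' #>\<^bsub>Q\<^esub> a'" for a a' b
  proof -
    have "a \<in> ?Q' #>\<^bsub>Q\<^esub> a'" using Q.rcos_self[OF ab(1) Q'.is_subgroup] ab(4) by simp
    then obtain r where r: "r \<in> ?Q'" "a = r \<otimes>\<^bsub>Q\<^esub> a'" unfolding r_coset_def by blast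
    then show ?thesis using hom_mult[OF Q_hom[OF ab(3)], of r a'] Q'.mem_carrier[OF r(1)] ab cl
        hom_trivial_on_derived[OF Q D Q_hom[OF ab(3)] r(1)] by simp
  qed
  \<comment> \<open>Representatives are arbitrary; \<open>P_eq\<close> and \<open>Q_eq\<close> make
    the choice immaterial.\<close>
  define \<gamma> where "\<gamma> S T = \<beta> (SOME a. a \<in> carrier P \<and> S = ?P' #>\<^bsub>P\<^esub> a) (SOME b. b \<in> carrier Q \<and> T = ?Q' #>\<^bsub>Q\<^esub> b)" for S T
  have \<gamma>: "\<gamma> (?P' #>\<^bsub>P\<^esub> a) (?Q' #>\<^bsub>Q\<^esub> b) = \<beta> a b" if ab: "a \<in> carrier P" "b \<in> carrier Q" for a b
  proof -
    let ?a = "SOME a'. a' \<in> carrier P \<and> ?P' #>\<^bsub>P\<^esub> a = ?P' #>\<^bsub>P\<^esub> a'"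
    let ?b = "SOME b'. b' \<in> carrier Q \<and> ?Q' #>\<^bsub>Q\<^esub> b = ?Q' #>\<^bsub>Q\<^esub> b'"
    have a: "?a \<in> carrier P \<and> ?P' #>\<^bsub>P\<^esub> a = ?P' #>\<^bsub>P\<^esub> ?a" by (rule someI[of _ a]) (simp add: ab)
    have b: "?b \<in> carrier Q \<and> ?Q' #>\<^bsub>Q\<^esub> b = ?Q' #>\<^bsub>Q\<^esub> ?b" by (rule someI[of _ b]) (simp add: ab)
    show ?thesis unfolding \<gamma>_def using P_eq[of a ?a b] Q_eq[of b ?b ?a] a b ab by simp
  qed
  have "bimult (abelianization P) (abelianization Q) D \<gamma>"
    unfolding bimult_def abelianization_def carrier_FactGroup mult_FactGroup
    using \<beta> by (auto simp: \<gamma> P'.rcos_sum Q'.rcos_sum bimult_def)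
  from tens_universal[OF aP.is_group aQ.is_group D this]
  obtain \<theta> where "\<theta> \<in> hom (ab_tensor P Q) D"
    "\<forall>S\<in>carrier (abelianization P). \<forall>T\<in>carrier (abelianization Q).
       \<theta> (tens (abelianization P) (abelianization Q) S T) = \<gamma> S T"
    unfolding ab_tensor_def by blast
  then show ?thesis unfolding ab_tens_def using \<gamma> abelianization_cosets by (intro bexI[of _ \<theta>]) simp_all
qed

end

section \<open>Central quotients and transgression\<close>

text \<open>The cocycle \<open>f\<close> of \<open>P/B\<close> represents the transgression of the character \<open>\<chi>\<close> of \<open>B\<close>, witnessed by a
  trivialization \<open>u\<close> of its inflation to \<open>P\<close>. Every trivialization \<open>u\<close> arises in this way, with
  \<open>\<chi> b = u b / u 1\<close>.\<close>

definition transgresses :: "('x, 'm) monoid_scheme \<Rightarrow> 'x set \<Rightarrow> ('d, 'n) monoid_scheme \<Rightarrow> ('x set \<times> 'x set \<Rightarrow> 'd)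
    \<Rightarrow> ('x \<Rightarrow> 'd) \<Rightarrow> ('x \<Rightarrow> 'd) \<Rightarrow> bool" where
  "transgresses P B D f \<chi> u \<longleftrightarrow> cobounds P D (pullback P (\<lambda>x. B #>\<^bsub>P\<^esub> x) f) u \<and>
     (\<forall>x\<in>carrier P. \<forall>b\<in>B. u (x \<otimes>\<^bsub>P\<^esub> b) = u x \<otimes>\<^bsub>D\<^esub> \<chi> b)"

locale central_quotient = cohomology P D
  for P :: "('x, 'm) monoid_scheme" and D :: "('d, 'n) monoid_scheme" +
  fixes B :: "'x set"
  assumes B: "subgroup B P"
    and central: "\<And>x b. x \<in> carrier P \<Longrightarrow> b \<in> B \<Longrightarrow> x \<otimes>\<^bsub>P\<^esub> b = b \<otimes>\<^bsub>P\<^esub> x"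
begin

lemma B_mem [simp]: "b \<in> B \<Longrightarrow> b \<in> carrier P"
  using subgroup.mem_carrier[OF B] .

sublocale Bn: normal B P
proof (rule P.normal_invI[OF B])
  fix x b assume "x \<in> carrier P" "b \<in> B"
  then show "x \<otimes>\<^bsub>P\<^esub> b \<otimes>\<^bsub>P\<^esub> inv\<^bsub>P\<^esub> x \<in> B"
    using central[of x b] by (simp add: P.m_assoc)
qed

sublocale Q: cohomology "P Mod B" D
  by (intro cohomology.intro Bn.factorgroup_is_group D.comm_group_axioms)

lemma proj_hom: "(\<lambda>x. B #>\<^bsub>P\<^esub> x) \<in> hom P (P Mod B)"
  by (rule Bn.r_coset_hom_Mod)

lemma proj_closed [simp]: "x \<in> carrier P \<Longrightarrow> B #>\<^bsub>P\<^esub> x \<in> carrier (P Mod B)"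
  by (auto simp: carrier_FactGroup)

lemma Q_cases: assumes "c \<in> carrier (P Mod B)" obtains x where "x \<in> carrier P" "c = B #>\<^bsub>P\<^esub> x"
  using assms by (auto simp: carrier_FactGroup)

lemma proj_mult: "x \<in> carrier P \<Longrightarrow> y \<in> carrier P \<Longrightarrow>
    (B #>\<^bsub>P\<^esub> x) \<otimes>\<^bsub>P Mod B\<^esub> (B #>\<^bsub>P\<^esub> y) = B #>\<^bsub>P\<^esub> (x \<otimes>\<^bsub>P\<^esub> y)"
  by (simp add: Bn.rcos_sum)

lemma proj_central: "x \<in> carrier P \<Longrightarrow> b \<in> B \<Longrightarrow> B #>\<^bsub>P\<^esub> (x \<otimes>\<^bsub>P\<^esub> b) = B #>\<^bsub>P\<^esub> x"
  using P.coset_mult_assoc[OF Bn.subset B_mem, of b x] P.coset_join2[OF B_mem B, of b] central[of x b] by simp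

text \<open>A set-theoretic section of the projection, not normalized at the trivial coset. It
  differs from \<open>x\<close> by an element of \<open>B\<close>.\<close>

definition sec :: "'x set \<Rightarrow> 'x" where "sec c = (SOME x. x \<in> carrier P \<and> c = B #>\<^bsub>P\<^esub> x)"

lemma sec: assumes "x \<in> carrier P"
  shows "sec (B #>\<^bsub>P\<^esub> x) \<in> carrier P" "B #>\<^bsub>P\<^esub> sec (B #>\<^bsub>P\<^esub> x) = B #>\<^bsub>P\<^esub> x"
    "\<exists>b\<in>B. x = sec (B #>\<^bsub>P\<^esub> x) \<otimes>\<^bsub>P\<^esub> b"
proof -
  have s: "sec (B #>\<^bsub>P\<^esub> x) \<in> carrier P \<and> B #>\<^bsub>P\<^esub> x = B #>\<^bsub>P\<^esub> sec (B #>\<^bsub>P\<^esub> x)"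
    unfolding sec_def by (rule someI[of _ x]) (simp add: assms)
  then show "sec (B #>\<^bsub>P\<^esub> x) \<in> carrier P" "B #>\<^bsub>P\<^esub> sec (B #>\<^bsub>P\<^esub> x) = B #>\<^bsub>P\<^esub> x" by auto
  have "x \<in> B #>\<^bsub>P\<^esub> sec (B #>\<^bsub>P\<^esub> x)" using P.rcos_self[OF assms B] s by auto
  then obtain b where "b \<in> B" "x = b \<otimes>\<^bsub>P\<^esub> sec (B #>\<^bsub>P\<^esub> x)" unfolding r_coset_def by blast
  then show "\<exists>b\<in>B. x = sec (B #>\<^bsub>P\<^esub> x) \<otimes>\<^bsub>P\<^esub> b" using central s by auto
qed

lemma invariant_sec:
  assumes "\<And>x b. x \<in> carrier P \<Longrightarrow> b \<in> B \<Longrightarrow> w (x \<otimes>\<^bsub>P\<^esub> b) = w x" "x \<in> carrier P"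
  shows "w (sec (B #>\<^bsub>P\<^esub> x)) = w x"
proof -
  obtain b where b: "b \<in> B" "x = sec (B #>\<^bsub>P\<^esub> x) \<otimes>\<^bsub>P\<^esub> b" using sec(3)[OF assms(2)] by blast
  show ?thesis using assms(1)[OF sec(1)[OF assms(2)] b(1)] b(2) by simp
qed

text \<open>Inverts inflation on the level of cocycles: by invariance, the value at section
  representatives is the value at all representatives, so the cocycle identity carries over to
  cosets.\<close>

lemma descend_cocycle:
  assumes F: "F \<in> Z2"
    and inv1: "\<And>x y b. x \<in> carrier P \<Longrightarrow> y \<in> carrier P \<Longrightarrow> b \<in> B \<Longrightarrow> F (x \<otimes>\<^bsub>P\<^esub> b, y) = F (x, y)"
    and inv2: "\<And>x y b. x \<in> carrier P \<Longrightarrow> y \<in> carrier P \<Longrightarrow> b \<in> B \<Longrightarrow> F (x, y \<otimes>\<^bsub>P\<^esub> b) = F (x, y)"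
  shows "\<exists>f\<in>Q.Z2. \<forall>x\<in>carrier P. \<forall>y\<in>carrier P. f (B #>\<^bsub>P\<^esub> x, B #>\<^bsub>P\<^esub> y) = F (x, y)"
proof -
  let ?f = "\<lambda>p\<in>carrier (P Mod B) \<times> carrier (P Mod B). F (sec (fst p), sec (snd p))"
  have f: "?f (B #>\<^bsub>P\<^esub> x, B #>\<^bsub>P\<^esub> y) = F (x, y)" if "x \<in> carrier P" "y \<in> carrier P" for x y
    using invariant_sec[of "\<lambda>x. F (x, sec (B #>\<^bsub>P\<^esub> y))" x] invariant_sec[of "\<lambda>y. F (x, y)" y]
      inv1 inv2 that sec(1) by simp
  have "?f \<in> Q.Z2"
  proof (rule Q.Z2I)
    fix a b assume "a \<in> carrier (P Mod B)" "b \<in> carrier (P Mod B)"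
    then obtain x y where xy: "x \<in> carrier P" "a = B #>\<^bsub>P\<^esub> x" "y \<in> carrier P" "b = B #>\<^bsub>P\<^esub> y"
      by (elim Q_cases)
    show "?f (a, b) \<in> carrier D" unfolding xy f[OF xy(1,3)] using F xy by simp
    fix c assume "c \<in> carrier (P Mod B)"
    then obtain z where z: "z \<in> carrier P" "c = B #>\<^bsub>P\<^esub> z" by (elim Q_cases)
    show "?f (b, c) \<otimes>\<^bsub>D\<^esub> ?f (a, b \<otimes>\<^bsub>P Mod B\<^esub> c) = ?f (a \<otimes>\<^bsub>P Mod B\<^esub> b, c) \<otimes>\<^bsub>D\<^esub> ?f (a, b)"
      unfolding xy z proj_mult[OF xy(1,3)] proj_mult[OF xy(3) z(1)]
      using xy z F by (simp only: f P.m_closed Z2_cocycle)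
  qed simp
  then show ?thesis using f by blast
qed

lemma transgressesI:
  assumes "u \<in> carrier P \<rightarrow> carrier D"
    and "\<And>x y. x \<in> carrier P \<Longrightarrow> y \<in> carrier P \<Longrightarrow>
         f (B #>\<^bsub>P\<^esub> x, B #>\<^bsub>P\<^esub> y) \<otimes>\<^bsub>D\<^esub> u (x \<otimes>\<^bsub>P\<^esub> y) = u x \<otimes>\<^bsub>D\<^esub> u y"
    and "\<And>x b. x \<in> carrier P \<Longrightarrow> b \<in> B \<Longrightarrow> u (x \<otimes>\<^bsub>P\<^esub> b) = u x \<otimes>\<^bsub>D\<^esub> \<chi> b"
  shows "transgresses P B D f \<chi> u"
  using assms by (simp add: transgresses_def cobounds_def)

lemma transgressesD:
  assumes "transgresses P B D f \<chi> u"
  shows "\<And>x. x \<in> carrier P \<Longrightarrow> u x \<in> carrier D"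
    and "\<And>x y. x \<in> carrier P \<Longrightarrow> y \<in> carrier P \<Longrightarrow>
         f (B #>\<^bsub>P\<^esub> x, B #>\<^bsub>P\<^esub> y) \<otimes>\<^bsub>D\<^esub> u (x \<otimes>\<^bsub>P\<^esub> y) = u x \<otimes>\<^bsub>D\<^esub> u y"
    and "\<And>x b. x \<in> carrier P \<Longrightarrow> b \<in> B \<Longrightarrow> u (x \<otimes>\<^bsub>P\<^esub> b) = u x \<otimes>\<^bsub>D\<^esub> \<chi> b"
    and "cobounds P D (pullback P (\<lambda>x. B #>\<^bsub>P\<^esub> x) f) u"
  using assms by (auto simp: transgresses_def cobounds_def)

lemma pullback_proj_Z2: "f \<in> Q.Z2 \<Longrightarrow> pullback P (\<lambda>x. B #>\<^bsub>P\<^esub> x) f \<in> Z2"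
  by (rule pullback_Z2[OF Q.P.is_group proj_hom])

lemma hom_B_closed: "\<chi> \<in> hom (P\<lparr>carrier := B\<rparr>) D \<Longrightarrow> b \<in> B \<Longrightarrow> \<chi> b \<in> carrier D"
  by (auto simp: hom_def)

lemma B_group: "group (P\<lparr>carrier := B\<rparr>)"
  using P.subgroup_imp_group[OF B] .

lemma transgresses_div:
  assumes "f \<in> Q.Z2" "g \<in> Q.Z2" and f: "transgresses P B D f \<chi> u" and g: "transgresses P B D g \<eta> v"
    and "\<chi> \<in> hom (P\<lparr>carrier := B\<rparr>) D" "\<eta> \<in> hom (P\<lparr>carrier := B\<rparr>) D"
  shows "transgresses P B D (f \<otimes>\<^bsub>cocycle_group (P Mod B) D\<^esub> inv\<^bsub>cocycle_group (P Mod B) D\<^esub> g)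
     (\<lambda>b. \<chi> b \<otimes>\<^bsub>D\<^esub> inv\<^bsub>D\<^esub> \<eta> b) (\<lambda>x. u x \<otimes>\<^bsub>D\<^esub> inv\<^bsub>D\<^esub> v x)"
  by (rule transgressesI) (use assms(1,2) hom_B_closed[OF assms(5)] hom_B_closed[OF assms(6)] in
     \<open>auto simp: Q.div_cocycle_group D.div_mult_div transgressesD[OF f] transgressesD[OF g]\<close>)

lemma transgresses_mult:
  assumes "f \<in> Q.Z2" "g \<in> Q.Z2" and f: "transgresses P B D f \<chi> u" and g: "transgresses P B D g \<eta> v"
    and "\<chi> \<in> hom (P\<lparr>carrier := B\<rparr>) D" "\<eta> \<in> hom (P\<lparr>carrier := B\<rparr>) D"
  shows "transgresses P B D (f \<otimes>\<^bsub>cocycle_group (P Mod B) D\<^esub> g)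
     (\<lambda>b. \<chi> b \<otimes>\<^bsub>D\<^esub> \<eta> b) (\<lambda>x. u x \<otimes>\<^bsub>D\<^esub> v x)"
proof (rule transgressesI)
  show "(\<lambda>x. u x \<otimes>\<^bsub>D\<^esub> v x) \<in> carrier P \<rightarrow> carrier D" using transgressesD(1)[OF f] transgressesD(1)[OF g] by simp
next
  fix x y assume xy: "x \<in> carrier P" "y \<in> carrier P"
  show "(f \<otimes>\<^bsub>cocycle_group (P Mod B) D\<^esub> g) (B #>\<^bsub>P\<^esub> x, B #>\<^bsub>P\<^esub> y) \<otimes>\<^bsub>D\<^esub> (u (x \<otimes>\<^bsub>P\<^esub> y) \<otimes>\<^bsub>D\<^esub> v (x \<otimes>\<^bsub>P\<^esub> y))
      = u x \<otimes>\<^bsub>D\<^esub> v x \<otimes>\<^bsub>D\<^esub> (u y \<otimes>\<^bsub>D\<^esub> v y)"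
    using D.mult_mult_swap[of "f (B #>\<^bsub>P\<^esub> x, B #>\<^bsub>P\<^esub> y)" "g (B #>\<^bsub>P\<^esub> x, B #>\<^bsub>P\<^esub> y)" "u (x \<otimes>\<^bsub>P\<^esub> y)" "v (x \<otimes>\<^bsub>P\<^esub> y)"]
      D.mult_mult_swap[of "u x" "v x" "u y" "v y"] xy assms(1,2)
    by (simp add: Q.mult_cocycle_group transgressesD[OF f] transgressesD[OF g])
next
  fix x b assume xb: "x \<in> carrier P" "b \<in> B"
  then show "u (x \<otimes>\<^bsub>P\<^esub> b) \<otimes>\<^bsub>D\<^esub> v (x \<otimes>\<^bsub>P\<^esub> b) = u x \<otimes>\<^bsub>D\<^esub> v x \<otimes>\<^bsub>D\<^esub> (\<chi> b \<otimes>\<^bsub>D\<^esub> \<eta> b)"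
    using hom_B_closed[OF assms(5)] hom_B_closed[OF assms(6)] D.mult_mult_swap[of "u x" "\<chi> b" "v x" "\<eta> b"]
    by (simp add: transgressesD[OF f] transgressesD[OF g])
qed

lemma transgresses_cong: "transgresses P B D f \<chi> u \<Longrightarrow> (\<And>b. b \<in> B \<Longrightarrow> \<chi> b = \<eta> b) \<Longrightarrow> transgresses P B D f \<eta> u"
  by (simp add: transgresses_def)

text \<open>A trivialization is unique only up to a character of \<open>P\<close>. So a cocycle
  determines the transgressed character only up to restrictions of characters of \<open>P\<close>,
  and this freedom is used to adjust it.\<close>

lemma transgresses_twist:
  assumes f: "transgresses P B D f \<chi> u" "f \<in> Q.Z2" and \<chi>: "\<chi> \<in> hom (P\<lparr>carrier := B\<rparr>) D" and \<psi>: "\<psi> \<in> hom P D"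
  shows "transgresses P B D f (\<lambda>b. \<chi> b \<otimes>\<^bsub>D\<^esub> \<psi> b) (\<lambda>x. u x \<otimes>\<^bsub>D\<^esub> \<psi> x)"
proof (rule transgressesI)
  note c = hom_in_carrier[OF \<psi>] transgressesD[OF f(1)]
  show "(\<lambda>x. u x \<otimes>\<^bsub>D\<^esub> \<psi> x) \<in> carrier P \<rightarrow> carrier D" using c by simp
  show "f (B #>\<^bsub>P\<^esub> x, B #>\<^bsub>P\<^esub> y) \<otimes>\<^bsub>D\<^esub> (u (x \<otimes>\<^bsub>P\<^esub> y) \<otimes>\<^bsub>D\<^esub> \<psi> (x \<otimes>\<^bsub>P\<^esub> y)) = u x \<otimes>\<^bsub>D\<^esub> \<psi> x \<otimes>\<^bsub>D\<^esub> (u y \<otimes>\<^bsub>D\<^esub> \<psi> y)"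
    if "x \<in> carrier P" "y \<in> carrier P" for x y
    using that f(2) D.mult_mult_swap[of "u x" "\<psi> x" "u y" "\<psi> y"]
    by (simp add: c D.m_assoc[symmetric] hom_mult[OF \<psi>])
  show "u (x \<otimes>\<^bsub>P\<^esub> b) \<otimes>\<^bsub>D\<^esub> \<psi> (x \<otimes>\<^bsub>P\<^esub> b) = u x \<otimes>\<^bsub>D\<^esub> \<psi> x \<otimes>\<^bsub>D\<^esub> (\<chi> b \<otimes>\<^bsub>D\<^esub> \<psi> b)"
    if "x \<in> carrier P" "b \<in> B" for x b
    using that D.mult_mult_swap[of "u x" "\<chi> b" "\<psi> x" "\<psi> b"] hom_B_closed[OF \<chi>]
    by (simp add: c hom_mult[OF \<psi>])
qed

text \<open>Elements of \<open>B\<close> are trivial in the quotient, where the cocycle takes the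
  constant value \<open>f (1, 1) = u 1\<close>. The coboundary equation at \<open>(x, b)\<close>
  thus reads \<open>u 1 u (x b) = u x u b\<close>. The division by \<open>u 1\<close> compensates
  for the missing normalization.\<close>

lemma cobounds_imp_transgresses:
  assumes f: "f \<in> Q.Z2" and u: "cobounds P D (pullback P (\<lambda>x. B #>\<^bsub>P\<^esub> x) f) u"
  shows "(\<lambda>b. u b \<otimes>\<^bsub>D\<^esub> inv\<^bsub>D\<^esub> u \<one>\<^bsub>P\<^esub>) \<in> hom (P\<lparr>carrier := B\<rparr>) D"
    and "transgresses P B D f (\<lambda>b. u b \<otimes>\<^bsub>D\<^esub> inv\<^bsub>D\<^esub> u \<one>\<^bsub>P\<^esub>) u"
proof -
  have uc: "\<And>x. x \<in> carrier P \<Longrightarrow> u x \<in> carrier D" using cobounds_closed[OF u] .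
  have fu: "f (B #>\<^bsub>P\<^esub> x, B #>\<^bsub>P\<^esub> y) \<otimes>\<^bsub>D\<^esub> u (x \<otimes>\<^bsub>P\<^esub> y) = u x \<otimes>\<^bsub>D\<^esub> u y"
    if "x \<in> carrier P" "y \<in> carrier P" for x y using coboundsD[OF u that] that by simp
  have f1: "f (B, B) = u \<one>\<^bsub>P\<^esub>" using fu[of "\<one>\<^bsub>P\<^esub>" "\<one>\<^bsub>P\<^esub>"] f Q.Z2_closed[OF f, of B B] Q.P.one_closed
    by (simp add: Bn.rcos_one uc)
  have ub: "u (x \<otimes>\<^bsub>P\<^esub> b) = u x \<otimes>\<^bsub>D\<^esub> (u b \<otimes>\<^bsub>D\<^esub> inv\<^bsub>D\<^esub> u \<one>\<^bsub>P\<^esub>)" if xb: "x \<in> carrier P" "b \<in> B" for x b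
  proof -
    have "B #>\<^bsub>P\<^esub> b = \<one>\<^bsub>P Mod B\<^esub>" using xb Bn.rcos_eq_self_iff by simp
    then have "u \<one>\<^bsub>P\<^esub> \<otimes>\<^bsub>D\<^esub> u (x \<otimes>\<^bsub>P\<^esub> b) = u x \<otimes>\<^bsub>D\<^esub> u b"
      using fu[of x b] xb Q.Z2_one_right[OF f proj_closed[OF xb(1)]] f1 by simp
    then have "u (x \<otimes>\<^bsub>P\<^esub> b) = u x \<otimes>\<^bsub>D\<^esub> u b \<otimes>\<^bsub>D\<^esub> inv\<^bsub>D\<^esub> u \<one>\<^bsub>P\<^esub>"
      using xb by (subst D.div_eq_iff) (simp_all add: uc D.m_comm)
    then show ?thesis using xb by (simp add: uc D.m_assoc)
  qed
  show "transgresses P B D f (\<lambda>b. u b \<otimes>\<^bsub>D\<^esub> inv\<^bsub>D\<^esub> u \<one>\<^bsub>P\<^esub>) u" by (rule transgressesI) (simp_all add: uc fu ub)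
  show "(\<lambda>b. u b \<otimes>\<^bsub>D\<^esub> inv\<^bsub>D\<^esub> u \<one>\<^bsub>P\<^esub>) \<in> hom (P\<lparr>carrier := B\<rparr>) D"
  proof (rule homI)
    fix a b assume "a \<in> carrier (P\<lparr>carrier := B\<rparr>)" "b \<in> carrier (P\<lparr>carrier := B\<rparr>)"
    then show "u (a \<otimes>\<^bsub>P\<lparr>carrier := B\<rparr>\<^esub> b) \<otimes>\<^bsub>D\<^esub> inv\<^bsub>D\<^esub> u \<one>\<^bsub>P\<^esub> = u a \<otimes>\<^bsub>D\<^esub> inv\<^bsub>D\<^esub> u \<one>\<^bsub>P\<^esub> \<otimes>\<^bsub>D\<^esub> (u b \<otimes>\<^bsub>D\<^esub> inv\<^bsub>D\<^esub> u \<one>\<^bsub>P\<^esub>)"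
      by (simp add: ub uc D.m_ac)
  qed (simp add: uc)
qed

text \<open>Up to inversion, the cocycle is the image under \<open>\<chi>\<close> of the extension
  cocycle attached to \<open>sec\<close>. It is obtained as the coboundary of \<open>u\<close>:
  since \<open>u (x b) = u x \<chi> b\<close> and \<open>b\<close> is central, the factors
  \<open>\<chi> b\<close> cancel, and the coboundary is constant on cosets of \<open>B\<close>
  although \<open>u\<close> is not.\<close>

lemma transgresses_exists:
  assumes \<chi>: "\<chi> \<in> hom (P\<lparr>carrier := B\<rparr>) D"
  shows "\<exists>f\<in>Q.Z2. \<exists>u. transgresses P B D f \<chi> u"
proof -
  \<comment> \<open>\<open>\<chi>\<close> applied to the \<open>B\<close>-component of
    \<open>x\<close> relative to the section.\<close>
  define u where "u x = \<chi> (inv\<^bsub>P\<^esub> sec (B #>\<^bsub>P\<^esub> x) \<otimes>\<^bsub>P\<^esub> x)" for x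
  have sx: "inv\<^bsub>P\<^esub> sec (B #>\<^bsub>P\<^esub> x) \<otimes>\<^bsub>P\<^esub> x \<in> B" if x: "x \<in> carrier P" for x
  proof -
    obtain b where b: "b \<in> B" "x = sec (B #>\<^bsub>P\<^esub> x) \<otimes>\<^bsub>P\<^esub> b" using sec(3)[OF x] by blast
    have "inv\<^bsub>P\<^esub> sec (B #>\<^bsub>P\<^esub> x) \<otimes>\<^bsub>P\<^esub> x = b"
      using P.inv_cancel_left(1)[OF sec(1)[OF x] B_mem[OF b(1)]] unfolding b(2)[symmetric] .
    then show ?thesis using b by simp
  qed
  have uc: "u x \<in> carrier D" if "x \<in> carrier P" for x
    unfolding u_def using hom_B_closed[OF \<chi> sx[OF that]] .
  have ub: "u (x \<otimes>\<^bsub>P\<^esub> b) = u x \<otimes>\<^bsub>D\<^esub> \<chi> b" if "x \<in> carrier P" "b \<in> B" for x b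
    unfolding u_def using hom_mult[OF \<chi>, of "inv\<^bsub>P\<^esub> sec (B #>\<^bsub>P\<^esub> x) \<otimes>\<^bsub>P\<^esub> x" b] that sx[OF that(1)] sec(1)[OF that(1)]
    by (simp add: proj_central P.m_assoc)
  let ?F = "\<lambda>p\<in>carrier P \<times> carrier P. u (fst p) \<otimes>\<^bsub>D\<^esub> u (snd p) \<otimes>\<^bsub>D\<^esub> inv\<^bsub>D\<^esub> (u (fst p \<otimes>\<^bsub>P\<^esub> snd p))"
  have cancel: "a \<otimes>\<^bsub>D\<^esub> e \<otimes>\<^bsub>D\<^esub> b \<otimes>\<^bsub>D\<^esub> inv\<^bsub>D\<^esub> (c \<otimes>\<^bsub>D\<^esub> e) = a \<otimes>\<^bsub>D\<^esub> b \<otimes>\<^bsub>D\<^esub> inv\<^bsub>D\<^esub> c"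
    "a \<otimes>\<^bsub>D\<^esub> (b \<otimes>\<^bsub>D\<^esub> e) \<otimes>\<^bsub>D\<^esub> inv\<^bsub>D\<^esub> (c \<otimes>\<^bsub>D\<^esub> e) = a \<otimes>\<^bsub>D\<^esub> b \<otimes>\<^bsub>D\<^esub> inv\<^bsub>D\<^esub> c"
    if "a \<in> carrier D" "b \<in> carrier D" "c \<in> carrier D" "e \<in> carrier D" for a b c e
    using that D.div_mult_div[of "a \<otimes>\<^bsub>D\<^esub> b" c e e] by (simp_all add: D.m_ac)
  have "\<exists>f\<in>Q.Z2. \<forall>x\<in>carrier P. \<forall>y\<in>carrier P. f (B #>\<^bsub>P\<^esub> x, B #>\<^bsub>P\<^esub> y) = ?F (x, y)"
  proof (rule descend_cocycle)
    show "?F \<in> Z2" by (rule coboundary_in_Z2) (simp add: uc)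
    fix x y b assume xyb: "x \<in> carrier P" "y \<in> carrier P" "b \<in> B"
    have xby: "x \<otimes>\<^bsub>P\<^esub> b \<otimes>\<^bsub>P\<^esub> y = x \<otimes>\<^bsub>P\<^esub> y \<otimes>\<^bsub>P\<^esub> b" using xyb central[of y b] by (simp add: P.m_assoc)
    show "?F (x \<otimes>\<^bsub>P\<^esub> b, y) = ?F (x, y)"
      using xyb xby by (simp add: ub uc cancel hom_B_closed[OF \<chi>])
    have "x \<otimes>\<^bsub>P\<^esub> (y \<otimes>\<^bsub>P\<^esub> b) = x \<otimes>\<^bsub>P\<^esub> y \<otimes>\<^bsub>P\<^esub> b" using xyb by (simp add: P.m_assoc)
    then show "?F (x, y \<otimes>\<^bsub>P\<^esub> b) = ?F (x, y)"
      using xyb by (simp add: ub uc cancel hom_B_closed[OF \<chi>])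
  qed
  then obtain f where f: "f \<in> Q.Z2" "\<And>x y. x \<in> carrier P \<Longrightarrow> y \<in> carrier P \<Longrightarrow> f (B #>\<^bsub>P\<^esub> x, B #>\<^bsub>P\<^esub> y) = ?F (x, y)" by blast
  have "transgresses P B D f \<chi> u"
    by (rule transgressesI) (simp_all add: uc ub f(2) D.m_assoc)
  then show ?thesis using f(1) by blast
qed

text \<open>Exactness of the five-term sequence at the characters of \<open>B\<close>. If
  \<open>v\<close> trivializes \<open>f\<close> on the quotient, then \<open>u\<close> divided by
  the pullback of \<open>v\<close> trivializes the trivial cocycle, so it is a character; it equals
  \<open>\<chi>\<close> on \<open>B\<close> because the pullback of \<open>v\<close> does not vary
  there. Conversely, \<open>u\<close> divided by an extension of \<open>\<chi>\<close> is constant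
  on cosets of \<open>B\<close> and descends.\<close>

lemma transgresses_coboundary_iff_extends:
  assumes f: "f \<in> Q.Z2" and t: "transgresses P B D f \<chi> u" and \<chi>: "\<chi> \<in> hom (P\<lparr>carrier := B\<rparr>) D"
  shows "(\<exists>v. cobounds (P Mod B) D f v) \<longleftrightarrow> (\<exists>\<psi>\<in>hom P D. \<forall>b\<in>B. \<psi> b = \<chi> b)"
proof
  let ?pf = "pullback P (\<lambda>x. B #>\<^bsub>P\<^esub> x) f"
  note pf = pullback_proj_Z2[OF f]
  assume "\<exists>v. cobounds (P Mod B) D f v"
  then obtain v where v: "cobounds (P Mod B) D f v" by blast
  have vc: "v (B #>\<^bsub>P\<^esub> x) \<in> carrier D" if "x \<in> carrier P" for x using Q.cobounds_closed[OF v] that by simp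
  define \<psi> where "\<psi> x = u x \<otimes>\<^bsub>D\<^esub> inv\<^bsub>D\<^esub> v (B #>\<^bsub>P\<^esub> x)" for x
  have "cobounds P D (?pf \<otimes>\<^bsub>cocycle_group P D\<^esub> inv\<^bsub>cocycle_group P D\<^esub> ?pf) \<psi>"
    unfolding \<psi>_def using cobounds_div[OF pf pf transgressesD(4)[OF t] pullback_cob[OF proj_hom v]] .
  then have c: "cobounds P D \<one>\<^bsub>cocycle_group P D\<^esub> \<psi>" using pf by simp
  have \<psi>: "\<psi> \<in> hom P D"
  proof (rule homI)
    fix x y assume "x \<in> carrier P" "y \<in> carrier P"
    then show "\<psi> (x \<otimes>\<^bsub>P\<^esub> y) = \<psi> x \<otimes>\<^bsub>D\<^esub> \<psi> y" using coboundsD[OF c, of x y] cobounds_closed[OF c] by (simp add: one_cocycle_group)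
  qed (rule cobounds_closed[OF c])
  have one: "\<psi> \<one>\<^bsub>P\<^esub> = \<one>\<^bsub>D\<^esub>" using hom_one[OF \<psi> P.is_group D.is_group] .
  have "\<psi> b = \<chi> b" if b: "b \<in> B" for b
  proof -
    have "\<psi> b = u (\<one>\<^bsub>P\<^esub> \<otimes>\<^bsub>P\<^esub> b) \<otimes>\<^bsub>D\<^esub> inv\<^bsub>D\<^esub> v (B #>\<^bsub>P\<^esub> \<one>\<^bsub>P\<^esub>)"
      unfolding \<psi>_def using proj_central[OF P.one_closed b] b by simp
    also have "\<dots> = u \<one>\<^bsub>P\<^esub> \<otimes>\<^bsub>D\<^esub> \<chi> b \<otimes>\<^bsub>D\<^esub> inv\<^bsub>D\<^esub> v (B #>\<^bsub>P\<^esub> \<one>\<^bsub>P\<^esub>)"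
      by (simp only: transgressesD(3)[OF t P.one_closed b])
    also have "\<dots> = \<psi> \<one>\<^bsub>P\<^esub> \<otimes>\<^bsub>D\<^esub> \<chi> b"
      unfolding \<psi>_def using b vc[OF P.one_closed] transgressesD(1)[OF t P.one_closed] hom_B_closed[OF \<chi> b]
      by (simp only: D.m_ac D.inv_closed D.m_closed)
    finally show ?thesis using one hom_B_closed[OF \<chi> b] by simp
  qed
  then show "\<exists>\<psi>\<in>hom P D. \<forall>b\<in>B. \<psi> b = \<chi> b" using \<psi> by blast
next
  assume "\<exists>\<psi>\<in>hom P D. \<forall>b\<in>B. \<psi> b = \<chi> b"
  then obtain \<psi> where \<psi>: "\<psi> \<in> hom P D" "\<And>b. b \<in> B \<Longrightarrow> \<psi> b = \<chi> b" by blast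
  let ?w = "\<lambda>x. u x \<otimes>\<^bsub>D\<^esub> inv\<^bsub>D\<^esub> \<psi> x"
  have "transgresses P B D f (\<lambda>b. \<chi> b \<otimes>\<^bsub>D\<^esub> inv\<^bsub>D\<^esub> \<psi> b) ?w"
    by (rule transgresses_twist[OF t f \<chi> hom_inv_closed[OF P.is_group D.comm_group_axioms \<psi>(1)]])
  then have w: "transgresses P B D f (\<lambda>b. \<one>\<^bsub>D\<^esub>) ?w"
    by (rule transgresses_cong) (simp add: \<psi>(2) hom_B_closed[OF \<chi>])
  have inv: "?w (x \<otimes>\<^bsub>P\<^esub> b) = ?w x" if "x \<in> carrier P" "b \<in> B" for x b
    using transgressesD(3)[OF w that] transgressesD(1)[OF w that(1)] by simp
  have v: "?w (sec (B #>\<^bsub>P\<^esub> x)) = ?w x" if "x \<in> carrier P" for x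
    using invariant_sec[of ?w x] inv that by blast
  have "cobounds (P Mod B) D f (\<lambda>c. ?w (sec c))"
  proof (rule Q.coboundsI)
    show "(\<lambda>c. ?w (sec c)) \<in> carrier (P Mod B) \<rightarrow> carrier D"
      using transgressesD(1)[OF w] by (auto simp: carrier_FactGroup v)
    fix a b assume "a \<in> carrier (P Mod B)" "b \<in> carrier (P Mod B)"
    then obtain x y where xy: "x \<in> carrier P" "a = B #>\<^bsub>P\<^esub> x" "y \<in> carrier P" "b = B #>\<^bsub>P\<^esub> y"
      by (elim Q_cases)
    show "f (a, b) \<otimes>\<^bsub>D\<^esub> ?w (sec (a \<otimes>\<^bsub>P Mod B\<^esub> b)) = ?w (sec a) \<otimes>\<^bsub>D\<^esub> ?w (sec b)"
      unfolding xy(2,4) proj_mult[OF xy(1,3)] v[OF xy(1)] v[OF xy(3)] v[OF P.m_closed[OF xy(1,3)]]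
      by (rule transgressesD(2)[OF w xy(1,3)])
  qed
  then show "\<exists>v. cobounds (P Mod B) D f v" by blast
qed

lemma transgresses_coboundary_iff:
  assumes "divisible_group D"
    and f: "f \<in> Q.Z2" and t: "transgresses P B D f \<chi> u" and \<chi>: "\<chi> \<in> hom (P\<lparr>carrier := B\<rparr>) D"
  shows "(\<exists>v. cobounds (P Mod B) D f v) \<longleftrightarrow> (\<forall>b\<in>B \<inter> derived P (carrier P). \<chi> b = \<one>\<^bsub>D\<^esub>)"
  unfolding transgresses_coboundary_iff_extends[OF f t \<chi>]
proof
  assume "\<exists>\<psi>\<in>hom P D. \<forall>b\<in>B. \<psi> b = \<chi> b"
  then obtain \<psi> where "\<psi> \<in> hom P D" "\<And>b. b \<in> B \<Longrightarrow> \<psi> b = \<chi> b" by blast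
  then show "\<forall>b\<in>B \<inter> derived P (carrier P). \<chi> b = \<one>\<^bsub>D\<^esub>"
    using hom_trivial_on_derived[OF P.is_group D.comm_group_axioms, of \<psi>] by force
next
  assume "\<forall>b\<in>B \<inter> derived P (carrier P). \<chi> b = \<one>\<^bsub>D\<^esub>"
  then show "\<exists>\<psi>\<in>hom P D. \<forall>b\<in>B. \<psi> b = \<chi> b"
    using divisible_extension[OF P.is_group D.comm_group_axioms assms(1) B \<chi>] by blast
qed

text \<open>A trivialization over \<open>P/C\<close> is a trivialization over \<open>P\<close> that
  is constant on cosets of \<open>C\<close>, that is, one whose character is trivial on
  \<open>C\<close>. The map \<open>q\<close> is given by its effect on cosets only, so that any
  description of the natural map fits.\<close>

lemma infl_trivial_iff:
  assumes C: "subgroup C P" "C \<subseteq> B"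
    and q: "\<And>x. x \<in> carrier P \<Longrightarrow> q (C #>\<^bsub>P\<^esub> x) = B #>\<^bsub>P\<^esub> x"
    and f: "f \<in> Q.Z2"
  shows "infl (P Mod C) (P Mod B) D q (H2_class (P Mod B) D f) = \<one>\<^bsub>H2 (P Mod C) D\<^esub> \<longleftrightarrow>
    (\<exists>\<chi>\<in>hom (P\<lparr>carrier := B\<rparr>) D. \<exists>u. transgresses P B D f \<chi> u \<and> (\<forall>c\<in>C. \<chi> c = \<one>\<^bsub>D\<^esub>))"
    and "q \<in> hom (P Mod C) (P Mod B)"
proof -
  interpret C: central_quotient P D C
    by (intro central_quotient.intro cohomology_axioms central_quotient_axioms.intro C(1))
      (use C(2) central in auto)
  show q_hom: "q \<in> hom (P Mod C) (P Mod B)"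
  proof (rule homI)
    fix a b assume "a \<in> carrier (P Mod C)" "b \<in> carrier (P Mod C)"
    then obtain x y where xy: "x \<in> carrier P" "a = C #>\<^bsub>P\<^esub> x" "y \<in> carrier P" "b = C #>\<^bsub>P\<^esub> y"
      by (elim C.Q_cases)
    show "q a \<in> carrier (P Mod B)" using xy q by simp
    show "q (a \<otimes>\<^bsub>P Mod C\<^esub> b) = q a \<otimes>\<^bsub>P Mod B\<^esub> q b"
      unfolding xy(2,4) C.proj_mult[OF xy(1,3)] q[OF xy(1)] q[OF xy(3)] q[OF P.m_closed[OF xy(1,3)]]
      by (rule proj_mult[OF xy(1,3), symmetric])
  qed
  let ?pf = "pullback (P Mod C) q f"
  have pf: "?pf \<in> C.Q.Z2" by (rule C.Q.pullback_Z2[OF Q.P.is_group q_hom f])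
  have pfx: "?pf (C #>\<^bsub>P\<^esub> x, C #>\<^bsub>P\<^esub> y) = f (B #>\<^bsub>P\<^esub> x, B #>\<^bsub>P\<^esub> y)" if "x \<in> carrier P" "y \<in> carrier P" for x y
    using that q by simp
  have "infl (P Mod C) (P Mod B) D q (H2_class (P Mod B) D f) = \<one>\<^bsub>H2 (P Mod C) D\<^esub> \<longleftrightarrow> (\<exists>v. cobounds (P Mod C) D ?pf v)"
    using C.Q.infl_cls[OF Q.P.is_group q_hom f] C.Q.H2_class_one_iff[OF pf] by simp
  also have "\<dots> \<longleftrightarrow> (\<exists>\<chi>\<in>hom (P\<lparr>carrier := B\<rparr>) D. \<exists>u. transgresses P B D f \<chi> u \<and> (\<forall>c\<in>C. \<chi> c = \<one>\<^bsub>D\<^esub>))"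
  proof
    assume "\<exists>v. cobounds (P Mod C) D ?pf v"
    then obtain v where v: "cobounds (P Mod C) D ?pf v" by blast
    let ?u = "\<lambda>x. v (C #>\<^bsub>P\<^esub> x)"
    have "cobounds P D (pullback P (\<lambda>x. C #>\<^bsub>P\<^esub> x) ?pf) ?u" using pullback_cob[OF C.proj_hom v] .
    then have u: "cobounds P D (pullback P (\<lambda>x. B #>\<^bsub>P\<^esub> x) f) ?u" by (simp add: cobounds_def pfx del: pullback_apply)
        (simp add: pfx q)
    have triv: "?u c \<otimes>\<^bsub>D\<^esub> inv\<^bsub>D\<^esub> ?u \<one>\<^bsub>P\<^esub> = \<one>\<^bsub>D\<^esub>" if c: "c \<in> C" for c
      using C.proj_central[OF P.one_closed c] c cobounds_closed[OF u] by simp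
    show "\<exists>\<chi>\<in>hom (P\<lparr>carrier := B\<rparr>) D. \<exists>u. transgresses P B D f \<chi> u \<and> (\<forall>c\<in>C. \<chi> c = \<one>\<^bsub>D\<^esub>)"
      by (rule bexI[OF _ cobounds_imp_transgresses(1)[OF f u]], rule exI[of _ ?u])
        (simp add: cobounds_imp_transgresses(2)[OF f u] triv)
  next
    assume "\<exists>\<chi>\<in>hom (P\<lparr>carrier := B\<rparr>) D. \<exists>u. transgresses P B D f \<chi> u \<and> (\<forall>c\<in>C. \<chi> c = \<one>\<^bsub>D\<^esub>)"
    then obtain \<chi> u where t: "transgresses P B D f \<chi> u" "\<And>c. c \<in> C \<Longrightarrow> \<chi> c = \<one>\<^bsub>D\<^esub>" by blast
    have inv: "u (x \<otimes>\<^bsub>P\<^esub> c) = u x" if "x \<in> carrier P" "c \<in> C" for x c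
      using transgressesD(3)[OF t(1) that(1)] transgressesD(1)[OF t(1) that(1)] t(2) C(2) that(2) by auto
    \<comment> \<open>Seen from \<open>C\<close>, the inflated cocycle transgresses the trivial
      character. This extends trivially to \<open>P\<close>, so the cocycle is a coboundary over
      \<open>P/C\<close>.\<close>
    have t1: "transgresses P C D ?pf (\<lambda>_. \<one>\<^bsub>D\<^esub>) u"
      by (rule C.transgressesI) (simp_all add: transgressesD[OF t(1)] inv pfx del: pullback_apply)
    have h1: "(\<lambda>_. \<one>\<^bsub>D\<^esub>) \<in> hom (P\<lparr>carrier := C\<rparr>) D" "(\<lambda>_. \<one>\<^bsub>D\<^esub>) \<in> hom P D"
      by (simp_all add: hom_def)
    show "\<exists>v. cobounds (P Mod C) D ?pf v"
      by (rule iffD2[OF C.transgresses_coboundary_iff_extends[OF pf t1 h1(1)]], rule bexI[OF _ h1(2)]) simp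
  qed
  finally show "infl (P Mod C) (P Mod B) D q (H2_class (P Mod B) D f) = \<one>\<^bsub>H2 (P Mod C) D\<^esub> \<longleftrightarrow>
    (\<exists>\<chi>\<in>hom (P\<lparr>carrier := B\<rparr>) D. \<exists>u. transgresses P B D f \<chi> u \<and> (\<forall>c\<in>C. \<chi> c = \<one>\<^bsub>D\<^esub>))" .
qed

end

section \<open>Commutator pairings and descent of cocycles along a central subgroup\<close>

lemma (in comm_group) inv_mult_cancel:
  assumes "a \<in> carrier G" "b \<in> carrier G" shows "inv (a \<otimes> b) \<otimes> b = inv a"
proof -
  have "inv (a \<otimes> b) \<otimes> b = inv a \<otimes> (inv b \<otimes> b)"
    unfolding inv_mult[OF assms] by (rule m_assoc) (simp_all add: assms)
  then show ?thesis using assms by simp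
qed

text \<open>\<open>f (a, b)\<close> divided by \<open>f (b, a)\<close> is the commutator of lifts of
  \<open>a\<close> and \<open>b\<close> to the central extension given by \<open>f\<close>. For
  commuting \<open>a\<close> and \<open>b\<close> it lies in the central copy of \<open>D\<close>,
  and such commutators are multiplicative. The second equation is the inverse of the first; it
  serves when the two factors exchange roles.\<close>

lemma (in cohomology) commutator_pairing_mult:
  assumes f: "f \<in> Z2" and c: "a \<in> carrier P" "a' \<in> carrier P" "b \<in> carrier P"
    and ab: "a \<otimes>\<^bsub>P\<^esub> b = b \<otimes>\<^bsub>P\<^esub> a" and a'b: "a' \<otimes>\<^bsub>P\<^esub> b = b \<otimes>\<^bsub>P\<^esub> a'"
  shows "f (a \<otimes>\<^bsub>P\<^esub> a', b) \<otimes>\<^bsub>D\<^esub> inv\<^bsub>D\<^esub> f (b, a \<otimes>\<^bsub>P\<^esub> a')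
       = (f (a, b) \<otimes>\<^bsub>D\<^esub> inv\<^bsub>D\<^esub> f (b, a)) \<otimes>\<^bsub>D\<^esub> (f (a', b) \<otimes>\<^bsub>D\<^esub> inv\<^bsub>D\<^esub> f (b, a'))" (is "?goal")
    and "f (b, a \<otimes>\<^bsub>P\<^esub> a') \<otimes>\<^bsub>D\<^esub> inv\<^bsub>D\<^esub> f (a \<otimes>\<^bsub>P\<^esub> a', b)
       = (f (b, a) \<otimes>\<^bsub>D\<^esub> inv\<^bsub>D\<^esub> f (a, b)) \<otimes>\<^bsub>D\<^esub> (f (b, a') \<otimes>\<^bsub>D\<^esub> inv\<^bsub>D\<^esub> f (a', b))" (is "?goal2")
proof -
  note cl = Z2_closed[OF f] c P.m_closed
  \<comment> \<open>With the factor \<open>?e\<close> the cocycle identity can be applied at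
    \<open>(a, a', b)\<close>, \<open>(a, b, a')\<close> and \<open>(b, a, a')\<close>; the factor
    cancels at the end.\<close>
  let ?e = "f (a, a') \<otimes>\<^bsub>D\<^esub> f (a, b \<otimes>\<^bsub>P\<^esub> a')"
  have "f (a \<otimes>\<^bsub>P\<^esub> a', b) \<otimes>\<^bsub>D\<^esub> (f (b, a) \<otimes>\<^bsub>D\<^esub> f (b, a')) \<otimes>\<^bsub>D\<^esub> ?e
      = (f (a \<otimes>\<^bsub>P\<^esub> a', b) \<otimes>\<^bsub>D\<^esub> f (a, a')) \<otimes>\<^bsub>D\<^esub> (f (b, a') \<otimes>\<^bsub>D\<^esub> f (a, b \<otimes>\<^bsub>P\<^esub> a')) \<otimes>\<^bsub>D\<^esub> f (b, a)"
    by (simp add: cl D.m_ac)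
  also have "\<dots> = (f (a', b) \<otimes>\<^bsub>D\<^esub> f (a, b \<otimes>\<^bsub>P\<^esub> a')) \<otimes>\<^bsub>D\<^esub> (f (b \<otimes>\<^bsub>P\<^esub> a, a') \<otimes>\<^bsub>D\<^esub> f (a, b)) \<otimes>\<^bsub>D\<^esub> f (b, a)"
    using Z2_cocycle[OF f c(1,2,3)] Z2_cocycle[OF f c(1,3,2)] by (simp only: ab a'b)
  also have "\<dots> = (f (a, b) \<otimes>\<^bsub>D\<^esub> f (a', b)) \<otimes>\<^bsub>D\<^esub> (f (b \<otimes>\<^bsub>P\<^esub> a, a') \<otimes>\<^bsub>D\<^esub> f (b, a)) \<otimes>\<^bsub>D\<^esub> f (a, b \<otimes>\<^bsub>P\<^esub> a')"
    by (simp add: cl D.m_ac)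
  also have "\<dots> = (f (a, b) \<otimes>\<^bsub>D\<^esub> f (a', b)) \<otimes>\<^bsub>D\<^esub> (f (a, a') \<otimes>\<^bsub>D\<^esub> f (b, a \<otimes>\<^bsub>P\<^esub> a')) \<otimes>\<^bsub>D\<^esub> f (a, b \<otimes>\<^bsub>P\<^esub> a')"
    using Z2_cocycle[OF f c(3,1,2)] by simp
  also have "\<dots> = (f (a, b) \<otimes>\<^bsub>D\<^esub> f (a', b)) \<otimes>\<^bsub>D\<^esub> f (b, a \<otimes>\<^bsub>P\<^esub> a') \<otimes>\<^bsub>D\<^esub> ?e"
    by (simp add: cl D.m_ac)
  finally have key: "f (a \<otimes>\<^bsub>P\<^esub> a', b) \<otimes>\<^bsub>D\<^esub> (f (b, a) \<otimes>\<^bsub>D\<^esub> f (b, a'))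
      = (f (a, b) \<otimes>\<^bsub>D\<^esub> f (a', b)) \<otimes>\<^bsub>D\<^esub> f (b, a \<otimes>\<^bsub>P\<^esub> a')"
    by (simp add: cl)
  have cross: "x \<otimes>\<^bsub>D\<^esub> inv\<^bsub>D\<^esub> y = z \<otimes>\<^bsub>D\<^esub> inv\<^bsub>D\<^esub> w" if "x \<otimes>\<^bsub>D\<^esub> w = z \<otimes>\<^bsub>D\<^esub> y"
    "x \<in> carrier D" "y \<in> carrier D" "z \<in> carrier D" "w \<in> carrier D" for x y z w
  proof -
    have "x \<otimes>\<^bsub>D\<^esub> inv\<^bsub>D\<^esub> y \<otimes>\<^bsub>D\<^esub> w = x \<otimes>\<^bsub>D\<^esub> w \<otimes>\<^bsub>D\<^esub> inv\<^bsub>D\<^esub> y" using that(2-) by (simp add: D.m_ac)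
    also have "\<dots> = z" unfolding that(1) using that(2-) by (simp add: D.m_assoc)
    finally show ?thesis using that(2-) by (simp add: D.div_eq_iff)
  qed
  show ?goal unfolding D.div_mult_div[OF cl(1)[OF c(1,3)] cl(1)[OF c(3,1)] cl(1)[OF c(2,3)] cl(1)[OF c(3,2)]]
    using key by (intro cross) (simp_all add: cl)
  show ?goal2 unfolding D.div_mult_div[OF cl(1)[OF c(3,1)] cl(1)[OF c(1,3)] cl(1)[OF c(3,2)] cl(1)[OF c(2,3)]]
    using key by (intro cross) (simp_all add: cl D.m_comm)
qed

text \<open>The restriction of the central extension defined by \<open>f\<close> to \<open>B\<close> is an abelian group
  containing \<open>D\<close>, so the identity of \<open>D\<close> extends to it.\<close>

lemma (in central_quotient) symmetric_cocycle_splits: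
  assumes div: "divisible_group D" and f: "f \<in> Z2"
    and sym: "\<And>a b. a \<in> B \<Longrightarrow> b \<in> B \<Longrightarrow> f (a, b) = f (b, a)"
  shows "\<exists>w\<in>B \<rightarrow> carrier D. \<forall>a\<in>B. \<forall>b\<in>B. f (a, b) \<otimes>\<^bsub>D\<^esub> w (a \<otimes>\<^bsub>P\<^esub> b) = w a \<otimes>\<^bsub>D\<^esub> w b"
proof -
  let ?c = "f (\<one>\<^bsub>P\<^esub>, \<one>\<^bsub>P\<^esub>)"
  \<comment> \<open>The extension restricted to \<open>B\<close>: pairs with multiplication twisted
    by \<open>f\<close>. The unit is shifted by \<open>?c\<close> because \<open>f\<close> is not
    normalized. Symmetry of \<open>f\<close> makes \<open>E\<close> commutative, so its derived
    subgroup causes no obstruction.\<close>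
  define E where "E = \<lparr>carrier = carrier D \<times> B,
     monoid.mult = (\<lambda>p q. (fst p \<otimes>\<^bsub>D\<^esub> fst q \<otimes>\<^bsub>D\<^esub> f (snd p, snd q), snd p \<otimes>\<^bsub>P\<^esub> snd q)),
     one = (inv\<^bsub>D\<^esub> ?c, \<one>\<^bsub>P\<^esub>)\<rparr>"
  have Ec: "carrier E = carrier D \<times> B" by (simp add: E_def)
  have Em: "(d, x) \<otimes>\<^bsub>E\<^esub> (e, y) = (d \<otimes>\<^bsub>D\<^esub> e \<otimes>\<^bsub>D\<^esub> f (x, y), x \<otimes>\<^bsub>P\<^esub> y)" for d x e y by (simp add: E_def)
  have E1: "\<one>\<^bsub>E\<^esub> = (inv\<^bsub>D\<^esub> ?c, \<one>\<^bsub>P\<^esub>)" by (simp add: E_def)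
  note cl = Z2_closed[OF f]
  have fl: "f (\<one>\<^bsub>P\<^esub>, x) = ?c" if "x \<in> B" for x using Z2_one_left[OF f B_mem[OF that]] .
  have "comm_group E"
  proof (rule comm_groupI)
    show "\<one>\<^bsub>E\<^esub> \<in> carrier E" using subgroup.one_closed[OF B] cl by (simp add: E1 Ec)
  next
    fix p q assume "p \<in> carrier E" "q \<in> carrier E"
    then obtain d x e y where p: "p = (d, x)" "d \<in> carrier D" "x \<in> B" "q = (e, y)" "e \<in> carrier D" "y \<in> B"
      by (auto simp: Ec)
    show "p \<otimes>\<^bsub>E\<^esub> q \<in> carrier E" using p cl subgroup.m_closed[OF B] by (simp add: Em Ec)
    show "p \<otimes>\<^bsub>E\<^esub> q = q \<otimes>\<^bsub>E\<^esub> p" using p sym[of x y] central[of x y] by (simp add: Em D.m_comm)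
    fix r assume "r \<in> carrier E"
    then obtain h z where r: "r = (h, z)" "h \<in> carrier D" "z \<in> B" by (auto simp: Ec)
    have "d \<otimes>\<^bsub>D\<^esub> e \<otimes>\<^bsub>D\<^esub> f (x, y) \<otimes>\<^bsub>D\<^esub> h \<otimes>\<^bsub>D\<^esub> f (x \<otimes>\<^bsub>P\<^esub> y, z)
        = (d \<otimes>\<^bsub>D\<^esub> e \<otimes>\<^bsub>D\<^esub> h) \<otimes>\<^bsub>D\<^esub> (f (x \<otimes>\<^bsub>P\<^esub> y, z) \<otimes>\<^bsub>D\<^esub> f (x, y))" using p r cl by (simp add: D.m_ac)
    also have "\<dots> = (d \<otimes>\<^bsub>D\<^esub> e \<otimes>\<^bsub>D\<^esub> h) \<otimes>\<^bsub>D\<^esub> (f (y, z) \<otimes>\<^bsub>D\<^esub> f (x, y \<otimes>\<^bsub>P\<^esub> z))"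
      using Z2_cocycle[OF f, of x y z] p r by simp
    also have "\<dots> = d \<otimes>\<^bsub>D\<^esub> (e \<otimes>\<^bsub>D\<^esub> h \<otimes>\<^bsub>D\<^esub> f (y, z)) \<otimes>\<^bsub>D\<^esub> f (x, y \<otimes>\<^bsub>P\<^esub> z)" using p r cl by (simp add: D.m_ac)
    finally show "p \<otimes>\<^bsub>E\<^esub> q \<otimes>\<^bsub>E\<^esub> r = p \<otimes>\<^bsub>E\<^esub> (q \<otimes>\<^bsub>E\<^esub> r)" using p r by (simp add: Em P.m_assoc)
  next
    fix p assume "p \<in> carrier E"
    then obtain d x where p: "p = (d, x)" "d \<in> carrier D" "x \<in> B" by (auto simp: Ec)
    show "\<one>\<^bsub>E\<^esub> \<otimes>\<^bsub>E\<^esub> p = p" using p cl fl[OF p(3)] by (simp add: Em E1 D.m_ac D.inv_cancel_left)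
    let ?x = "inv\<^bsub>P\<^esub> x"
    have x: "?x \<in> B" using subgroup.m_inv_closed[OF B p(3)] .
    let ?q = "(inv\<^bsub>D\<^esub> (?c \<otimes>\<^bsub>D\<^esub> (d \<otimes>\<^bsub>D\<^esub> f (?x, x))), ?x)"
    have "?q \<otimes>\<^bsub>E\<^esub> p = \<one>\<^bsub>E\<^esub>"
      using p x cl by (simp add: Em E1 D.m_assoc D.inv_mult_cancel)
    then show "\<exists>q\<in>carrier E. q \<otimes>\<^bsub>E\<^esub> p = \<one>\<^bsub>E\<^esub>" using p x cl by (intro bexI[of _ ?q]) (simp_all add: Ec)
  qed
  then interpret E: comm_group E .
  let ?S = "carrier D \<times> {\<one>\<^bsub>P\<^esub>}"
  have S: "subgroup ?S E"
  proof (rule E.subgroupI)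
    show "?S \<subseteq> carrier E" using subgroup.one_closed[OF B] by (auto simp: Ec)
    show "?S \<noteq> {}" by auto
    fix p assume "p \<in> ?S"
    then obtain d where d: "p = (d, \<one>\<^bsub>P\<^esub>)" "d \<in> carrier D" by auto
    have "inv\<^bsub>E\<^esub> p = (inv\<^bsub>D\<^esub> (?c \<otimes>\<^bsub>D\<^esub> (d \<otimes>\<^bsub>D\<^esub> ?c)), \<one>\<^bsub>P\<^esub>)"
      by (rule E.inv_equality) (use d cl subgroup.one_closed[OF B] in
        \<open>simp_all add: Ec Em E1 D.m_assoc D.inv_mult_cancel\<close>)
    then show "inv\<^bsub>E\<^esub> p \<in> ?S" using d cl by simp
    fix q assume "q \<in> ?S"
    then show "p \<otimes>\<^bsub>E\<^esub> q \<in> ?S" using d cl by (auto simp: Em)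
  qed
  \<comment> \<open>With this unit, \<open>D\<close> is embedded by sending \<open>d\<close> to
    \<open>(d / ?c, 1)\<close>; the map here is the inverse of that embedding.\<close>
  have h: "(\<lambda>p. fst p \<otimes>\<^bsub>D\<^esub> ?c) \<in> hom (E\<lparr>carrier := ?S\<rparr>) D"
    by (rule homI) (use cl in \<open>auto simp: Em D.m_ac\<close>)
  have "\<exists>\<psi>\<in>hom E D. \<forall>s\<in>?S. \<psi> s = fst s \<otimes>\<^bsub>D\<^esub> ?c"
  proof (rule divisible_extension[OF E.is_group D.comm_group_axioms div S h])
    fix s assume "s \<in> derived E (carrier E)"
    then have "s = (inv\<^bsub>D\<^esub> ?c, \<one>\<^bsub>P\<^esub>)" using E.derived_eq_singleton[of "carrier E"] E1 by simp
    then show "fst s \<otimes>\<^bsub>D\<^esub> ?c = \<one>\<^bsub>D\<^esub>" using cl by simp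
  qed
  then obtain \<psi> where \<psi>: "\<psi> \<in> hom E D" "\<And>d. d \<in> carrier D \<Longrightarrow> \<psi> (d, \<one>\<^bsub>P\<^esub>) = d \<otimes>\<^bsub>D\<^esub> ?c" by auto
  \<comment> \<open>The trivialization is the retraction \<open>\<psi>\<close> evaluated on the
    section \<open>a\<close> to \<open>(1, a)\<close>, whose failure to be multiplicative is
    measured by \<open>f\<close>.\<close>
  have "f (a, b) \<otimes>\<^bsub>D\<^esub> \<psi> (\<one>\<^bsub>D\<^esub>, a \<otimes>\<^bsub>P\<^esub> b) = \<psi> (\<one>\<^bsub>D\<^esub>, a) \<otimes>\<^bsub>D\<^esub> \<psi> (\<one>\<^bsub>D\<^esub>, b)" if ab: "a \<in> B" "b \<in> B" for a b
  proof -
    have abB: "a \<otimes>\<^bsub>P\<^esub> b \<in> B" using subgroup.m_closed[OF B ab] .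
    let ?s = "(f (a, b) \<otimes>\<^bsub>D\<^esub> inv\<^bsub>D\<^esub> ?c, \<one>\<^bsub>P\<^esub>)"
    have m: "(\<one>\<^bsub>D\<^esub>, a) \<otimes>\<^bsub>E\<^esub> (\<one>\<^bsub>D\<^esub>, b) = ?s \<otimes>\<^bsub>E\<^esub> (\<one>\<^bsub>D\<^esub>, a \<otimes>\<^bsub>P\<^esub> b)"
      using ab abB cl fl[OF abB] by (simp add: Em D.m_assoc)
    have "?s \<in> carrier E" "(\<one>\<^bsub>D\<^esub>, a) \<in> carrier E" "(\<one>\<^bsub>D\<^esub>, b) \<in> carrier E" "(\<one>\<^bsub>D\<^esub>, a \<otimes>\<^bsub>P\<^esub> b) \<in> carrier E"
      using ab abB cl subgroup.one_closed[OF B] by (simp_all add: Ec)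
    then have "\<psi> (\<one>\<^bsub>D\<^esub>, a) \<otimes>\<^bsub>D\<^esub> \<psi> (\<one>\<^bsub>D\<^esub>, b) = \<psi> ?s \<otimes>\<^bsub>D\<^esub> \<psi> (\<one>\<^bsub>D\<^esub>, a \<otimes>\<^bsub>P\<^esub> b)"
      by (simp only: hom_mult[OF \<psi>(1), symmetric] m)
    then show ?thesis using \<psi>(2) ab cl by (simp add: D.m_assoc)
  qed
  moreover have "\<psi> (\<one>\<^bsub>D\<^esub>, a) \<in> carrier D" if "a \<in> B" for a
    using hom_in_carrier[OF \<psi>(1)] that by (simp add: Ec)
  ultimately show ?thesis
    by (intro bexI[of _ "\<lambda>a. \<psi> (\<one>\<^bsub>D\<^esub>, a)"] ballI Pi_I)
qed

text \<open>In the extension of \<open>P\<close> given by \<open>f\<close>, symmetry makes the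
  preimage of \<open>B\<close> central, and divisibility splits it. Lifts of elements of
  \<open>P\<close> that are compatible with multiplication by the lifted \<open>B\<close> yield a
  cocycle that does not see \<open>B\<close>. The first change of cocycle makes it trivial on
  \<open>B x B\<close>, the second adjusts the lifts.\<close>

lemma (in central_quotient) invariant_representative:
  assumes div: "divisible_group D" and f0: "f \<in> Z2"
    and sym0: "\<And>x b. x \<in> carrier P \<Longrightarrow> b \<in> B \<Longrightarrow> f (x, b) = f (b, x)"
  shows "\<exists>F\<in>Z2. H2_class P D F = H2_class P D f \<and>
    (\<forall>x\<in>carrier P. \<forall>y\<in>carrier P. \<forall>b\<in>B. F (x \<otimes>\<^bsub>P\<^esub> b, y) = F (x, y) \<and> F (x, y \<otimes>\<^bsub>P\<^esub> b) = F (x, y))"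
proof -
  let ?\<delta> = "\<lambda>u. \<lambda>p\<in>carrier P \<times> carrier P. u (fst p) \<otimes>\<^bsub>D\<^esub> u (snd p) \<otimes>\<^bsub>D\<^esub> inv\<^bsub>D\<^esub> (u (fst p \<otimes>\<^bsub>P\<^esub> snd p))"
  let ?C = "cocycle_group P D"
  obtain w where w: "w \<in> B \<rightarrow> carrier D" "\<And>a b. a \<in> B \<Longrightarrow> b \<in> B \<Longrightarrow> f (a, b) \<otimes>\<^bsub>D\<^esub> w (a \<otimes>\<^bsub>P\<^esub> b) = w a \<otimes>\<^bsub>D\<^esub> w b"
    using symmetric_cocycle_splits[OF div f0 sym0[OF B_mem]] by blast
  \<comment> \<open>Only the coboundary of \<open>w'\<close> on \<open>B x B\<close> matters; the
    value \<open>1\<close> off \<open>B\<close> is a default.\<close>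
  define w' where "w' x = (if x \<in> B then w x else \<one>\<^bsub>D\<^esub>)" for x
  have w'c: "w' \<in> carrier P \<rightarrow> carrier D" using w(1) by (auto simp: w'_def)
  then have w'x: "\<And>x. x \<in> carrier P \<Longrightarrow> w' x \<in> carrier D" by auto
  note dw = coboundary_in_Z2[OF w'c]
  define g where "g = f \<otimes>\<^bsub>?C\<^esub> inv\<^bsub>?C\<^esub> ?\<delta> w'"
  have g: "g \<in> Z2" unfolding g_def using f0 dw(1) by simp
  note gc = Z2_closed[OF g]
  have gx: "g (x, y) = f (x, y) \<otimes>\<^bsub>D\<^esub> inv\<^bsub>D\<^esub> (?\<delta> w' (x, y))" if "x \<in> carrier P" "y \<in> carrier P" for x y
    unfolding g_def using div_cocycle_group[OF f0 dw(1) that] .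
  have gB: "g (a, b) = \<one>\<^bsub>D\<^esub>" if ab: "a \<in> B" "b \<in> B" for a b
  proof -
    have abB: "a \<otimes>\<^bsub>P\<^esub> b \<in> B" using subgroup.m_closed[OF B ab] .
    have "f (a, b) = w a \<otimes>\<^bsub>D\<^esub> w b \<otimes>\<^bsub>D\<^esub> inv\<^bsub>D\<^esub> w (a \<otimes>\<^bsub>P\<^esub> b)"
      using w(2)[OF ab] Z2_closed[OF f0, of a b] ab abB w(1) by (subst D.div_eq_iff) auto
    then show ?thesis using ab abB w(1) by (simp add: gx w'_def Pi_iff)
  qed
  have sym: "g (x, b) = g (b, x)" if xb: "x \<in> carrier P" "b \<in> B" for x b
    using xb sym0[OF xb] central[OF xb] w'x by (simp add: gx D.m_comm)
  \<comment> \<open>For \<open>x = s b\<close> with section representative \<open>s\<close>, this is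
    \<open>g (s, b)\<close>, the factor by which the product of the lifts of \<open>s\<close> and
    \<open>b\<close> differs from the lift of \<open>x\<close>.\<close>
  define u where "u x = g (sec (B #>\<^bsub>P\<^esub> x), inv\<^bsub>P\<^esub> sec (B #>\<^bsub>P\<^esub> x) \<otimes>\<^bsub>P\<^esub> x)" for x
  have uc: "u x \<in> carrier D" if "x \<in> carrier P" for x
    unfolding u_def using gc sec(1)[OF that] that by simp
  have ub: "u (x \<otimes>\<^bsub>P\<^esub> b) = u x \<otimes>\<^bsub>D\<^esub> g (x, b)" if xb: "x \<in> carrier P" "b \<in> B" for x b
  proof -
    let ?s = "sec (B #>\<^bsub>P\<^esub> x)"
    obtain a where a: "a \<in> B" "x = ?s \<otimes>\<^bsub>P\<^esub> a" using sec(3)[OF xb(1)] by blast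
    have s: "?s \<in> carrier P" using sec(1)[OF xb(1)] .
    have ia: "inv\<^bsub>P\<^esub> ?s \<otimes>\<^bsub>P\<^esub> x = a"
      using P.inv_cancel_left(1)[OF s B_mem[OF a(1)]] unfolding a(2)[symmetric] .
    then have iab: "inv\<^bsub>P\<^esub> ?s \<otimes>\<^bsub>P\<^esub> (x \<otimes>\<^bsub>P\<^esub> b) = a \<otimes>\<^bsub>P\<^esub> b"
      using s xb by (simp add: P.m_assoc[symmetric])
    have "u (x \<otimes>\<^bsub>P\<^esub> b) = g (?s, a \<otimes>\<^bsub>P\<^esub> b)" by (simp only: u_def proj_central[OF xb] iab)
    also have "\<dots> = g (a, b) \<otimes>\<^bsub>D\<^esub> g (?s, a \<otimes>\<^bsub>P\<^esub> b)" using gB[OF a(1) xb(2)] gc s a(1) xb by simp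
    also have "\<dots> = g (?s \<otimes>\<^bsub>P\<^esub> a, b) \<otimes>\<^bsub>D\<^esub> g (?s, a)" using Z2_cocycle[OF g s B_mem[OF a(1)] B_mem[OF xb(2)]] .
    also have "\<dots> = g (x, b) \<otimes>\<^bsub>D\<^esub> u x"
      by (simp only: u_def ia a(2)[symmetric])
    finally show ?thesis using gc xb uc by (simp add: D.m_comm)
  qed
  have uc': "u \<in> carrier P \<rightarrow> carrier D" using uc by auto
  note du = coboundary_in_Z2[OF uc']
  define F where "F = g \<otimes>\<^bsub>?C\<^esub> ?\<delta> u"
  have F: "F \<in> Z2" unfolding F_def using g du(1) by simp
  have Fx: "F (x, y) = (g (x, y) \<otimes>\<^bsub>D\<^esub> (u x \<otimes>\<^bsub>D\<^esub> u y)) \<otimes>\<^bsub>D\<^esub> inv\<^bsub>D\<^esub> (u (x \<otimes>\<^bsub>P\<^esub> y))"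
    if "x \<in> carrier P" "y \<in> carrier P" for x y
    unfolding F_def using that gc uc by (simp add: mult_cocycle_group D.m_assoc)
  have cancel: "a \<otimes>\<^bsub>D\<^esub> inv\<^bsub>D\<^esub> (b \<otimes>\<^bsub>D\<^esub> e) = c \<otimes>\<^bsub>D\<^esub> inv\<^bsub>D\<^esub> b" if "a = c \<otimes>\<^bsub>D\<^esub> e"
    "b \<in> carrier D" "c \<in> carrier D" "e \<in> carrier D" for a b c e
    unfolding that(1) using that(2-) D.div_mult_div[of c b e e] by simp
  have inv: "F (x \<otimes>\<^bsub>P\<^esub> b, y) = F (x, y) \<and> F (x, y \<otimes>\<^bsub>P\<^esub> b) = F (x, y)"
    if c: "x \<in> carrier P" "y \<in> carrier P" "b \<in> B" for x y b
  proof
    note cc = c B_mem[OF c(3)] gc uc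
    have co: "g (x \<otimes>\<^bsub>P\<^esub> y, b) \<otimes>\<^bsub>D\<^esub> g (x, y) = g (y, b) \<otimes>\<^bsub>D\<^esub> g (x, y \<otimes>\<^bsub>P\<^esub> b)"
      using Z2_cocycle[OF g c(1,2) B_mem[OF c(3)]] by simp
    \<comment> \<open>Invariance in the first variable leads to the triple \<open>(x, b, y)\<close>;
      symmetry and centrality of \<open>b\<close> reduce it to the triple
      \<open>(x, y, b)\<close>.\<close>
    have co': "g (x \<otimes>\<^bsub>P\<^esub> b, y) \<otimes>\<^bsub>D\<^esub> g (x, b) = g (x \<otimes>\<^bsub>P\<^esub> y, b) \<otimes>\<^bsub>D\<^esub> g (x, y)"
      using Z2_cocycle[OF g c(1) B_mem[OF c(3)] c(2)] co sym[OF c(2,3)] central[OF c(2,3)] by simp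
    have xby: "x \<otimes>\<^bsub>P\<^esub> b \<otimes>\<^bsub>P\<^esub> y = x \<otimes>\<^bsub>P\<^esub> y \<otimes>\<^bsub>P\<^esub> b" using c central[OF c(2,3)] by (simp add: P.m_assoc)
    have "g (x \<otimes>\<^bsub>P\<^esub> b, y) \<otimes>\<^bsub>D\<^esub> (u x \<otimes>\<^bsub>D\<^esub> g (x, b) \<otimes>\<^bsub>D\<^esub> u y)
       = (g (x \<otimes>\<^bsub>P\<^esub> b, y) \<otimes>\<^bsub>D\<^esub> g (x, b)) \<otimes>\<^bsub>D\<^esub> (u x \<otimes>\<^bsub>D\<^esub> u y)" by (simp add: cc D.m_ac)
    also have "\<dots> = (g (x, y) \<otimes>\<^bsub>D\<^esub> (u x \<otimes>\<^bsub>D\<^esub> u y)) \<otimes>\<^bsub>D\<^esub> g (x \<otimes>\<^bsub>P\<^esub> y, b)" unfolding co' by (simp add: cc D.m_ac)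
    finally have 1: "g (x \<otimes>\<^bsub>P\<^esub> b, y) \<otimes>\<^bsub>D\<^esub> (u (x \<otimes>\<^bsub>P\<^esub> b) \<otimes>\<^bsub>D\<^esub> u y) = (g (x, y) \<otimes>\<^bsub>D\<^esub> (u x \<otimes>\<^bsub>D\<^esub> u y)) \<otimes>\<^bsub>D\<^esub> g (x \<otimes>\<^bsub>P\<^esub> y, b)"
      unfolding ub[OF c(1,3)] .
    show "F (x \<otimes>\<^bsub>P\<^esub> b, y) = F (x, y)"
      unfolding Fx[OF P.m_closed[OF c(1) B_mem[OF c(3)]] c(2)] Fx[OF c(1,2)] xby ub[OF P.m_closed[OF c(1,2)] c(3)]
      by (rule cancel[OF 1]) (simp_all add: cc)
    have "g (x, y \<otimes>\<^bsub>P\<^esub> b) \<otimes>\<^bsub>D\<^esub> (u x \<otimes>\<^bsub>D\<^esub> (u y \<otimes>\<^bsub>D\<^esub> g (y, b)))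
       = (g (y, b) \<otimes>\<^bsub>D\<^esub> g (x, y \<otimes>\<^bsub>P\<^esub> b)) \<otimes>\<^bsub>D\<^esub> (u x \<otimes>\<^bsub>D\<^esub> u y)" by (simp add: cc D.m_ac)
    also have "\<dots> = (g (x, y) \<otimes>\<^bsub>D\<^esub> (u x \<otimes>\<^bsub>D\<^esub> u y)) \<otimes>\<^bsub>D\<^esub> g (x \<otimes>\<^bsub>P\<^esub> y, b)" unfolding co[symmetric] by (simp add: cc D.m_ac)
    finally have 2: "g (x, y \<otimes>\<^bsub>P\<^esub> b) \<otimes>\<^bsub>D\<^esub> (u x \<otimes>\<^bsub>D\<^esub> u (y \<otimes>\<^bsub>P\<^esub> b)) = (g (x, y) \<otimes>\<^bsub>D\<^esub> (u x \<otimes>\<^bsub>D\<^esub> u y)) \<otimes>\<^bsub>D\<^esub> g (x \<otimes>\<^bsub>P\<^esub> y, b)"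
      unfolding ub[OF c(2,3)] .
    have xyb: "x \<otimes>\<^bsub>P\<^esub> (y \<otimes>\<^bsub>P\<^esub> b) = x \<otimes>\<^bsub>P\<^esub> y \<otimes>\<^bsub>P\<^esub> b" by (simp add: cc P.m_assoc)
    show "F (x, y \<otimes>\<^bsub>P\<^esub> b) = F (x, y)"
      unfolding Fx[OF c(1) P.m_closed[OF c(2) B_mem[OF c(3)]]] Fx[OF c(1,2)] xyb ub[OF P.m_closed[OF c(1,2)] c(3)]
      by (rule cancel[OF 2]) (simp_all add: cc)
  qed
  have "H2_class P D F = H2_class P D f"
  proof -
    have "H2_class P D (?\<delta> w') = \<one>\<^bsub>H2 P D\<^esub>" "H2_class P D (?\<delta> u) = \<one>\<^bsub>H2 P D\<^esub>"
      using H2_class_one_iff dw du by blast+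
    moreover have "H2_class P D g = H2_class P D f \<otimes>\<^bsub>H2 P D\<^esub> inv\<^bsub>H2 P D\<^esub> H2_class P D (?\<delta> w')"
      unfolding g_def using H2_class_div[OF f0 dw(1)] by simp
    moreover have "H2_class P D F = H2_class P D g \<otimes>\<^bsub>H2 P D\<^esub> H2_class P D (?\<delta> u)"
      unfolding F_def using H2_class_mult[OF g du(1)] by simp
    ultimately show ?thesis using H2_class_carrier[OF f0] by simp
  qed
  then show ?thesis using F inv by blast
qed

section \<open>The kernel of inflation\<close>

lemma (in group) subgroup_by_div:
  assumes "S \<subseteq> carrier G" "S \<noteq> {}" and div: "\<And>x y. x \<in> S \<Longrightarrow> y \<in> S \<Longrightarrow> x \<otimes> inv y \<in> S"
  shows "subgroup S G"
proof -
  have one: "\<one> \<in> S" using assms div by (metis all_not_in_conv r_inv subsetD)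
  have inv: "inv x \<in> S" if "x \<in> S" for x using div[OF one that] assms(1) that by auto
  have "x \<otimes> y \<in> S" if "x \<in> S" "y \<in> S" for x y
    using div[OF that(1) inv[OF that(2)]] assms(1) that by auto
  then show ?thesis using assms(1,2) inv by (intro subgroupI) auto
qed

lemma DirProd_comm_group:
  assumes "comm_group G" "comm_group H" shows "comm_group (G \<times>\<times> H)"
proof -
  interpret G: comm_group G by fact
  interpret H: comm_group H by fact
  interpret group "G \<times>\<times> H" by (rule DirProd_group[OF G.is_group H.is_group])
  show ?thesis by (rule group_comm_groupI) (auto simp: G.m_comm H.m_comm)
qed

context central_quotient
begin

text \<open>\<open>B\<close> is abelian, so its derived subgroup is trivial and nothing obstructs
  the extension.\<close>

lemma extend_to_B:
  assumes div: "divisible_group D" and S: "subgroup S P" "S \<subseteq> B" and \<chi>: "\<chi> \<in> hom (P\<lparr>carrier := S\<rparr>) D"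
  shows "\<exists>\<psi>\<in>hom (P\<lparr>carrier := B\<rparr>) D. \<forall>s\<in>S. \<psi> s = \<chi> s"
proof -
  let ?B = "P\<lparr>carrier := B\<rparr>"
  interpret Bg: comm_group ?B
    by (rule group.group_comm_groupI[OF B_group]) (simp add: central)
  have SB: "subgroup S ?B" using P.subgroup_incl[OF S(1) B S(2)] .
  show ?thesis
  proof (rule divisible_extension[OF Bg.is_group D.comm_group_axioms div SB])
    show \<chi>': "\<chi> \<in> hom (?B\<lparr>carrier := S\<rparr>) D" using \<chi> by simp
    fix s assume "s \<in> derived ?B (carrier ?B)"
    then have "s = \<one>\<^bsub>?B\<lparr>carrier := S\<rparr>\<^esub>" using Bg.derived_eq_singleton[of "carrier ?B"] by simp
    then show "\<chi> s = \<one>\<^bsub>D\<^esub>"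
      using hom_one[OF \<chi>' Bg.subgroup_imp_group[OF SB] D.is_group] by simp
  qed
qed

text \<open>The pullback of a function on \<open>P/B\<close> is constant on cosets of
  \<open>B\<close>. So changing a cocycle by a coboundary alters the trivialization, but not its
  character.\<close>

lemma transgresses_cls_cong:
  assumes "f \<in> Q.Z2" "g \<in> Q.Z2" "H2_class (P Mod B) D f = H2_class (P Mod B) D g"
    and t: "transgresses P B D g \<chi> u" and \<chi>: "\<chi> \<in> hom (P\<lparr>carrier := B\<rparr>) D"
  shows "\<exists>u'. transgresses P B D f \<chi> u'"
proof -
  let ?C = "cocycle_group (P Mod B) D"
  let ?e = "f \<otimes>\<^bsub>?C\<^esub> inv\<^bsub>?C\<^esub> g"
  have e: "?e \<in> Q.Z2" using assms by simp
  obtain v where v: "cobounds (P Mod B) D ?e v" using assms(3) Q.H2_class_eq_iff[OF assms(1,2)] by blast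
  have vc: "v (B #>\<^bsub>P\<^esub> x) \<in> carrier D" if "x \<in> carrier P" for x using Q.cobounds_closed[OF v] that by simp
  have te: "transgresses P B D ?e (\<lambda>_. \<one>\<^bsub>D\<^esub>) (\<lambda>x. v (B #>\<^bsub>P\<^esub> x))"
    unfolding transgresses_def using pullback_cob[OF proj_hom v] vc by (simp add: proj_central)
  have one: "(\<lambda>_. \<one>\<^bsub>D\<^esub>) \<in> hom (P\<lparr>carrier := B\<rparr>) D" by (simp add: hom_def)
  have "?e \<otimes>\<^bsub>?C\<^esub> g = f" using assms by (simp add: Q.C.m_assoc)
  then have "transgresses P B D f (\<lambda>b. \<one>\<^bsub>D\<^esub> \<otimes>\<^bsub>D\<^esub> \<chi> b) (\<lambda>x. v (B #>\<^bsub>P\<^esub> x) \<otimes>\<^bsub>D\<^esub> u x)"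
    using transgresses_mult[OF e assms(2) te t one \<chi>] by simp
  then show ?thesis using transgresses_cong[of f "\<lambda>b. \<one>\<^bsub>D\<^esub> \<otimes>\<^bsub>D\<^esub> \<chi> b" _ \<chi>] hom_B_closed[OF \<chi>] by auto
qed

end

text \<open>Serves both factors, with \<open>B = A\<close> and \<open>C = Z\<close>. The inclusion
  of \<open>C\<close> in the derived subgroup makes the restriction to \<open>C\<close> of a
  transgressed character depend on the cocycle alone.\<close>

locale infl_kernel = central_quotient P D B
  for P :: "('x, 'm) monoid_scheme" and D :: "('d, 'n) monoid_scheme" and B +
  fixes C :: "'x set" and q :: "'x set \<Rightarrow> 'x set"
  assumes C: "subgroup C P" and C_B: "C \<subseteq> B" and C_derived: "C \<subseteq> derived P (carrier P)"
    and q: "\<And>x. x \<in> carrier P \<Longrightarrow> q (C #>\<^bsub>P\<^esub> x) = B #>\<^bsub>P\<^esub> x"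
    and divisible: "divisible_group D"
begin

definition L where "L = kernel (H2 (P Mod B) D) (H2 (P Mod C) D) (infl (P Mod C) (P Mod B) D q)"

sublocale Cq: central_quotient P D C
  by (intro central_quotient.intro cohomology_axioms central_quotient_axioms.intro C)
    (use C_B central in auto)

sublocale Ln: normal L "H2 (P Mod B) D"
proof -
  interpret i: group_hom "H2 (P Mod B) D" "H2 (P Mod C) D" "infl (P Mod C) (P Mod B) D q"
    by (rule Cq.Q.infl_hom[OF Q.P.is_group infl_trivial_iff(2)[OF C C_B q Q.Z2_one]])
  show "L \<lhd> H2 (P Mod B) D" unfolding L_def by (rule i.normal_kernel)
qed

lemma H2_class_in_L_iff:
  assumes "f \<in> Q.Z2"
  shows "H2_class (P Mod B) D f \<in> L \<longleftrightarrow>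
    (\<exists>\<chi>\<in>hom (P\<lparr>carrier := B\<rparr>) D. \<exists>u. transgresses P B D f \<chi> u \<and> (\<forall>c\<in>C. \<chi> c = \<one>\<^bsub>D\<^esub>))"
  unfolding L_def kernel_def using infl_trivial_iff(1)[OF C C_B q assms] Q.H2_class_carrier[OF assms] by simp

text \<open>Membership in \<open>L\<close> asks for one suitable character. Two characters
  transgressed by the same \<open>f\<close> have a quotient transgressed by the trivial cocycle, so
  they agree on \<open>B \<inter> P'\<close> and in particular on \<open>C\<close>. Hence any
  character at hand decides.\<close>

lemma transgresses_in_L_iff:
  assumes f: "f \<in> Q.Z2" and t: "transgresses P B D f \<chi> u" and \<chi>: "\<chi> \<in> hom (P\<lparr>carrier := B\<rparr>) D"
  shows "H2_class (P Mod B) D f \<in> L \<longleftrightarrow> (\<forall>c\<in>C. \<chi> c = \<one>\<^bsub>D\<^esub>)"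
proof
  assume "H2_class (P Mod B) D f \<in> L"
  then obtain \<eta> v where e: "\<eta> \<in> hom (P\<lparr>carrier := B\<rparr>) D" "transgresses P B D f \<eta> v" "\<And>c. c \<in> C \<Longrightarrow> \<eta> c = \<one>\<^bsub>D\<^esub>"
    using H2_class_in_L_iff[OF f] by blast
  let ?C = "cocycle_group (P Mod B) D"
  have t': "transgresses P B D (f \<otimes>\<^bsub>?C\<^esub> inv\<^bsub>?C\<^esub> f) (\<lambda>b. \<chi> b \<otimes>\<^bsub>D\<^esub> inv\<^bsub>D\<^esub> \<eta> b) (\<lambda>x. u x \<otimes>\<^bsub>D\<^esub> inv\<^bsub>D\<^esub> v x)"
    by (rule transgresses_div[OF f f t e(2) \<chi> e(1)])
  have "\<exists>v. cobounds (P Mod B) D (f \<otimes>\<^bsub>?C\<^esub> inv\<^bsub>?C\<^esub> f) v" using f Q.cobounds_one by auto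
  then have "\<forall>b\<in>B \<inter> derived P (carrier P). \<chi> b \<otimes>\<^bsub>D\<^esub> inv\<^bsub>D\<^esub> \<eta> b = \<one>\<^bsub>D\<^esub>"
    using transgresses_coboundary_iff[OF divisible _ t' hom_div_closed[OF B_group D.comm_group_axioms \<chi> e(1)]] f by simp
  then show "\<forall>c\<in>C. \<chi> c = \<one>\<^bsub>D\<^esub>" using C_B C_derived e(3) hom_B_closed[OF \<chi>] by force
next
  assume "\<forall>c\<in>C. \<chi> c = \<one>\<^bsub>D\<^esub>"
  then show "H2_class (P Mod B) D f \<in> L" using H2_class_in_L_iff[OF f] t \<chi> by blast
qed

text \<open>The quotient of \<open>f\<close> and \<open>g\<close> has its class in \<open>L\<close>,
  so it transgresses some \<open>\<eta>\<close> trivial on \<open>C\<close>; multiply with the data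
  for \<open>g\<close>. Equality modulo \<open>L\<close> thus preserves a transgressed character
  only along \<open>C\<close>.\<close>

lemma L_coset_eq:
  assumes f: "f \<in> Q.Z2" and g: "g \<in> Q.Z2"
    and eq: "L #>\<^bsub>H2 (P Mod B) D\<^esub> H2_class (P Mod B) D f = L #>\<^bsub>H2 (P Mod B) D\<^esub> H2_class (P Mod B) D g"
    and t: "transgresses P B D g \<chi> u" and \<chi>: "\<chi> \<in> hom (P\<lparr>carrier := B\<rparr>) D"
  shows "\<exists>\<eta>\<in>hom (P\<lparr>carrier := B\<rparr>) D. \<exists>v. transgresses P B D f (\<lambda>b. \<eta> b \<otimes>\<^bsub>D\<^esub> \<chi> b) v \<and> (\<forall>c\<in>C. \<eta> c = \<one>\<^bsub>D\<^esub>)"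
proof -
  let ?C = "cocycle_group (P Mod B) D"
  let ?e = "f \<otimes>\<^bsub>?C\<^esub> inv\<^bsub>?C\<^esub> g"
  have e: "?e \<in> Q.Z2" using f g by simp
  note c = Q.H2_class_carrier[OF f] Q.H2_class_carrier[OF g]
  interpret LM: group "H2 (P Mod B) D Mod L" by (rule Ln.factorgroup_is_group)
  have "L #>\<^bsub>H2 (P Mod B) D\<^esub> H2_class (P Mod B) D ?e = L"
    using Ln.rcos_div[OF c] Q.H2_class_div[OF f g] eq LM.r_inv[of "L #>\<^bsub>H2 (P Mod B) D\<^esub> H2_class (P Mod B) D g"] c(2)
    by (simp add: carrier_FactGroup del: mult_FactGroup)
  then have "H2_class (P Mod B) D ?e \<in> L" using Ln.rcos_eq_self_iff[OF Q.H2_class_carrier[OF e]] by simp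
  then obtain \<eta> v where v: "\<eta> \<in> hom (P\<lparr>carrier := B\<rparr>) D" "transgresses P B D ?e \<eta> v" "\<forall>c\<in>C. \<eta> c = \<one>\<^bsub>D\<^esub>"
    using H2_class_in_L_iff[OF e] by blast
  have "?e \<otimes>\<^bsub>?C\<^esub> g = f" using f g by (simp add: Q.C.m_assoc)
  then have "transgresses P B D f (\<lambda>b. \<eta> b \<otimes>\<^bsub>D\<^esub> \<chi> b) (\<lambda>x. v x \<otimes>\<^bsub>D\<^esub> u x)"
    using transgresses_mult[OF e g v(2) t v(1) \<chi>] by simp
  then show ?thesis using v by blast
qed

text \<open>A class in \<open>L\<close> comes from a character of \<open>B\<close> and determines
  that character exactly on \<open>B \<inter> P'\<close>. Since the character is trivial on
  \<open>C\<close>, what remains is a character of \<open>(B \<inter> P')/C\<close>, and each of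
  these occurs because it extends to \<open>B\<close>.\<close>

lemma L_iso:
  "(H2 (P Mod B) D)\<lparr>carrier := L\<rparr> \<cong> hom_group (P\<lparr>carrier := B \<inter> derived P (carrier P)\<rparr> Mod C) D"
proof -
  let ?P' = "derived P (carrier P)"
  let ?S = "P\<lparr>carrier := B \<inter> ?P'\<rparr>"
  let ?H = "H2 (P Mod B) D"
  let ?C = "cocycle_group (P Mod B) D"
  have S: "subgroup (B \<inter> ?P') P"
    using P.subgroups_Inter_pair[OF B P.derived_is_subgroup[of "carrier P"]] by simp
  interpret S: group ?S by (rule P.subgroup_imp_group[OF S])
  interpret Scq: central_quotient ?S D C
    by (intro central_quotient.intro cohomology.intro S.is_group D.comm_group_axioms central_quotient_axioms.intro)
      (use P.subgroup_incl[OF C S] C_B C_derived central in auto)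
  let ?W = "hom_group (?S Mod C) D"
  interpret W: comm_group ?W by (rule comm_group_hom_group[OF Scq.Q.P.is_group D.comm_group_axioms])
  interpret HL: group "?H\<lparr>carrier := L\<rparr>" by (rule Q.H.subgroup_imp_group[OF Ln.is_subgroup])
  \<comment> \<open>\<open>c\<close> is related to \<open>\<theta>\<close> if some character
    transgressing to \<open>c\<close> restricts to the pullback of \<open>\<theta>\<close>. Neither
    the cocycle nor the character on all of \<open>B\<close> is fixed.\<close>
  define R where "R c \<theta> \<longleftrightarrow> c \<in> L \<and> \<theta> \<in> carrier ?W \<and> (\<exists>f\<in>Q.Z2. \<exists>\<chi>\<in>hom (P\<lparr>carrier := B\<rparr>) D. \<exists>u.
     c = H2_class (P Mod B) D f \<and> transgresses P B D f \<chi> u \<and> (\<forall>b\<in>B \<inter> ?P'. \<theta> (C #>\<^bsub>P\<^esub> b) = \<chi> b))" for c \<theta>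
  show ?thesis
  proof (rule iso_by_relation[of _ _ R])
    show "group (?H\<lparr>carrier := L\<rparr>)" by (rule HL.is_group)
    show "group ?W" by (rule W.is_group)
  next
    fix c assume "c \<in> carrier (?H\<lparr>carrier := L\<rparr>)"
    then have c: "c \<in> L" by simp
    then obtain f where f: "f \<in> Q.Z2" "c = H2_class (P Mod B) D f"
      using Ln.mem_carrier[OF c] by (elim Q.H2_cases)
    then obtain \<chi> u where \<chi>: "\<chi> \<in> hom (P\<lparr>carrier := B\<rparr>) D" "transgresses P B D f \<chi> u" "\<And>c. c \<in> C \<Longrightarrow> \<chi> c = \<one>\<^bsub>D\<^esub>"
      using c H2_class_in_L_iff[OF f(1)] by blast
    have h: "\<chi> \<in> hom ?S D" using \<chi>(1) by (auto simp: hom_def)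
    have "\<exists>g\<in>hom (?S Mod C) D. \<forall>x\<in>carrier ?S. g (C #>\<^bsub>?S\<^esub> x) = \<chi> x"
    proof (rule FactGroup_universal[OF h Scq.Bn.normal_axioms])
      fix x y assume xy: "x \<in> carrier ?S" "y \<in> carrier ?S" "C #>\<^bsub>?S\<^esub> x = C #>\<^bsub>?S\<^esub> y"
      have "x \<in> C #>\<^bsub>?S\<^esub> y" using S.rcos_self[OF xy(1) Scq.B] xy(3) by simp
      then obtain c where c: "c \<in> C" "x = c \<otimes>\<^bsub>P\<^esub> y" unfolding r_coset_def by auto
      then show "\<chi> x = \<chi> y"
        using hom_mult[OF \<chi>(1), of c y] \<chi>(3) C_B xy hom_B_closed[OF \<chi>(1)] by auto
    qed blast
    then obtain g where g: "g \<in> hom (?S Mod C) D" "\<And>x. x \<in> B \<inter> ?P' \<Longrightarrow> g (C #>\<^bsub>P\<^esub> x) = \<chi> x" by auto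
    have "R c (restrict g (carrier (?S Mod C)))"
      unfolding R_def using c f \<chi> g restrict_in_hom_group[OF Scq.Q.P.is_group D.comm_group_axioms g(1)]
      by (auto simp: carrier_FactGroup)
    then show "\<exists>\<theta>. R c \<theta>" by blast
  next
    fix c \<theta> assume "R c \<theta>"
    then show "c \<in> carrier (?H\<lparr>carrier := L\<rparr>) \<and> \<theta> \<in> carrier ?W" by (simp add: R_def)
  next
    fix c \<theta> c' \<theta>' assume r: "R c \<theta>" "R c' \<theta>'"
    obtain f \<chi> u where f: "f \<in> Q.Z2" "\<chi> \<in> hom (P\<lparr>carrier := B\<rparr>) D" "c = H2_class (P Mod B) D f"
      "transgresses P B D f \<chi> u" "\<And>b. b \<in> B \<inter> ?P' \<Longrightarrow> \<theta> (C #>\<^bsub>P\<^esub> b) = \<chi> b" using r(1) unfolding R_def by blast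
    obtain f' \<chi>' u' where f': "f' \<in> Q.Z2" "\<chi>' \<in> hom (P\<lparr>carrier := B\<rparr>) D" "c' = H2_class (P Mod B) D f'"
      "transgresses P B D f' \<chi>' u'" "\<And>b. b \<in> B \<inter> ?P' \<Longrightarrow> \<theta>' (C #>\<^bsub>P\<^esub> b) = \<chi>' b" using r(2) unfolding R_def by blast
    have cc: "c \<in> L" "c' \<in> L" "\<theta> \<in> carrier ?W" "\<theta>' \<in> carrier ?W" using r by (simp_all add: R_def)
    have m: "c \<otimes>\<^bsub>?H\<lparr>carrier := L\<rparr>\<^esub> inv\<^bsub>?H\<lparr>carrier := L\<rparr>\<^esub> c' = c \<otimes>\<^bsub>?H\<^esub> inv\<^bsub>?H\<^esub> c'"
      using Q.H.m_inv_consistent[OF Ln.is_subgroup cc(2)] by simp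
    have in_L: "c \<otimes>\<^bsub>?H\<^esub> inv\<^bsub>?H\<^esub> c' \<in> L" using cc by simp
    have "C #>\<^bsub>P\<^esub> b \<in> carrier (?S Mod C)" if "b \<in> B \<inter> ?P'" for b
      using that by (auto simp: carrier_FactGroup)
    then have val: "(\<theta> \<otimes>\<^bsub>?W\<^esub> inv\<^bsub>?W\<^esub> \<theta>') (C #>\<^bsub>P\<^esub> b) = \<chi> b \<otimes>\<^bsub>D\<^esub> inv\<^bsub>D\<^esub> \<chi>' b" if "b \<in> B \<inter> ?P'" for b
      using that f(5) f'(5) hom_group_div_apply[OF Scq.Q.P.is_group D.comm_group_axioms cc(3,4)] by simp
    show "R (c \<otimes>\<^bsub>?H\<lparr>carrier := L\<rparr>\<^esub> inv\<^bsub>?H\<lparr>carrier := L\<rparr>\<^esub> c') (\<theta> \<otimes>\<^bsub>?W\<^esub> inv\<^bsub>?W\<^esub> \<theta>')"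
      unfolding m R_def
    proof (intro conjI in_L)
      show "\<theta> \<otimes>\<^bsub>?W\<^esub> inv\<^bsub>?W\<^esub> \<theta>' \<in> carrier ?W" using cc by simp
      show "\<exists>f\<in>Q.Z2. \<exists>\<chi>\<in>hom (P\<lparr>carrier := B\<rparr>) D. \<exists>u. c \<otimes>\<^bsub>?H\<^esub> inv\<^bsub>?H\<^esub> c' = H2_class (P Mod B) D f \<and> transgresses P B D f \<chi> u \<and>
          (\<forall>b\<in>B \<inter> ?P'. (\<theta> \<otimes>\<^bsub>?W\<^esub> inv\<^bsub>?W\<^esub> \<theta>') (C #>\<^bsub>P\<^esub> b) = \<chi> b)"
        using transgresses_div[OF f(1) f'(1) f(4) f'(4) f(2) f'(2)] val f f' Q.H2_class_div[OF f(1) f'(1)]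
          hom_div_closed[OF B_group D.comm_group_axioms f(2) f'(2)]
        by (intro bexI[of _ "f \<otimes>\<^bsub>?C\<^esub> inv\<^bsub>?C\<^esub> f'"] bexI[of _ "\<lambda>b. \<chi> b \<otimes>\<^bsub>D\<^esub> inv\<^bsub>D\<^esub> \<chi>' b"] exI[of _ "\<lambda>x. u x \<otimes>\<^bsub>D\<^esub> inv\<^bsub>D\<^esub> u' x"] conjI) auto
    qed
  next
    fix c \<theta> assume r: "R c \<theta>"
    then obtain f \<chi> u where f: "f \<in> Q.Z2" "\<chi> \<in> hom (P\<lparr>carrier := B\<rparr>) D" "c = H2_class (P Mod B) D f"
      "transgresses P B D f \<chi> u" "\<And>b. b \<in> B \<inter> ?P' \<Longrightarrow> \<theta> (C #>\<^bsub>P\<^esub> b) = \<chi> b" unfolding R_def by blast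
    have \<theta>: "\<theta> \<in> carrier ?W" using r by (simp add: R_def)
    have "c = \<one>\<^bsub>?H\<^esub> \<longleftrightarrow> (\<forall>b\<in>B \<inter> ?P'. \<chi> b = \<one>\<^bsub>D\<^esub>)"
      unfolding f(3) Q.H2_class_one_iff[OF f(1)] by (rule transgresses_coboundary_iff[OF divisible f(1,4,2)])
    also have "\<dots> \<longleftrightarrow> (\<forall>y\<in>carrier (?S Mod C). \<theta> y = \<one>\<^bsub>D\<^esub>)"
      using f(5) by (auto simp: carrier_FactGroup)
    also have "\<dots> \<longleftrightarrow> \<theta> = \<one>\<^bsub>?W\<^esub>"
      using hom_group_one_iff[OF Scq.Q.P.is_group D.comm_group_axioms \<theta>] by simp
    finally show "c = \<one>\<^bsub>?H\<lparr>carrier := L\<rparr>\<^esub> \<longleftrightarrow> \<theta> = \<one>\<^bsub>?W\<^esub>" by simp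
  next
    fix \<theta> assume \<theta>: "\<theta> \<in> carrier ?W"
    then have \<theta>h: "\<theta> \<in> hom (?S Mod C) D" by (simp add: hom_group_carrier_iff)
    have "(\<theta> \<circ> (\<lambda>b. C #>\<^bsub>?S\<^esub> b)) \<in> hom ?S D" using hom_compose[OF Scq.proj_hom \<theta>h] .
    then have h: "(\<lambda>b. \<theta> (C #>\<^bsub>P\<^esub> b)) \<in> hom ?S D" by (simp add: comp_def)
    obtain \<chi> where \<chi>: "\<chi> \<in> hom (P\<lparr>carrier := B\<rparr>) D" "\<And>b. b \<in> B \<inter> ?P' \<Longrightarrow> \<chi> b = \<theta> (C #>\<^bsub>P\<^esub> b)"
      using extend_to_B[OF divisible S _ h] by blast
    obtain f u where f: "f \<in> Q.Z2" "transgresses P B D f \<chi> u" using transgresses_exists[OF \<chi>(1)] by blast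
    \<comment> \<open>\<open>C\<close> lies in \<open>B \<inter> P'\<close>, where
      \<open>\<chi>\<close> is prescribed by \<open>\<theta>\<close>. So every extension to
      \<open>B\<close> is trivial on \<open>C\<close> and its transgression lands in
      \<open>L\<close>.\<close>
    have "\<theta> C = \<one>\<^bsub>D\<^esub>" using hom_one[OF \<theta>h Scq.Q.P.is_group D.is_group] by simp
    then have "\<chi> c = \<one>\<^bsub>D\<^esub>" if "c \<in> C" for c
      using \<chi>(2)[of c] that C_B C_derived Cq.Bn.rcos_eq_self_iff[of c] by auto
    then have "H2_class (P Mod B) D f \<in> L" using H2_class_in_L_iff[OF f(1)] f(2) \<chi>(1) by blast
    then have "R (H2_class (P Mod B) D f) \<theta>" unfolding R_def using \<theta> f \<chi>
      by (intro conjI bexI[OF _ f(1)] bexI[OF _ \<chi>(1)] exI[of _ u]) auto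
    then show "\<exists>c. R c \<theta>" by blast
  qed
qed

end

section \<open>Central products\<close>

locale central_product = G: group G + D: comm_group D
  for G :: "('g, 'm) monoid_scheme" and D :: "('d, 'n) monoid_scheme" +
  fixes H K :: "'g set"
  assumes H: "H \<lhd> G" and K: "K \<lhd> G" and HK: "H <#>\<^bsub>G\<^esub> K = carrier G"
    and commute: "\<And>h k. h \<in> H \<Longrightarrow> k \<in> K \<Longrightarrow> h \<otimes>\<^bsub>G\<^esub> k = k \<otimes>\<^bsub>G\<^esub> h"
    and divisible: "divisible_group D"
begin

abbreviation "A \<equiv> H \<inter> K"
abbreviation "Z \<equiv> derived G H \<inter> derived G K"
abbreviation "GH \<equiv> G\<lparr>carrier := H\<rparr>"
abbreviation "GK \<equiv> G\<lparr>carrier := K\<rparr>"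

sublocale H: normal H G by (rule H)
sublocale K: normal K G by (rule K)

sublocale GG: cohomology G D by unfold_locales

lemma HK_mult: "h \<in> H \<Longrightarrow> k \<in> K \<Longrightarrow> h' \<in> H \<Longrightarrow> k' \<in> K \<Longrightarrow>
    (h \<otimes>\<^bsub>G\<^esub> k) \<otimes>\<^bsub>G\<^esub> (h' \<otimes>\<^bsub>G\<^esub> k') = (h \<otimes>\<^bsub>G\<^esub> h') \<otimes>\<^bsub>G\<^esub> (k \<otimes>\<^bsub>G\<^esub> k')"
proof -
  assume c: "h \<in> H" "k \<in> K" "h' \<in> H" "k' \<in> K"
  note cc = H.mem_carrier[OF c(1)] K.mem_carrier[OF c(2)] H.mem_carrier[OF c(3)] K.mem_carrier[OF c(4)]
  have "(h \<otimes>\<^bsub>G\<^esub> k) \<otimes>\<^bsub>G\<^esub> (h' \<otimes>\<^bsub>G\<^esub> k') = h \<otimes>\<^bsub>G\<^esub> ((k \<otimes>\<^bsub>G\<^esub> h') \<otimes>\<^bsub>G\<^esub> k')" by (simp add: cc G.m_assoc)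
  also have "\<dots> = h \<otimes>\<^bsub>G\<^esub> ((h' \<otimes>\<^bsub>G\<^esub> k) \<otimes>\<^bsub>G\<^esub> k')" using commute[OF c(3,2)] by simp
  also have "\<dots> = (h \<otimes>\<^bsub>G\<^esub> h') \<otimes>\<^bsub>G\<^esub> (k \<otimes>\<^bsub>G\<^esub> k')" by (simp add: cc G.m_assoc)
  finally show ?thesis .
qed

lemma HK_cases: assumes "x \<in> carrier G" obtains h k where "h \<in> H" "k \<in> K" "x = h \<otimes>\<^bsub>G\<^esub> k"
  using assms HK unfolding set_mult_def by blast

lemma HK_closed: "h \<in> H \<Longrightarrow> k \<in> K \<Longrightarrow> h \<otimes>\<^bsub>G\<^esub> k \<in> carrier G"
  using H.mem_carrier K.mem_carrier by blast

lemma A_subgroup: "subgroup A G"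
  by (rule G.subgroups_Inter_pair[OF H.is_subgroup K.is_subgroup])

lemma Z_subgroup: "subgroup Z G"
  by (rule G.subgroups_Inter_pair[OF G.derived_is_subgroup[OF H.subset] G.derived_is_subgroup[OF K.subset]])

lemma Z_A: "Z \<subseteq> A"
  using G.derived_incl[OF order_refl H.is_subgroup] G.derived_incl[OF order_refl K.is_subgroup] by blast

lemma A_central: "x \<in> carrier G \<Longrightarrow> a \<in> A \<Longrightarrow> x \<otimes>\<^bsub>G\<^esub> a = a \<otimes>\<^bsub>G\<^esub> x"
proof -
  assume x: "x \<in> carrier G" and a: "a \<in> A"
  obtain h k where hk: "h \<in> H" "k \<in> K" "x = h \<otimes>\<^bsub>G\<^esub> k" using HK_cases[OF x] .
  note cc = H.mem_carrier[OF hk(1)] K.mem_carrier[OF hk(2)] subgroup.mem_carrier[OF A_subgroup a]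
  have "x \<otimes>\<^bsub>G\<^esub> a = h \<otimes>\<^bsub>G\<^esub> (a \<otimes>\<^bsub>G\<^esub> k)" using commute[of a k] hk a by (simp add: cc G.m_assoc)
  also have "\<dots> = (a \<otimes>\<^bsub>G\<^esub> h) \<otimes>\<^bsub>G\<^esub> k" using commute[of h a] hk a by (simp add: cc G.m_assoc[symmetric])
  also have "\<dots> = a \<otimes>\<^bsub>G\<^esub> x" using hk by (simp add: cc G.m_assoc)
  finally show ?thesis .
qed

text \<open>Two factorizations \<open>h k = h' k'\<close> differ by
  \<open>a = h^-1 h' = k k'^-1\<close> in \<open>A\<close>, so the assumption says that
  \<open>W\<close> is constant on the fibres of the map from \<open>H x K\<close> onto
  \<open>G\<close>. The projections and trivializations on \<open>G\<close> below are obtained in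
  this way.\<close>

lemma glue:
  assumes W: "\<And>h k a. h \<in> H \<Longrightarrow> k \<in> K \<Longrightarrow> a \<in> A \<Longrightarrow> W (h \<otimes>\<^bsub>G\<^esub> a) k = W h (a \<otimes>\<^bsub>G\<^esub> k)"
  shows "\<exists>w. \<forall>h\<in>H. \<forall>k\<in>K. w (h \<otimes>\<^bsub>G\<^esub> k) = W h k"
proof -
  have uniq: "W h' k' = W h k" if c: "h \<in> H" "k \<in> K" "h' \<in> H" "k' \<in> K" and eq: "h \<otimes>\<^bsub>G\<^esub> k = h' \<otimes>\<^bsub>G\<^esub> k'" for h k h' k'
  proof -
    note cc = H.mem_carrier[OF c(1)] K.mem_carrier[OF c(2)] H.mem_carrier[OF c(3)] K.mem_carrier[OF c(4)]
    let ?a = "inv\<^bsub>G\<^esub> h \<otimes>\<^bsub>G\<^esub> h'"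
    have "?a \<otimes>\<^bsub>G\<^esub> k' = inv\<^bsub>G\<^esub> h \<otimes>\<^bsub>G\<^esub> (h \<otimes>\<^bsub>G\<^esub> k)" unfolding eq by (simp add: cc G.m_assoc)
    also have "\<dots> = k" by (simp add: cc G.inv_cancel_left)
    finally have k: "?a \<otimes>\<^bsub>G\<^esub> k' = k" .
    then have "?a = k \<otimes>\<^bsub>G\<^esub> inv\<^bsub>G\<^esub> k'" using cc by (simp add: G.div_eq_iff)
    then have "?a \<in> K" using c by simp
    moreover have "?a \<in> H" using c by simp
    ultimately have "?a \<in> A" by blast
    then show ?thesis using W[OF c(1,4), of ?a] k by (simp add: cc G.inv_cancel_left)
  qed
  have ex: "\<exists>p. fst p \<in> H \<and> snd p \<in> K \<and> x = fst p \<otimes>\<^bsub>G\<^esub> snd p" if x: "x \<in> carrier G" for x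
  proof -
    obtain h k where "h \<in> H" "k \<in> K" "x = h \<otimes>\<^bsub>G\<^esub> k" using HK_cases[OF x] .
    then show ?thesis by (intro exI[of _ "(h, k)"]) simp
  qed
  define p where "p x = (SOME p. fst p \<in> H \<and> snd p \<in> K \<and> x = fst p \<otimes>\<^bsub>G\<^esub> snd p)" for x
  have p: "fst (p x) \<in> H \<and> snd (p x) \<in> K \<and> x = fst (p x) \<otimes>\<^bsub>G\<^esub> snd (p x)" if "x \<in> carrier G" for x
    unfolding p_def by (rule someI_ex[OF ex[OF that]])
  have "W (fst (p (h \<otimes>\<^bsub>G\<^esub> k))) (snd (p (h \<otimes>\<^bsub>G\<^esub> k))) = W h k" if "h \<in> H" "k \<in> K" for h k
    using uniq[OF that] p[OF HK_closed[OF that]] by blast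
  then show ?thesis by (intro exI[of _ "\<lambda>x. W (fst (p x)) (snd (p x))"]) blast
qed

sublocale GHg: group GH by (rule G.subgroup_imp_group[OF H.is_subgroup])
sublocale GKg: group GK by (rule G.subgroup_imp_group[OF K.is_subgroup])
sublocale GHc: cohomology GH D by unfold_locales
sublocale GKc: cohomology GK D by unfold_locales

lemma derived_GH: "derived GH (carrier GH) = derived G H" and derived_GK: "derived GK (carrier GK) = derived G K"
  using G.derived_consistent H.is_subgroup K.is_subgroup by auto

sublocale HA: infl_kernel GH D A Z "quot_map G H Z A"
proof (intro infl_kernel.intro central_quotient.intro central_quotient_axioms.intro infl_kernel_axioms.intro GHc.cohomology_axioms)
  show "subgroup A GH" by (rule G.subgroup_incl[OF A_subgroup H.is_subgroup]) simp
  show "x \<otimes>\<^bsub>GH\<^esub> b = b \<otimes>\<^bsub>GH\<^esub> x" if "x \<in> carrier GH" "b \<in> A" for x b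
    using that A_central H.mem_carrier by simp
  show "subgroup Z GH" using G.subgroup_incl[OF Z_subgroup H.is_subgroup] Z_A by blast
  show "Z \<subseteq> A" by (rule Z_A)
  show "Z \<subseteq> derived GH (carrier GH)" unfolding derived_GH by blast
  show "divisible_group D" by (rule divisible)
  show "quot_map G H Z A (Z #>\<^bsub>GH\<^esub> x) = A #>\<^bsub>GH\<^esub> x" if x: "x \<in> carrier GH" for x
  proof -
    \<comment> \<open>\<open>quot_map\<close> multiplies a coset of \<open>Z\<close> by
      \<open>A\<close>, and \<open>A Z = A\<close> because \<open>Z\<close> is contained in
      \<open>A\<close>.\<close>
    have "A <#>\<^bsub>G\<^esub> (Z #>\<^bsub>G\<^esub> x) = (A <#>\<^bsub>G\<^esub> Z) #>\<^bsub>G\<^esub> x"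
      using G.setmult_rcos_assoc[of A Z x] x H.mem_carrier subgroup.subset[OF A_subgroup] subgroup.subset[OF Z_subgroup] by simp
    also have "A <#>\<^bsub>G\<^esub> Z = A"
      using G.set_mult_subgroup_idem[OF A_subgroup] G.subgroup_incl[OF Z_subgroup A_subgroup Z_A] by blast
    finally show ?thesis using x unfolding quot_map_def by (auto simp: carrier_FactGroup)
  qed
qed

sublocale KA: infl_kernel GK D A Z "quot_map G K Z A"
proof (intro infl_kernel.intro central_quotient.intro central_quotient_axioms.intro infl_kernel_axioms.intro GKc.cohomology_axioms)
  show "subgroup A GK" by (rule G.subgroup_incl[OF A_subgroup K.is_subgroup]) simp
  show "x \<otimes>\<^bsub>GK\<^esub> b = b \<otimes>\<^bsub>GK\<^esub> x" if "x \<in> carrier GK" "b \<in> A" for x b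
    using that A_central K.mem_carrier by simp
  show "subgroup Z GK" using G.subgroup_incl[OF Z_subgroup K.is_subgroup] Z_A by blast
  show "Z \<subseteq> A" by (rule Z_A)
  show "Z \<subseteq> derived GK (carrier GK)" unfolding derived_GK by blast
  show "divisible_group D" by (rule divisible)
  show "quot_map G K Z A (Z #>\<^bsub>GK\<^esub> x) = A #>\<^bsub>GK\<^esub> x" if x: "x \<in> carrier GK" for x
  proof -
    have "A <#>\<^bsub>G\<^esub> (Z #>\<^bsub>G\<^esub> x) = (A <#>\<^bsub>G\<^esub> Z) #>\<^bsub>G\<^esub> x"
      using G.setmult_rcos_assoc[of A Z x] x K.mem_carrier subgroup.subset[OF A_subgroup] subgroup.subset[OF Z_subgroup] by simp
    also have "A <#>\<^bsub>G\<^esub> Z = A"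
      using G.set_mult_subgroup_idem[OF A_subgroup] G.subgroup_incl[OF Z_subgroup A_subgroup Z_A] by blast
    finally show ?thesis using x unfolding quot_map_def by (auto simp: carrier_FactGroup)
  qed
qed

sublocale GZ: central_quotient G D Z
  by (intro central_quotient.intro central_quotient_axioms.intro GG.cohomology_axioms Z_subgroup)
    (use A_central Z_A in blast)

text \<open>Extend the character \<open>(a, a) \<mapsto> \<psi> a\<close> of the diagonal copy of \<open>A\<close> to \<open>H \<times> K\<close>.\<close>

lemma split_character:
  assumes \<psi>: "\<psi> \<in> hom (G\<lparr>carrier := A\<rparr>) D" and triv: "\<And>z. z \<in> Z \<Longrightarrow> \<psi> z = \<one>\<^bsub>D\<^esub>"
  shows "\<exists>\<psi>1\<in>hom GH D. \<exists>\<psi>2\<in>hom GK D. \<forall>a\<in>A. \<psi> a = \<psi>1 a \<otimes>\<^bsub>D\<^esub> \<psi>2 a"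
proof -
  let ?X = "GH \<times>\<times> GK"
  interpret X: group ?X by (rule DirProd_group[OF GHg.is_group GKg.is_group])
  let ?S = "(\<lambda>a. (a, a)) ` A"
  have S: "subgroup ?S ?X"
  proof (rule X.subgroupI)
    show "?S \<subseteq> carrier ?X" by auto
    show "?S \<noteq> {}" using subgroup.one_closed[OF A_subgroup] by blast
    fix p assume "p \<in> ?S"
    then obtain a where a: "a \<in> A" "p = (a, a)" by blast
    then have "inv\<^bsub>?X\<^esub> p = (inv\<^bsub>G\<^esub> a, inv\<^bsub>G\<^esub> a)"
      using inv_DirProd[OF GHg.is_group GKg.is_group, of a a]
        G.m_inv_consistent[OF H.is_subgroup, of a] G.m_inv_consistent[OF K.is_subgroup, of a] by simp
    then show "inv\<^bsub>?X\<^esub> p \<in> ?S" using subgroup.m_inv_closed[OF A_subgroup a(1)] by blast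
    fix q assume "q \<in> ?S"
    then obtain b where b: "b \<in> A" "q = (b, b)" by blast
    then show "p \<otimes>\<^bsub>?X\<^esub> q \<in> ?S" using a subgroup.m_closed[OF A_subgroup a(1) b(1)] by simp
  qed
  \<comment> \<open>An element \<open>(a, a)\<close> of this derived subgroup has \<open>a\<close>
    in both \<open>H'\<close> and \<open>K'\<close>, so the obstruction to extending from the
    diagonal sits on \<open>Z\<close>.\<close>
  have der: "derived ?X (carrier ?X) \<subseteq> derived G H \<times> derived G K"
    unfolding derived_def[of ?X]
  proof (rule X.generate_subgroup_incl)
    show "subgroup (derived G H \<times> derived G K) ?X"
      using DirProd_subgroups[OF GHg.is_group GHg.derived_is_subgroup[OF order_refl]
        GKg.is_group GKg.derived_is_subgroup[OF order_refl]]
      unfolding derived_GH derived_GK .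
    show "derived_set ?X (carrier ?X) \<subseteq> derived G H \<times> derived G K"
    proof
      fix t assume "t \<in> derived_set ?X (carrier ?X)"
      then obtain p q where "p \<in> carrier ?X" "q \<in> carrier ?X"
        and t: "t = p \<otimes>\<^bsub>?X\<^esub> q \<otimes>\<^bsub>?X\<^esub> inv\<^bsub>?X\<^esub> p \<otimes>\<^bsub>?X\<^esub> inv\<^bsub>?X\<^esub> q" by blast
      then obtain a b c d where ab: "p = (a, b)" "a \<in> carrier GH" "b \<in> carrier GK"
        and cd: "q = (c, d)" "c \<in> carrier GH" "d \<in> carrier GK" unfolding carrier_DirProd by blast
      have "t = (a \<otimes>\<^bsub>GH\<^esub> c \<otimes>\<^bsub>GH\<^esub> inv\<^bsub>GH\<^esub> a \<otimes>\<^bsub>GH\<^esub> inv\<^bsub>GH\<^esub> c, b \<otimes>\<^bsub>GK\<^esub> d \<otimes>\<^bsub>GK\<^esub> inv\<^bsub>GK\<^esub> b \<otimes>\<^bsub>GK\<^esub> inv\<^bsub>GK\<^esub> d)"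
        unfolding t ab(1) cd(1) inv_DirProd[OF GHg.is_group GKg.is_group ab(2,3)]
          inv_DirProd[OF GHg.is_group GKg.is_group cd(2,3)] mult_DirProd ..
      then show "t \<in> derived G H \<times> derived G K"
        using GHg.commutator_in_derived[OF ab(2) cd(2)] GKg.commutator_in_derived[OF ab(3) cd(3)]
        unfolding derived_GH derived_GK by blast
    qed
  qed
  have h: "(\<lambda>p. \<psi> (fst p)) \<in> hom (?X\<lparr>carrier := ?S\<rparr>) D"
  proof (rule homI)
    fix p q assume "p \<in> carrier (?X\<lparr>carrier := ?S\<rparr>)" "q \<in> carrier (?X\<lparr>carrier := ?S\<rparr>)"
    then obtain a b where ab: "a \<in> A" "p = (a, a)" "b \<in> A" "q = (b, b)" by auto
    show "\<psi> (fst p) \<in> carrier D" using ab hom_in_carrier[OF \<psi>] by simp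
    show "\<psi> (fst (p \<otimes>\<^bsub>?X\<lparr>carrier := ?S\<rparr>\<^esub> q)) = \<psi> (fst p) \<otimes>\<^bsub>D\<^esub> \<psi> (fst q)"
      using ab hom_mult[OF \<psi>, of a b] by simp
  qed
  have "\<exists>\<Psi>\<in>hom ?X D. \<forall>s\<in>?S. \<Psi> s = \<psi> (fst s)"
  proof (rule divisible_extension[OF X.is_group D.comm_group_axioms divisible S h])
    fix s assume "s \<in> ?S" "s \<in> derived ?X (carrier ?X)"
    then have "fst s \<in> Z" using der by force
    then show "\<psi> (fst s) = \<one>\<^bsub>D\<^esub>" by (rule triv)
  qed
  then obtain \<Psi> where \<Psi>: "\<Psi> \<in> hom ?X D" "\<And>a. a \<in> A \<Longrightarrow> \<Psi> (a, a) = \<psi> a" by auto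
  have one: "\<one>\<^bsub>G\<^esub> \<in> H" "\<one>\<^bsub>G\<^esub> \<in> K" by auto
  have 1: "(\<lambda>h. \<Psi> (h, \<one>\<^bsub>G\<^esub>)) \<in> hom GH D"
  proof (rule homI)
    fix x y assume "x \<in> carrier GH" "y \<in> carrier GH"
    then show "\<Psi> (x \<otimes>\<^bsub>GH\<^esub> y, \<one>\<^bsub>G\<^esub>) = \<Psi> (x, \<one>\<^bsub>G\<^esub>) \<otimes>\<^bsub>D\<^esub> \<Psi> (y, \<one>\<^bsub>G\<^esub>)"
      using hom_mult[OF \<Psi>(1), of "(x, \<one>\<^bsub>G\<^esub>)" "(y, \<one>\<^bsub>G\<^esub>)"] one by simp
  qed (use hom_in_carrier[OF \<Psi>(1)] one in simp)
  have 2: "(\<lambda>k. \<Psi> (\<one>\<^bsub>G\<^esub>, k)) \<in> hom GK D"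
  proof (rule homI)
    fix x y assume "x \<in> carrier GK" "y \<in> carrier GK"
    then show "\<Psi> (\<one>\<^bsub>G\<^esub>, x \<otimes>\<^bsub>GK\<^esub> y) = \<Psi> (\<one>\<^bsub>G\<^esub>, x) \<otimes>\<^bsub>D\<^esub> \<Psi> (\<one>\<^bsub>G\<^esub>, y)"
      using hom_mult[OF \<Psi>(1), of "(\<one>\<^bsub>G\<^esub>, x)" "(\<one>\<^bsub>G\<^esub>, y)"] one by simp
  qed (use hom_in_carrier[OF \<Psi>(1)] one in simp)
  have "\<psi> a = \<Psi> (a, \<one>\<^bsub>G\<^esub>) \<otimes>\<^bsub>D\<^esub> \<Psi> (\<one>\<^bsub>G\<^esub>, a)" if a: "a \<in> A" for a
    using hom_mult[OF \<Psi>(1), of "(a, \<one>\<^bsub>G\<^esub>)" "(\<one>\<^bsub>G\<^esub>, a)"] \<Psi>(2)[OF a] a one H.mem_carrier by simp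
  then show ?thesis by (intro bexI[OF _ 1] bexI[OF _ 2] ballI)
qed


lemma GHA: "GH\<lparr>carrier := A\<rparr> = G\<lparr>carrier := A\<rparr>" and GKA: "GK\<lparr>carrier := A\<rparr> = G\<lparr>carrier := A\<rparr>"
  by simp_all

abbreviation "homA \<equiv> hom (G\<lparr>carrier := A\<rparr>) D"

lemma A_group: "group (G\<lparr>carrier := A\<rparr>)" by (rule G.subgroup_imp_group[OF A_subgroup])

lemma homA_closed: "\<chi> \<in> homA \<Longrightarrow> a \<in> A \<Longrightarrow> \<chi> a \<in> carrier D"
  by (auto simp: hom_def)

lemma homA_restrict_Z:
  assumes "\<chi> \<in> homA" shows "\<chi> \<in> hom (G\<lparr>carrier := Z\<rparr>) D"
proof (rule homI)
  fix x y assume "x \<in> carrier (G\<lparr>carrier := Z\<rparr>)" "y \<in> carrier (G\<lparr>carrier := Z\<rparr>)"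
  then have xy: "x \<in> A" "y \<in> A" using Z_A by auto
  show "\<chi> x \<in> carrier D" using homA_closed[OF assms xy(1)] .
  show "\<chi> (x \<otimes>\<^bsub>G\<lparr>carrier := Z\<rparr>\<^esub> y) = \<chi> x \<otimes>\<^bsub>D\<^esub> \<chi> y" using hom_mult[OF assms, of x y] xy by simp
qed

lemmas H_transgresses_div = HA.transgresses_div[unfolded GHA] and K_transgresses_div = KA.transgresses_div[unfolded GKA]
lemmas H_transgresses_twist = HA.transgresses_twist[unfolded GHA] and K_transgresses_twist = KA.transgresses_twist[unfolded GKA]
lemmas H_transgressesD = HA.transgressesD(1-3)[simplified] and K_transgressesD = KA.transgressesD(1-3)[simplified]

text \<open>The quotient of \<open>\<chi>\<close> and \<open>\<eta>\<close> is trivial on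
  \<open>Z\<close>, so it is \<open>\<psi>1 \<psi>2\<close> on \<open>A\<close>. Characters of
  \<open>H\<close> and \<open>K\<close> can be absorbed into the trivializations without touching
  \<open>f\<close> and \<open>g\<close>, and then
  \<open>\<xi> = \<chi> / \<psi>1 = \<eta> \<psi>2\<close> is common to both sides.\<close>

lemma match_characters:
  assumes f: "f \<in> HA.Q.Z2" "transgresses GH A D f \<chi> u" and g: "g \<in> KA.Q.Z2" "transgresses GK A D g \<eta> v"
    and \<chi>: "\<chi> \<in> homA" and \<eta>: "\<eta> \<in> homA" and eq: "\<And>z. z \<in> Z \<Longrightarrow> \<chi> z = \<eta> z"
  shows "\<exists>\<xi>\<in>homA. \<exists>u v. transgresses GH A D f \<xi> u \<and> transgresses GK A D g \<xi> v"
proof -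
  have Zc: "\<eta> z \<in> carrier D" if "z \<in> Z" for z using homA_closed[OF \<eta>] Z_A that by blast
  obtain \<psi>1 \<psi>2 where \<psi>: "\<psi>1 \<in> hom GH D" "\<psi>2 \<in> hom GK D"
    "\<And>a. a \<in> A \<Longrightarrow> \<chi> a \<otimes>\<^bsub>D\<^esub> inv\<^bsub>D\<^esub> \<eta> a = \<psi>1 a \<otimes>\<^bsub>D\<^esub> \<psi>2 a"
    using split_character[OF hom_div_closed[OF A_group D.comm_group_axioms \<chi> \<eta>]] eq Zc by auto
  have i1: "(\<lambda>x. inv\<^bsub>D\<^esub> \<psi>1 x) \<in> hom GH D" by (rule hom_inv_closed[OF GHg.is_group D.comm_group_axioms \<psi>(1)])
  have t1: "transgresses GH A D f (\<lambda>a. \<chi> a \<otimes>\<^bsub>D\<^esub> inv\<^bsub>D\<^esub> \<psi>1 a) (\<lambda>x. u x \<otimes>\<^bsub>D\<^esub> inv\<^bsub>D\<^esub> \<psi>1 x)"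
    by (rule H_transgresses_twist[OF f(2,1) \<chi> i1])
  have t2: "transgresses GK A D g (\<lambda>a. \<eta> a \<otimes>\<^bsub>D\<^esub> \<psi>2 a) (\<lambda>x. v x \<otimes>\<^bsub>D\<^esub> \<psi>2 x)"
    by (rule K_transgresses_twist[OF g(2,1) \<eta> \<psi>(2)])
  have "\<psi>1 \<in> homA" using \<psi>(1) by (auto simp: hom_def)
  then have \<xi>: "(\<lambda>a. \<chi> a \<otimes>\<^bsub>D\<^esub> inv\<^bsub>D\<^esub> \<psi>1 a) \<in> homA"
    by (rule hom_div_closed[OF A_group D.comm_group_axioms \<chi>])
  have "\<eta> a \<otimes>\<^bsub>D\<^esub> \<psi>2 a = \<chi> a \<otimes>\<^bsub>D\<^esub> inv\<^bsub>D\<^esub> \<psi>1 a" if a: "a \<in> A" for a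
  proof -
    have c: "\<chi> a \<in> carrier D" "\<eta> a \<in> carrier D" "\<psi>1 a \<in> carrier D" "\<psi>2 a \<in> carrier D"
      using a homA_closed \<chi> \<eta> hom_in_carrier[OF \<psi>(1), of a] hom_in_carrier[OF \<psi>(2), of a] by auto
    have "(\<psi>1 a \<otimes>\<^bsub>D\<^esub> \<psi>2 a) \<otimes>\<^bsub>D\<^esub> \<eta> a = \<chi> a"
      using \<psi>(3)[OF a] c D.div_eq_iff[of "\<psi>1 a \<otimes>\<^bsub>D\<^esub> \<psi>2 a" "\<chi> a" "\<eta> a"] by simp
    then show ?thesis using c by (subst D.div_eq_iff) (simp_all add: D.m_ac)
  qed
  then have t2': "transgresses GK A D g (\<lambda>a. \<chi> a \<otimes>\<^bsub>D\<^esub> inv\<^bsub>D\<^esub> \<psi>1 a) (\<lambda>x. v x \<otimes>\<^bsub>D\<^esub> \<psi>2 x)"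
    by (rule KA.transgresses_cong[OF t2])
  show ?thesis using t1 t2' by (intro bexI[OF _ \<xi>] exI conjI)
qed

section \<open>Pairs of transgressions of a common character of \<open>A\<close>\<close>

abbreviation "QH \<equiv> GH Mod A"
abbreviation "QK \<equiv> GK Mod A"
abbreviation "S \<equiv> (H2 QH D Mod HA.L) \<times>\<times> (H2 QK D Mod KA.L)"

definition class_pair where
  "class_pair f g = (HA.L #>\<^bsub>H2 QH D\<^esub> H2_class QH D f, KA.L #>\<^bsub>H2 QK D\<^esub> H2_class QK D g)"

text \<open>The same \<open>\<chi>\<close> on both sides gives
  \<open>u (h a) v k = u h v (a k)\<close>, which is the condition for trivializations over
  \<open>H\<close> and \<open>K\<close> to glue to a function on \<open>G\<close>.\<close>

definition transgresses_A where
  "transgresses_A f g \<chi> \<longleftrightarrow> f \<in> HA.Q.Z2 \<and> g \<in> KA.Q.Z2 \<and> \<chi> \<in> homA \<and> (\<exists>u. transgresses GH A D f \<chi> u) \<and> (\<exists>v. transgresses GK A D g \<chi> v)"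

definition N where "N = {class_pair f g | f g. \<exists>\<chi>. transgresses_A f g \<chi>}"

interpretation SH: comm_group "H2 QH D Mod HA.L" by (rule HA.Q.H.abelian_FactGroup[OF HA.Ln.is_subgroup])
interpretation SK: comm_group "H2 QK D Mod KA.L" by (rule KA.Q.H.abelian_FactGroup[OF KA.Ln.is_subgroup])
interpretation S: comm_group S by (rule DirProd_comm_group[OF SH.comm_group_axioms SK.comm_group_axioms])

lemma S_cases:
  assumes "s \<in> carrier S" obtains f g where "f \<in> HA.Q.Z2" "g \<in> KA.Q.Z2" "s = class_pair f g"
proof -
  obtain c d where cd: "c \<in> carrier (H2 QH D)" "d \<in> carrier (H2 QK D)"
    "s = (HA.L #>\<^bsub>H2 QH D\<^esub> c, KA.L #>\<^bsub>H2 QK D\<^esub> d)"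
    using assms by (auto simp: carrier_FactGroup)
  from cd(1) obtain f where f: "f \<in> HA.Q.Z2" "c = H2_class QH D f" by (elim HA.Q.H2_cases)
  from cd(2) obtain g where g: "g \<in> KA.Q.Z2" "d = H2_class QK D g" by (elim KA.Q.H2_cases)
  show thesis using that[OF f(1) g(1)] cd(3) f(2) g(2) by (simp add: class_pair_def)
qed

lemma class_pair_carrier: "f \<in> HA.Q.Z2 \<Longrightarrow> g \<in> KA.Q.Z2 \<Longrightarrow> class_pair f g \<in> carrier S"
  using HA.Q.H2_class_carrier KA.Q.H2_class_carrier by (auto simp: class_pair_def carrier_FactGroup)

lemma class_pair_div:
  assumes "f \<in> HA.Q.Z2" "g \<in> KA.Q.Z2" "f' \<in> HA.Q.Z2" "g' \<in> KA.Q.Z2"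
  shows "class_pair f g \<otimes>\<^bsub>S\<^esub> inv\<^bsub>S\<^esub> class_pair f' g' =
     class_pair (f \<otimes>\<^bsub>cocycle_group QH D\<^esub> inv\<^bsub>cocycle_group QH D\<^esub> f') (g \<otimes>\<^bsub>cocycle_group QK D\<^esub> inv\<^bsub>cocycle_group QK D\<^esub> g')"
proof -
  note c = HA.Q.H2_class_carrier[OF assms(1)] HA.Q.H2_class_carrier[OF assms(3)] KA.Q.H2_class_carrier[OF assms(2)] KA.Q.H2_class_carrier[OF assms(4)]
  have m: "HA.L #>\<^bsub>H2 QH D\<^esub> H2_class QH D f' \<in> carrier (H2 QH D Mod HA.L)" "KA.L #>\<^bsub>H2 QK D\<^esub> H2_class QK D g' \<in> carrier (H2 QK D Mod KA.L)"
    using c by (auto simp: carrier_FactGroup)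
  show ?thesis
    unfolding class_pair_def inv_DirProd[OF SH.is_group SK.is_group m] mult_DirProd
      HA.Ln.rcos_div[OF c(1,2)] KA.Ln.rcos_div[OF c(3,4)] HA.Q.H2_class_div[OF assms(1,3)] KA.Q.H2_class_div[OF assms(2,4)] ..
qed

lemma class_pair_one_iff:
  assumes "f \<in> HA.Q.Z2" "g \<in> KA.Q.Z2"
  shows "class_pair f g = \<one>\<^bsub>S\<^esub> \<longleftrightarrow> H2_class QH D f \<in> HA.L \<and> H2_class QK D g \<in> KA.L"
  unfolding class_pair_def
  using HA.Ln.rcos_eq_self_iff[OF HA.Q.H2_class_carrier[OF assms(1)]] KA.Ln.rcos_eq_self_iff[OF KA.Q.H2_class_carrier[OF assms(2)]]
  by simp

lemma transgresses_A_div: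
  assumes "transgresses_A f g \<chi>" "transgresses_A f' g' \<chi>'"
  shows "transgresses_A (f \<otimes>\<^bsub>cocycle_group QH D\<^esub> inv\<^bsub>cocycle_group QH D\<^esub> f') (g \<otimes>\<^bsub>cocycle_group QK D\<^esub> inv\<^bsub>cocycle_group QK D\<^esub> g')
     (\<lambda>a. \<chi> a \<otimes>\<^bsub>D\<^esub> inv\<^bsub>D\<^esub> \<chi>' a)"
proof -
  from assms(1) obtain u v where 1: "f \<in> HA.Q.Z2" "g \<in> KA.Q.Z2" "\<chi> \<in> homA" "transgresses GH A D f \<chi> u" "transgresses GK A D g \<chi> v"
    unfolding transgresses_A_def by blast
  from assms(2) obtain u' v' where 2: "f' \<in> HA.Q.Z2" "g' \<in> KA.Q.Z2" "\<chi>' \<in> homA" "transgresses GH A D f' \<chi>' u'" "transgresses GK A D g' \<chi>' v'"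
    unfolding transgresses_A_def by blast
  show ?thesis unfolding transgresses_A_def
    using 1 2 hom_div_closed[OF A_group D.comm_group_axioms 1(3) 2(3)]
      H_transgresses_div[OF 1(1) 2(1) 1(4) 2(4) 1(3) 2(3)] K_transgresses_div[OF 1(2) 2(2) 1(5) 2(5) 1(3) 2(3)]
    by (intro conjI exI) (assumption | simp)+
qed

lemma transgresses_A_exists:
  assumes "\<chi> \<in> homA" shows "\<exists>f g. transgresses_A f g \<chi>"
  using HA.transgresses_exists[unfolded GHA, OF assms] KA.transgresses_exists[unfolded GKA, OF assms] assms
  unfolding transgresses_A_def by blast

lemma N_subgroup: "subgroup N S"
proof (rule S.subgroup_by_div)
  show "N \<subseteq> carrier S" unfolding N_def transgresses_A_def using class_pair_carrier by blast
  have "(\<lambda>_. \<one>\<^bsub>D\<^esub>) \<in> homA" by (simp add: hom_def)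
  then show "N \<noteq> {}" unfolding N_def using transgresses_A_exists by blast
  fix x y assume "x \<in> N" "y \<in> N"
  then obtain f g \<chi> f' g' \<chi>' where xy: "x = class_pair f g" "transgresses_A f g \<chi>" "y = class_pair f' g'" "transgresses_A f' g' \<chi>'"
    unfolding N_def by blast
  have "x \<otimes>\<^bsub>S\<^esub> inv\<^bsub>S\<^esub> y = class_pair (f \<otimes>\<^bsub>cocycle_group QH D\<^esub> inv\<^bsub>cocycle_group QH D\<^esub> f') (g \<otimes>\<^bsub>cocycle_group QK D\<^esub> inv\<^bsub>cocycle_group QK D\<^esub> g')"
    unfolding xy(1,3) by (rule class_pair_div) (use xy in \<open>simp_all add: transgresses_A_def\<close>)
  then show "x \<otimes>\<^bsub>S\<^esub> inv\<^bsub>S\<^esub> y \<in> N" unfolding N_def using transgresses_A_div[OF xy(2,4)] by blast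
qed

lemma GZ_group: "group (G\<lparr>carrier := Z\<rparr>)" by (rule G.subgroup_imp_group[OF Z_subgroup])

lemma N_iso: "S\<lparr>carrier := N\<rparr> \<cong> hom_group (G\<lparr>carrier := Z\<rparr>) D"
proof -
  let ?W = "hom_group (G\<lparr>carrier := Z\<rparr>) D"
  interpret W: comm_group ?W by (rule comm_group_hom_group[OF GZ_group D.comm_group_axioms])
  interpret SN: group "S\<lparr>carrier := N\<rparr>" by (rule S.subgroup_imp_group[OF N_subgroup])
  define R where "R n \<theta> \<longleftrightarrow> \<theta> \<in> carrier ?W \<and> (\<exists>f g \<chi>. n = class_pair f g \<and> transgresses_A f g \<chi> \<and> (\<forall>z\<in>Z. \<theta> z = \<chi> z))" for n \<theta>
  have RN: "R n \<theta> \<Longrightarrow> n \<in> N" for n \<theta> unfolding R_def N_def by blast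
  show ?thesis
  proof (rule iso_by_relation[of _ _ R])
    show "group (S\<lparr>carrier := N\<rparr>)" by (rule SN.is_group)
    show "group ?W" by (rule W.is_group)
  next
    fix n assume "n \<in> carrier (S\<lparr>carrier := N\<rparr>)"
    then obtain f g \<chi> where n: "n = class_pair f g" "transgresses_A f g \<chi>" unfolding N_def by auto
    then have "\<chi> \<in> hom (G\<lparr>carrier := Z\<rparr>) D" using homA_restrict_Z unfolding transgresses_A_def by blast
    from restrict_in_hom_group[OF GZ_group D.comm_group_axioms this]
    have "R n (restrict \<chi> Z)" unfolding R_def using n by auto
    then show "\<exists>\<theta>. R n \<theta>" by blast
  next
    fix n \<theta> assume "R n \<theta>"
    then show "n \<in> carrier (S\<lparr>carrier := N\<rparr>) \<and> \<theta> \<in> carrier ?W" using RN by (simp add: R_def)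
  next
    fix n \<theta> n' \<theta>' assume r: "R n \<theta>" "R n' \<theta>'"
    obtain f g \<chi> where n: "\<theta> \<in> carrier ?W" "n = class_pair f g" "transgresses_A f g \<chi>" "\<And>z. z \<in> Z \<Longrightarrow> \<theta> z = \<chi> z"
      using r(1) unfolding R_def by blast
    obtain f' g' \<chi>' where n': "\<theta>' \<in> carrier ?W" "n' = class_pair f' g'" "transgresses_A f' g' \<chi>'" "\<And>z. z \<in> Z \<Longrightarrow> \<theta>' z = \<chi>' z"
      using r(2) unfolding R_def by blast
    have m: "n \<otimes>\<^bsub>S\<lparr>carrier := N\<rparr>\<^esub> inv\<^bsub>S\<lparr>carrier := N\<rparr>\<^esub> n' = n \<otimes>\<^bsub>S\<^esub> inv\<^bsub>S\<^esub> n'"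
      using S.m_inv_consistent[OF N_subgroup RN[OF r(2)]] by simp
    have d: "n \<otimes>\<^bsub>S\<^esub> inv\<^bsub>S\<^esub> n' = class_pair (f \<otimes>\<^bsub>cocycle_group QH D\<^esub> inv\<^bsub>cocycle_group QH D\<^esub> f') (g \<otimes>\<^bsub>cocycle_group QK D\<^esub> inv\<^bsub>cocycle_group QK D\<^esub> g')"
      unfolding n(2) n'(2) by (rule class_pair_div) (use n n' in \<open>simp_all add: transgresses_A_def\<close>)
    have v: "\<forall>z\<in>Z. (\<theta> \<otimes>\<^bsub>?W\<^esub> inv\<^bsub>?W\<^esub> \<theta>') z = \<chi> z \<otimes>\<^bsub>D\<^esub> inv\<^bsub>D\<^esub> \<chi>' z"
      using hom_group_div_apply[OF GZ_group D.comm_group_axioms n(1) n'(1)] n(4) n'(4) by simp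
    have w: "\<theta> \<otimes>\<^bsub>?W\<^esub> inv\<^bsub>?W\<^esub> \<theta>' \<in> carrier ?W" using n(1) n'(1) by simp
    show "R (n \<otimes>\<^bsub>S\<lparr>carrier := N\<rparr>\<^esub> inv\<^bsub>S\<lparr>carrier := N\<rparr>\<^esub> n') (\<theta> \<otimes>\<^bsub>?W\<^esub> inv\<^bsub>?W\<^esub> \<theta>')"
      unfolding m d R_def using w v transgresses_A_div[OF n(3) n'(3)] by blast
  next
    fix n \<theta> assume "R n \<theta>"
    then obtain f g \<chi> where n: "\<theta> \<in> carrier ?W" "n = class_pair f g" "transgresses_A f g \<chi>" "\<And>z. z \<in> Z \<Longrightarrow> \<theta> z = \<chi> z"
      unfolding R_def by blast
    then obtain u v where fg: "f \<in> HA.Q.Z2" "g \<in> KA.Q.Z2" "\<chi> \<in> homA" "transgresses GH A D f \<chi> u" "transgresses GK A D g \<chi> v"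
      unfolding transgresses_A_def by blast
    \<comment> \<open>Both memberships are decided by the same character, through its values on
      \<open>Z\<close> alone.\<close>
    have "n = \<one>\<^bsub>S\<^esub> \<longleftrightarrow> (\<forall>z\<in>Z. \<chi> z = \<one>\<^bsub>D\<^esub>)"
      unfolding n(2) class_pair_one_iff[OF fg(1,2)] HA.transgresses_in_L_iff[unfolded GHA, OF fg(1,4,3)]
        KA.transgresses_in_L_iff[unfolded GKA, OF fg(2,5,3)] by simp
    also have "\<dots> \<longleftrightarrow> \<theta> = \<one>\<^bsub>?W\<^esub>"
      using hom_group_one_iff[OF GZ_group D.comm_group_axioms n(1)] n(4) by simp
    finally show "n = \<one>\<^bsub>S\<lparr>carrier := N\<rparr>\<^esub> \<longleftrightarrow> \<theta> = \<one>\<^bsub>?W\<^esub>" by simp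
  next
    fix \<theta> assume \<theta>: "\<theta> \<in> carrier ?W"
    then have h: "\<theta> \<in> hom (GH\<lparr>carrier := Z\<rparr>) D" by (simp add: hom_group_carrier_iff)
    \<comment> \<open>The extension to \<open>A\<close> is not unique, but two extensions differ by
      a character trivial on \<open>Z\<close>, whose transgressions lie in the kernels that are
      divided out.\<close>
    obtain \<chi> where \<chi>: "\<chi> \<in> homA" "\<And>z. z \<in> Z \<Longrightarrow> \<chi> z = \<theta> z"
      using HA.extend_to_B[unfolded GHA, OF divisible HA.C Z_A h] by blast
    obtain f g where "transgresses_A f g \<chi>" using transgresses_A_exists[OF \<chi>(1)] by blast
    then have "R (class_pair f g) \<theta>" unfolding R_def using \<theta> \<chi>(2) by (metis (no_types))
    then show "\<exists>n. R n \<theta>" by blast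
  qed
qed

subsection \<open>The embedding into the cohomology of a central product\<close>

abbreviation "T \<equiv> ab_tensor QH QK"

text \<open>A Kuenneth-type cocycle, inflated from the two factors of \<open>G/A\<close>, with one
  mixed term. Prescribing it on products \<open>h k\<close> is consistent, since only cosets modulo
  \<open>A\<close> enter, and determines \<open>F\<close>, since \<open>G = HK\<close>. The mixed
  term pairs the \<open>H\<close>-part of the first argument with the \<open>K\<close>-part of the
  second and not conversely, so it shows up in the commutator of lifts of \<open>h\<close> and
  \<open>k\<close>.\<close>

definition product_cocycle where
  "product_cocycle f g \<theta> F \<longleftrightarrow> F \<in> GG.Z2 \<and> (\<forall>h\<in>H. \<forall>k\<in>K. \<forall>h'\<in>H. \<forall>k'\<in>K.
     F (h \<otimes>\<^bsub>G\<^esub> k, h' \<otimes>\<^bsub>G\<^esub> k') = f (A #>\<^bsub>G\<^esub> h, A #>\<^bsub>G\<^esub> h') \<otimes>\<^bsub>D\<^esub> g (A #>\<^bsub>G\<^esub> k, A #>\<^bsub>G\<^esub> k')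
        \<otimes>\<^bsub>D\<^esub> \<theta> (ab_tens QH QK (A #>\<^bsub>G\<^esub> h) (A #>\<^bsub>G\<^esub> k')))"

lemma cosets_carrier: "h \<in> H \<Longrightarrow> A #>\<^bsub>G\<^esub> h \<in> carrier QH" "k \<in> K \<Longrightarrow> A #>\<^bsub>G\<^esub> k \<in> carrier QK"
  using HA.proj_closed[of h] KA.proj_closed[of k] by simp_all

lemma cosets_mult:
  "h \<in> H \<Longrightarrow> h' \<in> H \<Longrightarrow> (A #>\<^bsub>G\<^esub> h) \<otimes>\<^bsub>QH\<^esub> (A #>\<^bsub>G\<^esub> h') = A #>\<^bsub>G\<^esub> (h \<otimes>\<^bsub>G\<^esub> h')"
  "k \<in> K \<Longrightarrow> k' \<in> K \<Longrightarrow> (A #>\<^bsub>G\<^esub> k) \<otimes>\<^bsub>QK\<^esub> (A #>\<^bsub>G\<^esub> k') = A #>\<^bsub>G\<^esub> (k \<otimes>\<^bsub>G\<^esub> k')"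
  using HA.proj_mult[of h h'] KA.proj_mult[of k k'] by simp_all

lemma bimult_hom_tens:
  assumes "group P" "group Q" "\<theta> \<in> hom (ab_tensor P Q) D"
  shows "bimult P Q D (\<lambda>a b. \<theta> (ab_tens P Q a b))"
  using bimult_ab_tens[OF assms(1,2)] hom_mult[OF assms(3)] hom_in_carrier[OF assms(3)]
  unfolding bimult_def by simp

text \<open>Stands in for the decomposition of \<open>G/A\<close> as a direct product. Moving an
  element of \<open>A\<close> between \<open>h\<close> and \<open>k\<close> affects neither coset,
  so both projections are well defined on \<open>G\<close>; they are homomorphisms because
  \<open>H\<close> and \<open>K\<close> commute.\<close>

lemma HK_projections:
  "\<exists>p\<in>hom G QH. \<forall>h\<in>H. \<forall>k\<in>K. p (h \<otimes>\<^bsub>G\<^esub> k) = A #>\<^bsub>G\<^esub> h"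
  "\<exists>q\<in>hom G QK. \<forall>h\<in>H. \<forall>k\<in>K. q (h \<otimes>\<^bsub>G\<^esub> k) = A #>\<^bsub>G\<^esub> k"
proof -
  have "\<exists>p. \<forall>h\<in>H. \<forall>k\<in>K. p (h \<otimes>\<^bsub>G\<^esub> k) = A #>\<^bsub>G\<^esub> h"
    by (rule glue) (use HA.proj_central in simp)
  then obtain p where p: "\<And>h k. h \<in> H \<Longrightarrow> k \<in> K \<Longrightarrow> p (h \<otimes>\<^bsub>G\<^esub> k) = A #>\<^bsub>G\<^esub> h" by blast
  have "p \<in> hom G QH"
  proof (rule homI)
    fix x assume x: "x \<in> carrier G"
    then obtain h k where hk: "h \<in> H" "k \<in> K" "x = h \<otimes>\<^bsub>G\<^esub> k" using HK_cases by blast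
    then show "p x \<in> carrier QH" using p cosets_carrier by simp
    fix y assume "y \<in> carrier G"
    then obtain h' k' where hk': "h' \<in> H" "k' \<in> K" "y = h' \<otimes>\<^bsub>G\<^esub> k'" using HK_cases by blast
    show "p (x \<otimes>\<^bsub>G\<^esub> y) = p x \<otimes>\<^bsub>QH\<^esub> p y"
      unfolding hk(3) hk'(3) HK_mult[OF hk(1,2) hk'(1,2)] p[OF hk(1,2)] p[OF hk'(1,2)]
        p[OF H.m_closed[OF hk(1) hk'(1)] K.m_closed[OF hk(2) hk'(2)]] cosets_mult(1)[OF hk(1) hk'(1)] ..
  qed
  then show "\<exists>p\<in>hom G QH. \<forall>h\<in>H. \<forall>k\<in>K. p (h \<otimes>\<^bsub>G\<^esub> k) = A #>\<^bsub>G\<^esub> h" using p by blast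
  have ak: "A #>\<^bsub>G\<^esub> (a \<otimes>\<^bsub>G\<^esub> k) = A #>\<^bsub>G\<^esub> k" if "a \<in> A" "k \<in> K" for a k
    using KA.proj_central[of k a] A_central[of k a] that K.mem_carrier by simp
  have "\<exists>q. \<forall>h\<in>H. \<forall>k\<in>K. q (h \<otimes>\<^bsub>G\<^esub> k) = A #>\<^bsub>G\<^esub> k"
    by (rule glue) (rule ak[symmetric])
  then obtain q where q: "\<And>h k. h \<in> H \<Longrightarrow> k \<in> K \<Longrightarrow> q (h \<otimes>\<^bsub>G\<^esub> k) = A #>\<^bsub>G\<^esub> k" by blast
  have "q \<in> hom G QK"
  proof (rule homI)
    fix x assume x: "x \<in> carrier G"
    then obtain h k where hk: "h \<in> H" "k \<in> K" "x = h \<otimes>\<^bsub>G\<^esub> k" using HK_cases by blast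
    then show "q x \<in> carrier QK" using q cosets_carrier by simp
    fix y assume "y \<in> carrier G"
    then obtain h' k' where hk': "h' \<in> H" "k' \<in> K" "y = h' \<otimes>\<^bsub>G\<^esub> k'" using HK_cases by blast
    show "q (x \<otimes>\<^bsub>G\<^esub> y) = q x \<otimes>\<^bsub>QK\<^esub> q y"
      unfolding hk(3) hk'(3) HK_mult[OF hk(1,2) hk'(1,2)] q[OF hk(1,2)] q[OF hk'(1,2)]
        q[OF H.m_closed[OF hk(1) hk'(1)] K.m_closed[OF hk(2) hk'(2)]] cosets_mult(2)[OF hk(2) hk'(2)] ..
  qed
  then show "\<exists>q\<in>hom G QK. \<forall>h\<in>H. \<forall>k\<in>K. q (h \<otimes>\<^bsub>G\<^esub> k) = A #>\<^bsub>G\<^esub> k" using q by blast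
qed

lemma product_cocycle_exists:
  assumes f: "f \<in> HA.Q.Z2" and g: "g \<in> KA.Q.Z2" and \<theta>: "\<theta> \<in> hom T D"
  shows "\<exists>F. product_cocycle f g \<theta> F"
proof -
  obtain p where p: "p \<in> hom G QH" "\<And>h k. h \<in> H \<Longrightarrow> k \<in> K \<Longrightarrow> p (h \<otimes>\<^bsub>G\<^esub> k) = A #>\<^bsub>G\<^esub> h"
    using HK_projections(1) by blast
  obtain q where q: "q \<in> hom G QK" "\<And>h k. h \<in> H \<Longrightarrow> k \<in> K \<Longrightarrow> q (h \<otimes>\<^bsub>G\<^esub> k) = A #>\<^bsub>G\<^esub> k"
    using HK_projections(2) by blast
  define \<beta> where "\<beta> a b = \<theta> (ab_tens QH QK a b)" for a b
  have \<beta>: "bimult QH QK D \<beta>"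
    unfolding \<beta>_def by (rule bimult_hom_tens[OF HA.Q.P.is_group KA.Q.P.is_group \<theta>])
  note pq = hom_in_carrier[OF p(1)] hom_in_carrier[OF q(1)] hom_mult[OF p(1)] hom_mult[OF q(1)]
  let ?b = "\<lambda>r\<in>carrier G \<times> carrier G. \<beta> (p (fst r)) (q (snd r))"
  \<comment> \<open>A bimultiplicative map is a 2-cocycle: both sides of the identity expand to the
    same three values.\<close>
  have b: "?b \<in> GG.Z2"
  proof (rule GG.Z2I)
    fix x y z assume xyz: "x \<in> carrier G" "y \<in> carrier G" "z \<in> carrier G"
    have cl: "\<beta> (p x) (q y) \<in> carrier D" "\<beta> (p x) (q z) \<in> carrier D" "\<beta> (p y) (q z) \<in> carrier D"
      using \<beta> pq xyz unfolding bimult_def by auto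
    have e: "\<beta> (p x) (q (y \<otimes>\<^bsub>G\<^esub> z)) = \<beta> (p x) (q y) \<otimes>\<^bsub>D\<^esub> \<beta> (p x) (q z)"
      "\<beta> (p (x \<otimes>\<^bsub>G\<^esub> y)) (q z) = \<beta> (p x) (q z) \<otimes>\<^bsub>D\<^esub> \<beta> (p y) (q z)"
      using \<beta> pq xyz unfolding bimult_def by auto
    show "?b (y, z) \<otimes>\<^bsub>D\<^esub> ?b (x, y \<otimes>\<^bsub>G\<^esub> z) = ?b (x \<otimes>\<^bsub>G\<^esub> y, z) \<otimes>\<^bsub>D\<^esub> ?b (x, y)"
      using xyz by (simp add: e) (simp add: cl D.m_ac)
  qed (use \<beta> pq in \<open>auto simp: bimult_def\<close>)
  let ?C = "cocycle_group G D"
  let ?pf = "pullback G p f" and ?qg = "pullback G q g"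
  have pf: "?pf \<in> GG.Z2" by (rule GG.pullback_Z2[OF HA.Q.P.is_group p(1) f])
  have qg: "?qg \<in> GG.Z2" by (rule GG.pullback_Z2[OF KA.Q.P.is_group q(1) g])
  let ?F = "?pf \<otimes>\<^bsub>?C\<^esub> ?qg \<otimes>\<^bsub>?C\<^esub> ?b"
  have F: "?F \<in> GG.Z2" by (intro GG.Z2_mult pf qg b)
  have Fv: "?F (h \<otimes>\<^bsub>G\<^esub> k, h' \<otimes>\<^bsub>G\<^esub> k') = f (A #>\<^bsub>G\<^esub> h, A #>\<^bsub>G\<^esub> h') \<otimes>\<^bsub>D\<^esub> g (A #>\<^bsub>G\<^esub> k, A #>\<^bsub>G\<^esub> k') \<otimes>\<^bsub>D\<^esub> \<beta> (A #>\<^bsub>G\<^esub> h) (A #>\<^bsub>G\<^esub> k')"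
    if c: "h \<in> H" "k \<in> K" "h' \<in> H" "k' \<in> K" for h k h' k'
    using HK_closed[OF c(1,2)] HK_closed[OF c(3,4)] p(2)[OF c(1,2)] p(2)[OF c(3,4)] q(2)[OF c(1,2)] q(2)[OF c(3,4)]
    by (simp add: GG.mult_cocycle_group)
  show ?thesis unfolding product_cocycle_def \<beta>_def[symmetric] by (intro exI[of _ ?F] conjI ballI F Fv)
qed

text \<open>A trivialization \<open>w\<close> makes \<open>F\<close> symmetric on commuting pairs,
  which kills the mixed term; its restrictions to \<open>H\<close> and \<open>K\<close> then share
  the character \<open>w / w 1\<close> of \<open>A\<close>. For the converse, the trivializations
  over \<open>H\<close> and \<open>K\<close> are first brought to a common character and then
  multiplied together.\<close>

lemma product_cocycle_trivial_iff:
  assumes f: "f \<in> HA.Q.Z2" and g: "g \<in> KA.Q.Z2" and \<theta>: "\<theta> \<in> hom T D" and F: "product_cocycle f g \<theta> F"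
  shows "(\<exists>w. cobounds G D F w) \<longleftrightarrow> class_pair f g \<in> N \<and> (\<forall>t\<in>carrier T. \<theta> t = \<one>\<^bsub>D\<^esub>)"
proof -
  define \<beta> where "\<beta> a b = \<theta> (ab_tens QH QK a b)" for a b
  have bm: "bimult QH QK D \<beta>"
    unfolding \<beta>_def by (rule bimult_hom_tens[OF HA.Q.P.is_group KA.Q.P.is_group \<theta>])
  have FZ: "F \<in> GG.Z2" using F by (simp add: product_cocycle_def)
  have Fx: "F (h \<otimes>\<^bsub>G\<^esub> k, h' \<otimes>\<^bsub>G\<^esub> k') = f (A #>\<^bsub>G\<^esub> h, A #>\<^bsub>G\<^esub> h') \<otimes>\<^bsub>D\<^esub> g (A #>\<^bsub>G\<^esub> k, A #>\<^bsub>G\<^esub> k') \<otimes>\<^bsub>D\<^esub> \<beta> (A #>\<^bsub>G\<^esub> h) (A #>\<^bsub>G\<^esub> k')"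
    if "h \<in> H" "k \<in> K" "h' \<in> H" "k' \<in> K" for h k h' k'
    using F that unfolding product_cocycle_def \<beta>_def by blast
  have fc: "f (A #>\<^bsub>G\<^esub> h, A #>\<^bsub>G\<^esub> h') \<in> carrier D" if "h \<in> H" "h' \<in> H" for h h'
    using HA.Q.Z2_closed[OF f] cosets_carrier that by blast
  have gc: "g (A #>\<^bsub>G\<^esub> k, A #>\<^bsub>G\<^esub> k') \<in> carrier D" if "k \<in> K" "k' \<in> K" for k k'
    using KA.Q.Z2_closed[OF g] cosets_carrier that by blast
  have bc: "\<beta> (A #>\<^bsub>G\<^esub> h) (A #>\<^bsub>G\<^esub> k) \<in> carrier D" if "h \<in> H" "k \<in> K" for h k
    using bm cosets_carrier that unfolding bimult_def by blast
  have A1: "A #>\<^bsub>G\<^esub> \<one>\<^bsub>G\<^esub> = A" using HA.Bn.rcos_one by simp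
  note oneH = H.one_closed and oneK = K.one_closed
  have b1: "\<beta> (A #>\<^bsub>G\<^esub> h) A = \<one>\<^bsub>D\<^esub>" if h: "h \<in> H" for h
  proof -
    have "\<beta> (A #>\<^bsub>G\<^esub> h) (A \<otimes>\<^bsub>QK\<^esub> A) = \<beta> (A #>\<^bsub>G\<^esub> h) A \<otimes>\<^bsub>D\<^esub> \<beta> (A #>\<^bsub>G\<^esub> h) A"
      using bm cosets_carrier(1)[OF h] cosets_carrier(2)[OF oneK] unfolding bimult_def A1 by blast
    moreover have "A \<otimes>\<^bsub>QK\<^esub> A = A" using cosets_mult(2)[OF oneK oneK] A1 by simp
    ultimately show ?thesis using bc[OF h oneK] unfolding A1 by simp
  qed
  have b2: "\<beta> A (A #>\<^bsub>G\<^esub> k) = \<one>\<^bsub>D\<^esub>" if k: "k \<in> K" for k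
  proof -
    have "\<beta> (A \<otimes>\<^bsub>QH\<^esub> A) (A #>\<^bsub>G\<^esub> k) = \<beta> A (A #>\<^bsub>G\<^esub> k) \<otimes>\<^bsub>D\<^esub> \<beta> A (A #>\<^bsub>G\<^esub> k)"
      using bm cosets_carrier(1)[OF oneH] cosets_carrier(2)[OF k] unfolding bimult_def A1 by blast
    moreover have "A \<otimes>\<^bsub>QH\<^esub> A = A" using cosets_mult(1)[OF oneH oneH] A1 by simp
    ultimately show ?thesis using bc[OF oneH k] unfolding A1 by simp
  qed
  have f1: "f (A #>\<^bsub>G\<^esub> h, A) = f (A, A)" "f (A, A #>\<^bsub>G\<^esub> h) = f (A, A)" if "h \<in> H" for h
    using HA.Q.Z2_one_right[OF f cosets_carrier(1)[OF that]] HA.Q.Z2_one_left[OF f cosets_carrier(1)[OF that]] by simp_all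
  have g1: "g (A #>\<^bsub>G\<^esub> k, A) = g (A, A)" "g (A, A #>\<^bsub>G\<^esub> k) = g (A, A)" if "k \<in> K" for k
    using KA.Q.Z2_one_right[OF g cosets_carrier(2)[OF that]] KA.Q.Z2_one_left[OF g cosets_carrier(2)[OF that]] by simp_all
  have f11: "f (A, A) \<in> carrier D" using fc[OF oneH oneH] A1 by simp
  have g11: "g (A, A) \<in> carrier D" using gc[OF oneK oneK] A1 by simp
  show ?thesis
  proof
    assume "\<exists>w. cobounds G D F w"
    then obtain w where w: "cobounds G D F w" by blast
    have wc: "\<And>x. x \<in> carrier G \<Longrightarrow> w x \<in> carrier D" using GG.cobounds_closed[OF w] .
    \<comment> \<open>At \<open>(h, k)\<close> and at \<open>(k, h)\<close> the factors from the two
      quotients are the constants \<open>f (A, A)\<close> and \<open>g (A, A)\<close>, whereas the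
      mixed term is present at \<open>(h, k)\<close> only.\<close>
    have triv: "\<beta> (A #>\<^bsub>G\<^esub> h) (A #>\<^bsub>G\<^esub> k) = \<one>\<^bsub>D\<^esub>" if c: "h \<in> H" "k \<in> K" for h k
    proof -
      note cc = H.mem_carrier[OF c(1)] K.mem_carrier[OF c(2)]
      have "F (h, k) \<otimes>\<^bsub>D\<^esub> w (h \<otimes>\<^bsub>G\<^esub> k) = F (k, h) \<otimes>\<^bsub>D\<^esub> w (h \<otimes>\<^bsub>G\<^esub> k)"
        using GG.coboundsD[OF w cc] GG.coboundsD[OF w cc(2,1)] commute[OF c] wc cc by (simp add: D.m_comm)
      then have "F (h, k) = F (k, h)" using GG.Z2_closed[OF FZ] wc cc by simp
      moreover have "F (h, k) = f (A, A) \<otimes>\<^bsub>D\<^esub> g (A, A) \<otimes>\<^bsub>D\<^esub> \<beta> (A #>\<^bsub>G\<^esub> h) (A #>\<^bsub>G\<^esub> k)"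
        using Fx[OF c(1) oneK oneH c(2)] cc by (simp add: A1 f1[OF c(1)] g1[OF c(2)])
      moreover have "F (k, h) = f (A, A) \<otimes>\<^bsub>D\<^esub> g (A, A)"
        using Fx[OF oneH c(2) c(1) oneK] cc b1[OF oneH] f11 g11 by (simp add: A1 f1[OF c(1)] g1[OF c(2)])
      ultimately have "f (A, A) \<otimes>\<^bsub>D\<^esub> g (A, A) \<otimes>\<^bsub>D\<^esub> \<beta> (A #>\<^bsub>G\<^esub> h) (A #>\<^bsub>G\<^esub> k) = f (A, A) \<otimes>\<^bsub>D\<^esub> g (A, A) \<otimes>\<^bsub>D\<^esub> \<one>\<^bsub>D\<^esub>"
        using f11 g11 by simp
      then show ?thesis using D.l_cancel[of "f (A, A) \<otimes>\<^bsub>D\<^esub> g (A, A)"] f11 g11 bc[OF c] by blast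
    qed
    have 1: "\<theta> t = \<one>\<^bsub>D\<^esub>" if t: "t \<in> carrier T" for t
    proof (rule ab_tens_generate[OF HA.Q.P.is_group KA.Q.P.is_group D.is_group \<theta> _ t])
      fix a b assume "a \<in> carrier QH" "b \<in> carrier QK"
      then obtain h k where hk: "h \<in> H" "k \<in> K" "a = A #>\<^bsub>G\<^esub> h" "b = A #>\<^bsub>G\<^esub> k" by (auto simp: carrier_FactGroup)
      show "\<theta> (ab_tens QH QK a b) = \<one>\<^bsub>D\<^esub>" using triv[OF hk(1,2)] hk by (simp add: \<beta>_def)
    qed
    have shift: "x \<otimes>\<^bsub>D\<^esub> (c \<otimes>\<^bsub>D\<^esub> inv\<^bsub>D\<^esub> e) = (a \<otimes>\<^bsub>D\<^esub> inv\<^bsub>D\<^esub> e) \<otimes>\<^bsub>D\<^esub> (b \<otimes>\<^bsub>D\<^esub> inv\<^bsub>D\<^esub> e)"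
      if "x \<otimes>\<^bsub>D\<^esub> e \<otimes>\<^bsub>D\<^esub> c = a \<otimes>\<^bsub>D\<^esub> b" and xx: "x \<in> carrier D" "e \<in> carrier D" "c \<in> carrier D" "a \<in> carrier D" "b \<in> carrier D" for x e c a b
    proof -
      have "(a \<otimes>\<^bsub>D\<^esub> inv\<^bsub>D\<^esub> e) \<otimes>\<^bsub>D\<^esub> (b \<otimes>\<^bsub>D\<^esub> inv\<^bsub>D\<^esub> e) = (a \<otimes>\<^bsub>D\<^esub> b) \<otimes>\<^bsub>D\<^esub> inv\<^bsub>D\<^esub> (e \<otimes>\<^bsub>D\<^esub> e)"
        using D.div_mult_div xx by simp
      also have "\<dots> = (x \<otimes>\<^bsub>D\<^esub> c \<otimes>\<^bsub>D\<^esub> e) \<otimes>\<^bsub>D\<^esub> inv\<^bsub>D\<^esub> (e \<otimes>\<^bsub>D\<^esub> e)" unfolding that(1)[symmetric] using xx by (simp add: D.m_ac)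
      also have "\<dots> = (x \<otimes>\<^bsub>D\<^esub> c \<otimes>\<^bsub>D\<^esub> inv\<^bsub>D\<^esub> e) \<otimes>\<^bsub>D\<^esub> (e \<otimes>\<^bsub>D\<^esub> inv\<^bsub>D\<^esub> e)" by (rule D.div_mult_div[symmetric]) (use xx in simp_all)
      also have "\<dots> = x \<otimes>\<^bsub>D\<^esub> (c \<otimes>\<^bsub>D\<^esub> inv\<^bsub>D\<^esub> e)" using xx by (simp add: D.m_assoc)
      finally show ?thesis by simp
    qed
    \<comment> \<open>On \<open>H x H\<close> the cocycle \<open>F\<close> is \<open>f\<close> times
      the constant \<open>g (A, A)\<close>, so \<open>w\<close> is divided by that constant to
      trivialize \<open>f\<close>; on \<open>K\<close> the roles are exchanged.\<close>
    let ?u = "\<lambda>x. w x \<otimes>\<^bsub>D\<^esub> inv\<^bsub>D\<^esub> g (A, A)" and ?v = "\<lambda>x. w x \<otimes>\<^bsub>D\<^esub> inv\<^bsub>D\<^esub> f (A, A)"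
    have "f (A #>\<^bsub>G\<^esub> h, A #>\<^bsub>G\<^esub> h') \<otimes>\<^bsub>D\<^esub> ?u (h \<otimes>\<^bsub>G\<^esub> h') = ?u h \<otimes>\<^bsub>D\<^esub> ?u h'" if c: "h \<in> H" "h' \<in> H" for h h'
    proof (rule shift)
      note cc = H.mem_carrier[OF c(1)] H.mem_carrier[OF c(2)]
      have "F (h, h') = f (A #>\<^bsub>G\<^esub> h, A #>\<^bsub>G\<^esub> h') \<otimes>\<^bsub>D\<^esub> g (A, A)"
        using Fx[OF c(1) oneK c(2) oneK] cc b1[OF c(1)] fc[OF c] g11 by (simp add: A1)
      then show "f (A #>\<^bsub>G\<^esub> h, A #>\<^bsub>G\<^esub> h') \<otimes>\<^bsub>D\<^esub> g (A, A) \<otimes>\<^bsub>D\<^esub> w (h \<otimes>\<^bsub>G\<^esub> h') = w h \<otimes>\<^bsub>D\<^esub> w h'"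
        using GG.coboundsD[OF w cc] by simp
    qed (use c fc g11 wc H.mem_carrier in auto)
    then have cu: "cobounds GH D (pullback GH (\<lambda>x. A #>\<^bsub>GH\<^esub> x) f) ?u"
      using wc g11 H.mem_carrier by (intro GHc.coboundsI) auto
    have "g (A #>\<^bsub>G\<^esub> h, A #>\<^bsub>G\<^esub> h') \<otimes>\<^bsub>D\<^esub> ?v (h \<otimes>\<^bsub>G\<^esub> h') = ?v h \<otimes>\<^bsub>D\<^esub> ?v h'" if c: "h \<in> K" "h' \<in> K" for h h'
    proof (rule shift)
      note cc = K.mem_carrier[OF c(1)] K.mem_carrier[OF c(2)]
      have "F (h, h') = g (A #>\<^bsub>G\<^esub> h, A #>\<^bsub>G\<^esub> h') \<otimes>\<^bsub>D\<^esub> f (A, A)"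
        using Fx[OF oneH c(1) oneH c(2)] cc b2[OF c(2)] gc[OF c] f11 by (simp add: A1 D.m_comm)
      then show "g (A #>\<^bsub>G\<^esub> h, A #>\<^bsub>G\<^esub> h') \<otimes>\<^bsub>D\<^esub> f (A, A) \<otimes>\<^bsub>D\<^esub> w (h \<otimes>\<^bsub>G\<^esub> h') = w h \<otimes>\<^bsub>D\<^esub> w h'"
        using GG.coboundsD[OF w cc] by simp
    qed (use c gc f11 wc K.mem_carrier in auto)
    then have cv: "cobounds GK D (pullback GK (\<lambda>x. A #>\<^bsub>GK\<^esub> x) g) ?v"
      using wc f11 K.mem_carrier by (intro GKc.coboundsI) auto
    \<comment> \<open>The constants divided out cancel in \<open>u a / u 1\<close> and in
      \<open>v a / v 1\<close>, so both sides yield this character.\<close>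
    let ?\<chi> = "\<lambda>a. w a \<otimes>\<^bsub>D\<^esub> inv\<^bsub>D\<^esub> w \<one>\<^bsub>G\<^esub>"
    have quot: "a \<otimes>\<^bsub>D\<^esub> inv\<^bsub>D\<^esub> e \<otimes>\<^bsub>D\<^esub> inv\<^bsub>D\<^esub> (b \<otimes>\<^bsub>D\<^esub> inv\<^bsub>D\<^esub> e) = a \<otimes>\<^bsub>D\<^esub> inv\<^bsub>D\<^esub> b"
      if "a \<in> carrier D" "b \<in> carrier D" "e \<in> carrier D" for a b e
      using that by (simp add: D.inv_mult D.m_assoc D.m_lcomm[of "inv\<^bsub>D\<^esub> e" "inv\<^bsub>D\<^esub> b"])
    have eu: "?u a \<otimes>\<^bsub>D\<^esub> inv\<^bsub>D\<^esub> ?u \<one>\<^bsub>GH\<^esub> = ?\<chi> a" if "a \<in> A" for a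
      using quot[of "w a" "w \<one>\<^bsub>G\<^esub>" "g (A, A)"] wc g11 that H.mem_carrier by simp
    have ev: "?v a \<otimes>\<^bsub>D\<^esub> inv\<^bsub>D\<^esub> ?v \<one>\<^bsub>GK\<^esub> = ?\<chi> a" if "a \<in> A" for a
      using quot[of "w a" "w \<one>\<^bsub>G\<^esub>" "f (A, A)"] wc f11 that H.mem_carrier by simp
    have tu: "transgresses GH A D f ?\<chi> ?u" by (rule HA.transgresses_cong[OF HA.cobounds_imp_transgresses(2)[OF f cu] eu])
    have tv: "transgresses GK A D g ?\<chi> ?v" by (rule KA.transgresses_cong[OF KA.cobounds_imp_transgresses(2)[OF g cv] ev])
    have h1: "(\<lambda>a. ?u a \<otimes>\<^bsub>D\<^esub> inv\<^bsub>D\<^esub> ?u \<one>\<^bsub>GH\<^esub>) \<in> homA" using HA.cobounds_imp_transgresses(1)[OF f cu] unfolding GHA .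
    have "?\<chi> \<in> homA"
    proof (rule homI)
      fix a b assume ab: "a \<in> carrier (G\<lparr>carrier := A\<rparr>)" "b \<in> carrier (G\<lparr>carrier := A\<rparr>)"
      show "?\<chi> a \<in> carrier D" using ab wc H.mem_carrier by simp
      show "?\<chi> (a \<otimes>\<^bsub>G\<lparr>carrier := A\<rparr>\<^esub> b) = ?\<chi> a \<otimes>\<^bsub>D\<^esub> ?\<chi> b"
        using hom_mult[OF h1 ab] eu[of a] eu[of b] eu[of "a \<otimes>\<^bsub>G\<^esub> b"] ab subgroup.m_closed[OF A_subgroup, of a b] by simp
    qed
    then have "transgresses_A f g ?\<chi>" unfolding transgresses_A_def using f g tu tv by blast
    then have "class_pair f g \<in> N" unfolding N_def by blast
    then show "class_pair f g \<in> N \<and> (\<forall>t\<in>carrier T. \<theta> t = \<one>\<^bsub>D\<^esub>)" using 1 by blast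
  next
    assume asm: "class_pair f g \<in> N \<and> (\<forall>t\<in>carrier T. \<theta> t = \<one>\<^bsub>D\<^esub>)"
    then obtain f1 g1 \<chi> where fg: "class_pair f g = class_pair f1 g1" "transgresses_A f1 g1 \<chi>" unfolding N_def by blast
    then obtain u1 v1 where t1: "f1 \<in> HA.Q.Z2" "g1 \<in> KA.Q.Z2" "\<chi> \<in> homA" "transgresses GH A D f1 \<chi> u1" "transgresses GK A D g1 \<chi> v1"
      unfolding transgresses_A_def by blast
    have eqs: "HA.L #>\<^bsub>H2 QH D\<^esub> H2_class QH D f = HA.L #>\<^bsub>H2 QH D\<^esub> H2_class QH D f1"
      "KA.L #>\<^bsub>H2 QK D\<^esub> H2_class QK D g = KA.L #>\<^bsub>H2 QK D\<^esub> H2_class QK D g1"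
      using fg(1) unfolding class_pair_def by simp_all
    obtain \<eta>1 u2 where e1: "\<eta>1 \<in> homA" "transgresses GH A D f (\<lambda>a. \<eta>1 a \<otimes>\<^bsub>D\<^esub> \<chi> a) u2" "\<And>z. z \<in> Z \<Longrightarrow> \<eta>1 z = \<one>\<^bsub>D\<^esub>"
      using HA.L_coset_eq[unfolded GHA, OF f t1(1) eqs(1) t1(4,3)] by blast
    obtain \<eta>2 v2 where e2: "\<eta>2 \<in> homA" "transgresses GK A D g (\<lambda>a. \<eta>2 a \<otimes>\<^bsub>D\<^esub> \<chi> a) v2" "\<And>z. z \<in> Z \<Longrightarrow> \<eta>2 z = \<one>\<^bsub>D\<^esub>"
      using KA.L_coset_eq[unfolded GKA, OF g t1(2) eqs(2) t1(5,3)] by blast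
    \<comment> \<open>The characters known so far, \<open>\<eta>1 \<chi>\<close> and
      \<open>\<eta>2 \<chi>\<close>, need not agree on \<open>A\<close>; they agree on
      \<open>Z\<close>, which is enough.\<close>
    obtain \<xi> u v where x: "\<xi> \<in> homA" "transgresses GH A D f \<xi> u" "transgresses GK A D g \<xi> v"
      using match_characters[OF f e1(2) g e2(2) hom_mult_closed[OF A_group D.comm_group_axioms e1(1) t1(3)]
          hom_mult_closed[OF A_group D.comm_group_axioms e2(1) t1(3)]] e1(3) e2(3) by auto
    note uD = H_transgressesD[OF x(2)] and vD = K_transgressesD[OF x(3)]
    have "\<exists>w. \<forall>h\<in>H. \<forall>k\<in>K. w (h \<otimes>\<^bsub>G\<^esub> k) = u h \<otimes>\<^bsub>D\<^esub> v k"
    proof (rule glue)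
      fix h k a assume c: "h \<in> H" "k \<in> K" "a \<in> A"
      have "a \<otimes>\<^bsub>G\<^esub> k = k \<otimes>\<^bsub>G\<^esub> a" using c commute by blast
      then show "u (h \<otimes>\<^bsub>G\<^esub> a) \<otimes>\<^bsub>D\<^esub> v k = u h \<otimes>\<^bsub>D\<^esub> v (a \<otimes>\<^bsub>G\<^esub> k)"
        using c uD vD homA_closed[OF x(1) c(3)] by (simp add: D.m_ac)
    qed
    then obtain w where w: "\<And>h k. h \<in> H \<Longrightarrow> k \<in> K \<Longrightarrow> w (h \<otimes>\<^bsub>G\<^esub> k) = u h \<otimes>\<^bsub>D\<^esub> v k" by blast
    have b0: "\<beta> (A #>\<^bsub>G\<^esub> h) (A #>\<^bsub>G\<^esub> k) = \<one>\<^bsub>D\<^esub>" if "h \<in> H" "k \<in> K" for h k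
      using asm bimult_ab_tens[OF HA.Q.P.is_group KA.Q.P.is_group] cosets_carrier that
      unfolding bimult_def \<beta>_def by blast
    have "cobounds G D F w"
    proof (rule GG.coboundsI)
      show "w \<in> carrier G \<rightarrow> carrier D"
      proof
        fix x assume "x \<in> carrier G"
        then obtain h k where "h \<in> H" "k \<in> K" "x = h \<otimes>\<^bsub>G\<^esub> k" using HK_cases by blast
        then show "w x \<in> carrier D" using w uD(1) vD(1) by simp
      qed
      fix x y assume "x \<in> carrier G" "y \<in> carrier G"
      then obtain h k h' k' where c: "h \<in> H" "k \<in> K" "x = h \<otimes>\<^bsub>G\<^esub> k" "h' \<in> H" "k' \<in> K" "y = h' \<otimes>\<^bsub>G\<^esub> k'"
        by (elim HK_cases)
      have cH: "h \<otimes>\<^bsub>G\<^esub> h' \<in> H" and cK: "k \<otimes>\<^bsub>G\<^esub> k' \<in> K" using c by auto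
      have "F (x, y) \<otimes>\<^bsub>D\<^esub> w (x \<otimes>\<^bsub>G\<^esub> y)
          = (f (A #>\<^bsub>G\<^esub> h, A #>\<^bsub>G\<^esub> h') \<otimes>\<^bsub>D\<^esub> g (A #>\<^bsub>G\<^esub> k, A #>\<^bsub>G\<^esub> k')) \<otimes>\<^bsub>D\<^esub> (u (h \<otimes>\<^bsub>G\<^esub> h') \<otimes>\<^bsub>D\<^esub> v (k \<otimes>\<^bsub>G\<^esub> k'))"
        unfolding c(3,6) Fx[OF c(1,2,4,5)] HK_mult[OF c(1,2,4,5)] w[OF cH cK] b0[OF c(1,5)]
        using fc[OF c(1,4)] gc[OF c(2,5)] by simp
      also have "\<dots> = (f (A #>\<^bsub>G\<^esub> h, A #>\<^bsub>G\<^esub> h') \<otimes>\<^bsub>D\<^esub> u (h \<otimes>\<^bsub>G\<^esub> h')) \<otimes>\<^bsub>D\<^esub> (g (A #>\<^bsub>G\<^esub> k, A #>\<^bsub>G\<^esub> k') \<otimes>\<^bsub>D\<^esub> v (k \<otimes>\<^bsub>G\<^esub> k'))"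
        by (rule D.mult_mult_swap) (use fc[OF c(1,4)] gc[OF c(2,5)] uD(1)[OF cH] vD(1)[OF cK] in simp_all)
      also have "\<dots> = (u h \<otimes>\<^bsub>D\<^esub> u h') \<otimes>\<^bsub>D\<^esub> (v k \<otimes>\<^bsub>D\<^esub> v k')" using uD(2)[OF c(1,4)] vD(2)[OF c(2,5)] by simp
      also have "\<dots> = (u h \<otimes>\<^bsub>D\<^esub> v k) \<otimes>\<^bsub>D\<^esub> (u h' \<otimes>\<^bsub>D\<^esub> v k')"
        by (rule D.mult_mult_swap) (use uD(1) vD(1) c in simp_all)
      finally show "F (x, y) \<otimes>\<^bsub>D\<^esub> w (x \<otimes>\<^bsub>G\<^esub> y) = w x \<otimes>\<^bsub>D\<^esub> w y" unfolding c(3,6) w[OF c(1,2)] w[OF c(4,5)] .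
    qed
    then show "\<exists>w. cobounds G D F w" by blast
  qed
qed

lemma product_cocycle_div:
  assumes "f \<in> HA.Q.Z2" "g \<in> KA.Q.Z2" "f' \<in> HA.Q.Z2" "g' \<in> KA.Q.Z2"
    and \<theta>: "\<theta> \<in> carrier (hom_group T D)" "\<theta>' \<in> carrier (hom_group T D)"
    and F: "product_cocycle f g \<theta> F" "product_cocycle f' g' \<theta>' F'"
  shows "product_cocycle (f \<otimes>\<^bsub>cocycle_group QH D\<^esub> inv\<^bsub>cocycle_group QH D\<^esub> f') (g \<otimes>\<^bsub>cocycle_group QK D\<^esub> inv\<^bsub>cocycle_group QK D\<^esub> g')
    (\<theta> \<otimes>\<^bsub>hom_group T D\<^esub> inv\<^bsub>hom_group T D\<^esub> \<theta>') (F \<otimes>\<^bsub>cocycle_group G D\<^esub> inv\<^bsub>cocycle_group G D\<^esub> F')"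
proof -
  have FZ: "F \<in> GG.Z2" "F' \<in> GG.Z2" using F by (simp_all add: product_cocycle_def)
  interpret T: comm_group T by (rule comm_group_ab_tensor[OF HA.Q.P.is_group KA.Q.P.is_group])
  show ?thesis unfolding product_cocycle_def
  proof (intro conjI ballI)
    show "F \<otimes>\<^bsub>cocycle_group G D\<^esub> inv\<^bsub>cocycle_group G D\<^esub> F' \<in> GG.Z2" using FZ by simp
    fix h k h' k' assume c: "h \<in> H" "k \<in> K" "h' \<in> H" "k' \<in> K"
    let ?a = "A #>\<^bsub>G\<^esub> h" and ?b = "A #>\<^bsub>G\<^esub> k" and ?a' = "A #>\<^bsub>G\<^esub> h'" and ?b' = "A #>\<^bsub>G\<^esub> k'"
    note m = cosets_carrier(1)[OF c(1)] cosets_carrier(1)[OF c(3)] cosets_carrier(2)[OF c(2)] cosets_carrier(2)[OF c(4)]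
    have t: "ab_tens QH QK ?a ?b' \<in> carrier T"
      using bimult_ab_tens[OF HA.Q.P.is_group KA.Q.P.is_group] m unfolding bimult_def by blast
    note cl = HA.Q.Z2_closed[OF assms(1) m(1,2)] HA.Q.Z2_closed[OF assms(3) m(1,2)]
      KA.Q.Z2_closed[OF assms(2) m(3,4)] KA.Q.Z2_closed[OF assms(4) m(3,4)]
      hom_group_closed[OF T.is_group D.comm_group_axioms \<theta>(1) t] hom_group_closed[OF T.is_group D.comm_group_axioms \<theta>(2) t]
    have Fe: "F (h \<otimes>\<^bsub>G\<^esub> k, h' \<otimes>\<^bsub>G\<^esub> k') = f (?a, ?a') \<otimes>\<^bsub>D\<^esub> g (?b, ?b') \<otimes>\<^bsub>D\<^esub> \<theta> (ab_tens QH QK ?a ?b')"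
      "F' (h \<otimes>\<^bsub>G\<^esub> k, h' \<otimes>\<^bsub>G\<^esub> k') = f' (?a, ?a') \<otimes>\<^bsub>D\<^esub> g' (?b, ?b') \<otimes>\<^bsub>D\<^esub> \<theta>' (ab_tens QH QK ?a ?b')"
      using F c unfolding product_cocycle_def by blast+
    show "(F \<otimes>\<^bsub>cocycle_group G D\<^esub> inv\<^bsub>cocycle_group G D\<^esub> F') (h \<otimes>\<^bsub>G\<^esub> k, h' \<otimes>\<^bsub>G\<^esub> k') =
      (f \<otimes>\<^bsub>cocycle_group QH D\<^esub> inv\<^bsub>cocycle_group QH D\<^esub> f') (?a, ?a') \<otimes>\<^bsub>D\<^esub>
      (g \<otimes>\<^bsub>cocycle_group QK D\<^esub> inv\<^bsub>cocycle_group QK D\<^esub> g') (?b, ?b') \<otimes>\<^bsub>D\<^esub>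
      (\<theta> \<otimes>\<^bsub>hom_group T D\<^esub> inv\<^bsub>hom_group T D\<^esub> \<theta>') (ab_tens QH QK ?a ?b')"
      unfolding GG.div_cocycle_group[OF FZ HK_closed[OF c(1,2)] HK_closed[OF c(3,4)]]
        HA.Q.div_cocycle_group[OF assms(1,3) m(1,2)] KA.Q.div_cocycle_group[OF assms(2,4) m(3,4)]
        hom_group_div_apply[OF T.is_group D.comm_group_axioms \<theta> t] Fe
      using cl by (simp add: D.div_mult_div)
  qed
qed

text \<open>The relation admits every choice of \<open>f\<close>, \<open>g\<close>,
  \<open>\<theta>\<close> and \<open>F\<close>. That the class depends only on the coset of
  \<open>N\<close> and on \<open>\<theta>\<close>, and determines both, is the coboundary criterion
  for \<open>product_cocycle\<close> read in its two directions.\<close>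

lemma embedding_into_H2: "embeds ((S Mod N) \<times>\<times> hom_group T D) (H2 G D)"
proof -
  interpret Nn: normal N S by (rule S.subgroup_imp_normal[OF N_subgroup])
  interpret T: comm_group T by (rule comm_group_ab_tensor[OF HA.Q.P.is_group KA.Q.P.is_group])
  let ?W = "hom_group T D"
  interpret W: comm_group ?W by (rule comm_group_hom_group[OF T.is_group D.comm_group_axioms])
  interpret SN: group "S Mod N" by (rule Nn.factorgroup_is_group)
  define R where "R y c \<longleftrightarrow> (\<exists>f\<in>HA.Q.Z2. \<exists>g\<in>KA.Q.Z2. \<exists>\<theta>\<in>carrier ?W. \<exists>F. product_cocycle f g \<theta> F \<and>
      y = (N #>\<^bsub>S\<^esub> class_pair f g, \<theta>) \<and> c = H2_class G D F)" for y c
  show ?thesis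
  proof (rule embeds_by_relation[of _ _ R])
    show "group ((S Mod N) \<times>\<times> ?W)" by (rule DirProd_group[OF SN.is_group W.is_group])
    show "group (H2 G D)" by (rule GG.H.is_group)
  next
    fix y assume "y \<in> carrier ((S Mod N) \<times>\<times> ?W)"
    then obtain s \<theta> where y: "s \<in> carrier S" "\<theta> \<in> carrier ?W" "y = (N #>\<^bsub>S\<^esub> s, \<theta>)"
      unfolding carrier_DirProd carrier_FactGroup by blast
    obtain f g where fg: "f \<in> HA.Q.Z2" "g \<in> KA.Q.Z2" "s = class_pair f g" using S_cases[OF y(1)] .
    have "\<theta> \<in> hom T D" using y(2) by (simp add: hom_group_carrier_iff)
    then obtain F where "product_cocycle f g \<theta> F" using product_cocycle_exists[OF fg(1,2)] by blast
    then have "R y (H2_class G D F)" unfolding R_def using y fg by blast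
    then show "\<exists>c. R y c" by blast
  next
    fix y c assume "R y c"
    then obtain f g \<theta> F where y: "f \<in> HA.Q.Z2" "g \<in> KA.Q.Z2" "\<theta> \<in> carrier ?W" "product_cocycle f g \<theta> F"
      "y = (N #>\<^bsub>S\<^esub> class_pair f g, \<theta>)" "c = H2_class G D F" unfolding R_def by blast
    have "N #>\<^bsub>S\<^esub> class_pair f g \<in> carrier (S Mod N)"
      unfolding carrier_FactGroup using class_pair_carrier[OF y(1,2)] by (rule imageI)
    moreover have "F \<in> GG.Z2" using y(4) by (simp add: product_cocycle_def)
    ultimately show "y \<in> carrier ((S Mod N) \<times>\<times> ?W) \<and> c \<in> carrier (H2 G D)"
      unfolding y(5,6) carrier_DirProd using y(3) GG.H2_class_carrier by blast
  next
    fix y c y' c' assume r: "R y c" "R y' c'"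
    obtain f g \<theta> F where y: "f \<in> HA.Q.Z2" "g \<in> KA.Q.Z2" "\<theta> \<in> carrier ?W" "product_cocycle f g \<theta> F"
      "y = (N #>\<^bsub>S\<^esub> class_pair f g, \<theta>)" "c = H2_class G D F" using r(1) unfolding R_def by blast
    obtain f' g' \<theta>' F' where y': "f' \<in> HA.Q.Z2" "g' \<in> KA.Q.Z2" "\<theta>' \<in> carrier ?W" "product_cocycle f' g' \<theta>' F'"
      "y' = (N #>\<^bsub>S\<^esub> class_pair f' g', \<theta>')" "c' = H2_class G D F'" using r(2) unfolding R_def by blast
    have FZ: "F \<in> GG.Z2" "F' \<in> GG.Z2" using y(4) y'(4) by (simp_all add: product_cocycle_def)
    have m: "N #>\<^bsub>S\<^esub> class_pair f' g' \<in> carrier (S Mod N)"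
      unfolding carrier_FactGroup using class_pair_carrier[OF y'(1,2)] by (rule imageI)
    have e: "y \<otimes>\<^bsub>(S Mod N) \<times>\<times> ?W\<^esub> inv\<^bsub>(S Mod N) \<times>\<times> ?W\<^esub> y' =
       (N #>\<^bsub>S\<^esub> class_pair (f \<otimes>\<^bsub>cocycle_group QH D\<^esub> inv\<^bsub>cocycle_group QH D\<^esub> f') (g \<otimes>\<^bsub>cocycle_group QK D\<^esub> inv\<^bsub>cocycle_group QK D\<^esub> g'),
        \<theta> \<otimes>\<^bsub>?W\<^esub> inv\<^bsub>?W\<^esub> \<theta>')"
      unfolding y(5) y'(5) inv_DirProd[OF SN.is_group W.is_group m y'(3)] mult_DirProd
        Nn.rcos_div[OF class_pair_carrier[OF y(1,2)] class_pair_carrier[OF y'(1,2)]] class_pair_div[OF y(1,2) y'(1,2)] ..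
    show "R (y \<otimes>\<^bsub>(S Mod N) \<times>\<times> ?W\<^esub> inv\<^bsub>(S Mod N) \<times>\<times> ?W\<^esub> y') (c \<otimes>\<^bsub>H2 G D\<^esub> inv\<^bsub>H2 G D\<^esub> c')"
      unfolding e y(6) y'(6) GG.H2_class_div[OF FZ] R_def
    proof (intro bexI exI conjI)
      show "product_cocycle (f \<otimes>\<^bsub>cocycle_group QH D\<^esub> inv\<^bsub>cocycle_group QH D\<^esub> f') (g \<otimes>\<^bsub>cocycle_group QK D\<^esub> inv\<^bsub>cocycle_group QK D\<^esub> g')
        (\<theta> \<otimes>\<^bsub>?W\<^esub> inv\<^bsub>?W\<^esub> \<theta>') (F \<otimes>\<^bsub>cocycle_group G D\<^esub> inv\<^bsub>cocycle_group G D\<^esub> F')"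
        by (rule product_cocycle_div[OF y(1,2) y'(1,2) y(3) y'(3) y(4) y'(4)])
    qed (use y y' in simp_all)
  next
    fix y c assume "R y c"
    then obtain f g \<theta> F where y: "f \<in> HA.Q.Z2" "g \<in> KA.Q.Z2" "\<theta> \<in> carrier ?W" "product_cocycle f g \<theta> F"
      "y = (N #>\<^bsub>S\<^esub> class_pair f g, \<theta>)" "c = H2_class G D F" unfolding R_def by blast
    have FZ: "F \<in> GG.Z2" using y(4) by (simp add: product_cocycle_def)
    have \<theta>: "\<theta> \<in> hom T D" using y(3) by (simp add: hom_group_carrier_iff)
    show "y = \<one>\<^bsub>(S Mod N) \<times>\<times> ?W\<^esub> \<longleftrightarrow> c = \<one>\<^bsub>H2 G D\<^esub>"
      unfolding y(5,6) GG.H2_class_one_iff[OF FZ] product_cocycle_trivial_iff[OF y(1,2) \<theta> y(4)]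
        hom_group_one_iff[OF T.is_group D.comm_group_axioms y(3), symmetric]
        Nn.rcos_eq_self_iff[OF class_pair_carrier[OF y(1,2)], symmetric] by simp
  qed
qed

subsection \<open>The embedding of the cohomology of a central product\<close>

lemma GHZ: "GH\<lparr>carrier := Z\<rparr> = G\<lparr>carrier := Z\<rparr>" and GKZ: "GK\<lparr>carrier := Z\<rparr> = G\<lparr>carrier := Z\<rparr>"
  by simp_all

abbreviation "homZ \<equiv> hom (G\<lparr>carrier := Z\<rparr>) D"
abbreviation "RH \<equiv> GH Mod Z"
abbreviation "RK \<equiv> GK Mod Z"
abbreviation "S' \<equiv> H2 RH D \<times>\<times> H2 RK D"

section \<open>Pairs of transgressions of a common character of \<open>Z\<close>\<close>

definition transgresses_Z where
  "transgresses_Z f g \<chi> \<longleftrightarrow> f \<in> HA.Cq.Q.Z2 \<and> g \<in> KA.Cq.Q.Z2 \<and> \<chi> \<in> homZ \<and> (\<exists>u. transgresses GH Z D f \<chi> u) \<and> (\<exists>v. transgresses GK Z D g \<chi> v)"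

definition N' where "N' = {(H2_class RH D f, H2_class RK D g) | f g. \<exists>\<chi>. transgresses_Z f g \<chi>}"

interpretation S': comm_group S'
  by (rule DirProd_comm_group[OF HA.Cq.Q.H.comm_group_axioms KA.Cq.Q.H.comm_group_axioms])

lemma S'_div:
  assumes "f \<in> HA.Cq.Q.Z2" "g \<in> KA.Cq.Q.Z2" "f' \<in> HA.Cq.Q.Z2" "g' \<in> KA.Cq.Q.Z2"
  shows "(H2_class RH D f, H2_class RK D g) \<otimes>\<^bsub>S'\<^esub> inv\<^bsub>S'\<^esub> (H2_class RH D f', H2_class RK D g') =
     (H2_class RH D (f \<otimes>\<^bsub>cocycle_group RH D\<^esub> inv\<^bsub>cocycle_group RH D\<^esub> f'), H2_class RK D (g \<otimes>\<^bsub>cocycle_group RK D\<^esub> inv\<^bsub>cocycle_group RK D\<^esub> g'))"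
  unfolding inv_DirProd[OF HA.Cq.Q.H.is_group KA.Cq.Q.H.is_group HA.Cq.Q.H2_class_carrier[OF assms(3)] KA.Cq.Q.H2_class_carrier[OF assms(4)]]
    mult_DirProd HA.Cq.Q.H2_class_div[OF assms(1,3)] KA.Cq.Q.H2_class_div[OF assms(2,4)] ..

lemma transgresses_Z_div:
  assumes "transgresses_Z f g \<chi>" "transgresses_Z f' g' \<chi>'"
  shows "transgresses_Z (f \<otimes>\<^bsub>cocycle_group RH D\<^esub> inv\<^bsub>cocycle_group RH D\<^esub> f') (g \<otimes>\<^bsub>cocycle_group RK D\<^esub> inv\<^bsub>cocycle_group RK D\<^esub> g')
     (\<lambda>a. \<chi> a \<otimes>\<^bsub>D\<^esub> inv\<^bsub>D\<^esub> \<chi>' a)"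
proof -
  from assms(1) obtain u v where 1: "f \<in> HA.Cq.Q.Z2" "g \<in> KA.Cq.Q.Z2" "\<chi> \<in> homZ" "transgresses GH Z D f \<chi> u" "transgresses GK Z D g \<chi> v"
    unfolding transgresses_Z_def by blast
  from assms(2) obtain u' v' where 2: "f' \<in> HA.Cq.Q.Z2" "g' \<in> KA.Cq.Q.Z2" "\<chi>' \<in> homZ" "transgresses GH Z D f' \<chi>' u'" "transgresses GK Z D g' \<chi>' v'"
    unfolding transgresses_Z_def by blast
  show ?thesis unfolding transgresses_Z_def
    using 1 2 hom_div_closed[OF GZ_group D.comm_group_axioms 1(3) 2(3)]
      HA.Cq.transgresses_div[unfolded GHZ, OF 1(1) 2(1) 1(4) 2(4) 1(3) 2(3)] KA.Cq.transgresses_div[unfolded GKZ, OF 1(2) 2(2) 1(5) 2(5) 1(3) 2(3)]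
    by (intro conjI exI) (assumption | simp)+
qed

lemma transgresses_Z_exists:
  assumes "\<chi> \<in> homZ" shows "\<exists>f g. transgresses_Z f g \<chi>"
  using HA.Cq.transgresses_exists[unfolded GHZ, OF assms] KA.Cq.transgresses_exists[unfolded GKZ, OF assms] assms
  unfolding transgresses_Z_def by blast

lemma N'_subgroup: "subgroup N' S'"
proof (rule S'.subgroup_by_div)
  show "N' \<subseteq> carrier S'"
    unfolding N'_def transgresses_Z_def carrier_DirProd using HA.Cq.Q.H2_class_carrier KA.Cq.Q.H2_class_carrier by blast
  have "(\<lambda>_. \<one>\<^bsub>D\<^esub>) \<in> homZ" by (simp add: hom_def)
  then obtain f g where "transgresses_Z f g (\<lambda>_. \<one>\<^bsub>D\<^esub>)" using transgresses_Z_exists by blast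
  then have "(H2_class RH D f, H2_class RK D g) \<in> N'" unfolding N'_def by blast
  then show "N' \<noteq> {}" by blast
  fix x y assume "x \<in> N'" "y \<in> N'"
  then obtain f g \<chi> f' g' \<chi>' where xy: "x = (H2_class RH D f, H2_class RK D g)" "transgresses_Z f g \<chi>"
    "y = (H2_class RH D f', H2_class RK D g')" "transgresses_Z f' g' \<chi>'"
    unfolding N'_def by blast
  have "x \<otimes>\<^bsub>S'\<^esub> inv\<^bsub>S'\<^esub> y = (H2_class RH D (f \<otimes>\<^bsub>cocycle_group RH D\<^esub> inv\<^bsub>cocycle_group RH D\<^esub> f'),
      H2_class RK D (g \<otimes>\<^bsub>cocycle_group RK D\<^esub> inv\<^bsub>cocycle_group RK D\<^esub> g'))"
    unfolding xy(1,3) by (rule S'_div) (use xy in \<open>simp_all add: transgresses_Z_def\<close>)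
  then show "x \<otimes>\<^bsub>S'\<^esub> inv\<^bsub>S'\<^esub> y \<in> N'" unfolding N'_def using transgresses_Z_div[OF xy(2,4)] by blast
qed

text \<open>\<open>Z\<close> lies in \<open>H'\<close> and in \<open>K'\<close>, so no nontrivial
  character of \<open>Z\<close> extends to \<open>H\<close> or to \<open>K\<close>, and
  transgression is injective. Already one component of a pair determines the character, which is why
  \<open>N'\<close> sits in the direct sum itself.\<close>

lemma N'_iso: "S'\<lparr>carrier := N'\<rparr> \<cong> hom_group (G\<lparr>carrier := Z\<rparr>) D"
proof -
  let ?W = "hom_group (G\<lparr>carrier := Z\<rparr>) D"
  interpret W: comm_group ?W by (rule comm_group_hom_group[OF GZ_group D.comm_group_axioms])
  interpret SN: group "S'\<lparr>carrier := N'\<rparr>" by (rule S'.subgroup_imp_group[OF N'_subgroup])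
  define R where "R n \<theta> \<longleftrightarrow> \<theta> \<in> carrier ?W \<and> (\<exists>f g. n = (H2_class RH D f, H2_class RK D g) \<and> transgresses_Z f g \<theta>)" for n \<theta>
  have RN: "R n \<theta> \<Longrightarrow> n \<in> N'" for n \<theta> unfolding R_def N'_def by blast
  have cong: "transgresses_Z f g \<eta>" if t: "transgresses_Z f g \<chi>" and \<eta>: "\<eta> \<in> homZ" and e: "\<And>z. z \<in> Z \<Longrightarrow> \<chi> z = \<eta> z" for f g \<chi> \<eta>
    using t HA.Cq.transgresses_cong[of f \<chi> _ \<eta>, OF _ e] KA.Cq.transgresses_cong[of g \<chi> _ \<eta>, OF _ e] \<eta> unfolding transgresses_Z_def by blast
  show ?thesis
  proof (rule iso_by_relation[of _ _ R])
    show "group (S'\<lparr>carrier := N'\<rparr>)" by (rule SN.is_group)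
    show "group ?W" by (rule W.is_group)
  next
    fix n assume "n \<in> carrier (S'\<lparr>carrier := N'\<rparr>)"
    then obtain f g \<chi> where n: "n = (H2_class RH D f, H2_class RK D g)" "transgresses_Z f g \<chi>" unfolding N'_def by auto
    have \<chi>: "\<chi> \<in> homZ" using n(2) by (simp add: transgresses_Z_def)
    have r: "restrict \<chi> Z \<in> carrier ?W" using restrict_in_hom_group[OF GZ_group D.comm_group_axioms \<chi>] by simp
    then have "transgresses_Z f g (restrict \<chi> Z)" using cong[OF n(2), of "restrict \<chi> Z"] by (simp add: hom_group_carrier_iff)
    then have "R n (restrict \<chi> Z)" unfolding R_def using n r by blast
    then show "\<exists>\<theta>. R n \<theta>" by blast
  next
    fix n \<theta> assume "R n \<theta>"
    then show "n \<in> carrier (S'\<lparr>carrier := N'\<rparr>) \<and> \<theta> \<in> carrier ?W" using RN by (simp add: R_def)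
  next
    fix n \<theta> n' \<theta>' assume r: "R n \<theta>" "R n' \<theta>'"
    obtain f g where n: "\<theta> \<in> carrier ?W" "n = (H2_class RH D f, H2_class RK D g)" "transgresses_Z f g \<theta>"
      using r(1) unfolding R_def by blast
    obtain f' g' where n': "\<theta>' \<in> carrier ?W" "n' = (H2_class RH D f', H2_class RK D g')" "transgresses_Z f' g' \<theta>'"
      using r(2) unfolding R_def by blast
    have m: "n \<otimes>\<^bsub>S'\<lparr>carrier := N'\<rparr>\<^esub> inv\<^bsub>S'\<lparr>carrier := N'\<rparr>\<^esub> n' = n \<otimes>\<^bsub>S'\<^esub> inv\<^bsub>S'\<^esub> n'"
      using S'.m_inv_consistent[OF N'_subgroup RN[OF r(2)]] by simp
    have d: "n \<otimes>\<^bsub>S'\<^esub> inv\<^bsub>S'\<^esub> n' = (H2_class RH D (f \<otimes>\<^bsub>cocycle_group RH D\<^esub> inv\<^bsub>cocycle_group RH D\<^esub> f'),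
      H2_class RK D (g \<otimes>\<^bsub>cocycle_group RK D\<^esub> inv\<^bsub>cocycle_group RK D\<^esub> g'))"
      unfolding n(2) n'(2) by (rule S'_div) (use n n' in \<open>simp_all add: transgresses_Z_def\<close>)
    have w: "\<theta> \<otimes>\<^bsub>?W\<^esub> inv\<^bsub>?W\<^esub> \<theta>' \<in> carrier ?W" using n(1) n'(1) by simp
    have "transgresses_Z (f \<otimes>\<^bsub>cocycle_group RH D\<^esub> inv\<^bsub>cocycle_group RH D\<^esub> f') (g \<otimes>\<^bsub>cocycle_group RK D\<^esub> inv\<^bsub>cocycle_group RK D\<^esub> g') (\<theta> \<otimes>\<^bsub>?W\<^esub> inv\<^bsub>?W\<^esub> \<theta>')"
      by (rule cong[OF transgresses_Z_div[OF n(3) n'(3)]])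
        (use w hom_group_div_apply[OF GZ_group D.comm_group_axioms n(1) n'(1)] in \<open>simp_all add: hom_group_carrier_iff\<close>)
    then show "R (n \<otimes>\<^bsub>S'\<lparr>carrier := N'\<rparr>\<^esub> inv\<^bsub>S'\<lparr>carrier := N'\<rparr>\<^esub> n') (\<theta> \<otimes>\<^bsub>?W\<^esub> inv\<^bsub>?W\<^esub> \<theta>')"
      unfolding m d R_def using w by blast
  next
    fix n \<theta> assume "R n \<theta>"
    then obtain f g where n: "\<theta> \<in> carrier ?W" "n = (H2_class RH D f, H2_class RK D g)" "transgresses_Z f g \<theta>" unfolding R_def by blast
    then obtain u v where fg: "f \<in> HA.Cq.Q.Z2" "g \<in> KA.Cq.Q.Z2" "\<theta> \<in> homZ" "transgresses GH Z D f \<theta> u" "transgresses GK Z D g \<theta> v"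
      unfolding transgresses_Z_def by blast
    have int: "Z \<inter> derived GH (carrier GH) = Z" "Z \<inter> derived GK (carrier GK) = Z"
      unfolding derived_GH derived_GK by blast+
    have "n = \<one>\<^bsub>S'\<^esub> \<longleftrightarrow> (\<forall>z\<in>Z. \<theta> z = \<one>\<^bsub>D\<^esub>)"
      unfolding n(2) one_DirProd prod.inject HA.Cq.Q.H2_class_one_iff[OF fg(1)] KA.Cq.Q.H2_class_one_iff[OF fg(2)]
        HA.Cq.transgresses_coboundary_iff[unfolded GHZ, OF divisible fg(1,4,3)]
        KA.Cq.transgresses_coboundary_iff[unfolded GKZ, OF divisible fg(2,5,3)] int by simp
    also have "\<dots> \<longleftrightarrow> \<theta> = \<one>\<^bsub>?W\<^esub>"
      using hom_group_one_iff[OF GZ_group D.comm_group_axioms n(1)] by simp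
    finally show "n = \<one>\<^bsub>S'\<lparr>carrier := N'\<rparr>\<^esub> \<longleftrightarrow> \<theta> = \<one>\<^bsub>?W\<^esub>" by simp
  next
    fix \<theta> assume \<theta>: "\<theta> \<in> carrier ?W"
    then have "\<theta> \<in> homZ" by (simp add: hom_group_carrier_iff)
    then obtain f g where "transgresses_Z f g \<theta>" using transgresses_Z_exists by blast
    then have "R (H2_class RH D f, H2_class RK D g) \<theta>" unfolding R_def using \<theta> by blast
    then show "\<exists>n. R n \<theta>" by blast
  qed
qed

section \<open>Cocycles of \<open>G\<close> described on \<open>H\<close>, on \<open>K\<close> and
  by a commutator pairing\<close>

abbreviation "T' \<equiv> ab_tensor GH GK"

text \<open>Unlike \<open>product_cocycle\<close>, this does not determine \<open>F\<close>: mixed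
  values enter only through their antisymmetrization. The coboundary criterion below shows that the
  class is determined nevertheless. The data are not independent: for \<open>a\<close> in
  \<open>A\<close> and \<open>k\<close> in \<open>K\<close> the pairing is dictated by
  \<open>g\<close>, so in general not every triple occurs.\<close>

definition adapted_cocycle where
  "adapted_cocycle f g \<theta> F \<longleftrightarrow> F \<in> GG.Z2 \<and> (\<forall>h\<in>H. \<forall>h'\<in>H. F (h, h') = f (Z #>\<^bsub>G\<^esub> h, Z #>\<^bsub>G\<^esub> h'))
     \<and> (\<forall>k\<in>K. \<forall>k'\<in>K. F (k, k') = g (Z #>\<^bsub>G\<^esub> k, Z #>\<^bsub>G\<^esub> k'))
     \<and> (\<forall>h\<in>H. \<forall>k\<in>K. \<theta> (ab_tens GH GK h k) = F (h, k) \<otimes>\<^bsub>D\<^esub> inv\<^bsub>D\<^esub> F (k, h))"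

lemma commutator_pairing:
  assumes F: "F \<in> GG.Z2"
  shows "bimult GH GK D (\<lambda>h k. F (h, k) \<otimes>\<^bsub>D\<^esub> inv\<^bsub>D\<^esub> F (k, h))"
  unfolding bimult_def
proof (intro conjI ballI)
  fix h k assume c: "h \<in> carrier GH" "k \<in> carrier GK"
  then have cc: "h \<in> carrier G" "k \<in> carrier G" "h \<in> H" "k \<in> K" using H.mem_carrier K.mem_carrier by auto
  show "F (h, k) \<otimes>\<^bsub>D\<^esub> inv\<^bsub>D\<^esub> F (k, h) \<in> carrier D" using GG.Z2_closed[OF F] cc by simp
next
  fix h h' k assume "h \<in> carrier GH" "h' \<in> carrier GH" "k \<in> carrier GK"
  then have c: "h \<in> H" "h' \<in> H" "k \<in> K" by auto
  show "F (h \<otimes>\<^bsub>GH\<^esub> h', k) \<otimes>\<^bsub>D\<^esub> inv\<^bsub>D\<^esub> F (k, h \<otimes>\<^bsub>GH\<^esub> h')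
     = F (h, k) \<otimes>\<^bsub>D\<^esub> inv\<^bsub>D\<^esub> F (k, h) \<otimes>\<^bsub>D\<^esub> (F (h', k) \<otimes>\<^bsub>D\<^esub> inv\<^bsub>D\<^esub> F (k, h'))"
    using GG.commutator_pairing_mult(1)[OF F H.mem_carrier[OF c(1)] H.mem_carrier[OF c(2)] K.mem_carrier[OF c(3)]
        commute[OF c(1,3)] commute[OF c(2,3)]] by simp
next
  fix h k k' assume "h \<in> carrier GH" "k \<in> carrier GK" "k' \<in> carrier GK"
  then have c: "h \<in> H" "k \<in> K" "k' \<in> K" by auto
  show "F (h, k \<otimes>\<^bsub>GK\<^esub> k') \<otimes>\<^bsub>D\<^esub> inv\<^bsub>D\<^esub> F (k \<otimes>\<^bsub>GK\<^esub> k', h)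
     = F (h, k) \<otimes>\<^bsub>D\<^esub> inv\<^bsub>D\<^esub> F (k, h) \<otimes>\<^bsub>D\<^esub> (F (h, k') \<otimes>\<^bsub>D\<^esub> inv\<^bsub>D\<^esub> F (k', h))"
    using GG.commutator_pairing_mult(2)[OF F K.mem_carrier[OF c(2)] K.mem_carrier[OF c(3)] H.mem_carrier[OF c(1)]
        commute[OF c(1,2), symmetric] commute[OF c(1,3), symmetric]] by simp
qed

text \<open>The pairing of \<open>H\<close> and \<open>K\<close> is trivial on \<open>H \<times> K'\<close> and on \<open>H' \<times> K\<close>, so
  \<open>Z = H' \<inter> K'\<close> stays central in every central extension of \<open>G\<close>.\<close>

lemma cocycle_symmetric_on_Z:
  assumes F: "F \<in> GG.Z2" and x: "x \<in> carrier G" and z: "z \<in> Z"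
  shows "F (x, z) = F (z, x)"
proof -
  note bm = commutator_pairing[OF F]
  obtain h k where hk: "h \<in> H" "k \<in> K" "x = h \<otimes>\<^bsub>G\<^esub> k" using HK_cases[OF x] .
  have zA: "z \<in> H" "z \<in> K" and zc: "z \<in> carrier G" using z Z_A H.mem_carrier by auto
  note cc = H.mem_carrier[OF hk(1)] K.mem_carrier[OF hk(2)] zc
  have eqI: "a = b" if "a \<otimes>\<^bsub>D\<^esub> inv\<^bsub>D\<^esub> b = \<one>\<^bsub>D\<^esub>" "a \<in> carrier D" "b \<in> carrier D" for a b
    using that D.div_eq_iff[of "\<one>\<^bsub>D\<^esub>" a b] by simp
  have "(\<lambda>k. F (h, k) \<otimes>\<^bsub>D\<^esub> inv\<^bsub>D\<^esub> F (k, h)) \<in> hom GK D"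
    using bm hk(1) unfolding bimult_def by (intro homI) simp_all
  then have "F (h, z) \<otimes>\<^bsub>D\<^esub> inv\<^bsub>D\<^esub> F (z, h) = \<one>\<^bsub>D\<^esub>"
    using hom_trivial_on_derived[OF GKg.is_group D.comm_group_axioms, of _ z] z unfolding derived_GK by blast
  moreover have "(\<lambda>h. F (h, k) \<otimes>\<^bsub>D\<^esub> inv\<^bsub>D\<^esub> F (k, h)) \<in> hom GH D"
    using bm hk(2) unfolding bimult_def by (intro homI) simp_all
  then have "F (z, k) \<otimes>\<^bsub>D\<^esub> inv\<^bsub>D\<^esub> F (k, z) = \<one>\<^bsub>D\<^esub>"
    using hom_trivial_on_derived[OF GHg.is_group D.comm_group_axioms, of _ z] z unfolding derived_GH by blast
  then have "F (z, k) = F (k, z)" by (rule eqI) (use GG.Z2_closed[OF F] cc in simp_all)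
  \<comment> \<open>Inverted so that \<open>z\<close> stands in the second slot of both pairings, as
    multiplicativity along \<open>x = h k\<close> requires.\<close>
  then have "F (k, z) \<otimes>\<^bsub>D\<^esub> inv\<^bsub>D\<^esub> F (z, k) = \<one>\<^bsub>D\<^esub>" using GG.Z2_closed[OF F] cc by simp
  ultimately have "F (h \<otimes>\<^bsub>G\<^esub> k, z) \<otimes>\<^bsub>D\<^esub> inv\<^bsub>D\<^esub> F (z, h \<otimes>\<^bsub>G\<^esub> k) = \<one>\<^bsub>D\<^esub>"
    using GG.commutator_pairing_mult(1)[OF F cc commute[OF hk(1) zA(2)] commute[OF zA(1) hk(2), symmetric]] by simp
  then show ?thesis unfolding hk(3) by (rule eqI) (use GG.Z2_closed[OF F] cc in simp_all)
qed

text \<open>The \<open>Z\<close>-invariant representative is not itself pushed down to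
  \<open>G/Z\<close>. Its restrictions to \<open>H\<close> and \<open>K\<close> descend, and the
  mixed information is kept as its commutator pairing, a homomorphism on the tensor product by
  universality.\<close>

lemma adapted_cocycle_exists:
  assumes c: "c \<in> carrier (H2 G D)"
  shows "\<exists>f\<in>HA.Cq.Q.Z2. \<exists>g\<in>KA.Cq.Q.Z2. \<exists>\<theta>\<in>carrier (hom_group T' D). \<exists>F. adapted_cocycle f g \<theta> F \<and> c = H2_class G D F"
proof -
  obtain F0 where F0: "F0 \<in> GG.Z2" "c = H2_class G D F0" using c by (elim GG.H2_cases)
  obtain F where F: "F \<in> GG.Z2" "H2_class G D F = H2_class G D F0"
    and inv1: "\<And>x y z. x \<in> carrier G \<Longrightarrow> y \<in> carrier G \<Longrightarrow> z \<in> Z \<Longrightarrow> F (x \<otimes>\<^bsub>G\<^esub> z, y) = F (x, y)"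
    and inv2: "\<And>x y z. x \<in> carrier G \<Longrightarrow> y \<in> carrier G \<Longrightarrow> z \<in> Z \<Longrightarrow> F (x, y \<otimes>\<^bsub>G\<^esub> z) = F (x, y)"
    using GZ.invariant_representative[OF divisible F0(1) cocycle_symmetric_on_Z[OF F0(1)]] by blast
  have iH: "(\<lambda>x. x) \<in> hom GH G" by (rule homI) (simp_all add: H.mem_carrier)
  have iK: "(\<lambda>x. x) \<in> hom GK G" by (rule homI) (simp_all add: K.mem_carrier)
  have "\<exists>f\<in>HA.Cq.Q.Z2. \<forall>x\<in>carrier GH. \<forall>y\<in>carrier GH. f (Z #>\<^bsub>GH\<^esub> x, Z #>\<^bsub>GH\<^esub> y) = pullback GH (\<lambda>x. x) F (x, y)"
    by (rule HA.Cq.descend_cocycle[OF GHc.pullback_Z2[OF G.is_group iH F(1)]])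
      (use inv1 inv2 H.mem_carrier HA.Cq.B_mem in simp_all)
  then obtain f where f: "f \<in> HA.Cq.Q.Z2" "\<And>x y. x \<in> H \<Longrightarrow> y \<in> H \<Longrightarrow> f (Z #>\<^bsub>G\<^esub> x, Z #>\<^bsub>G\<^esub> y) = F (x, y)" by auto
  have "\<exists>f\<in>KA.Cq.Q.Z2. \<forall>x\<in>carrier GK. \<forall>y\<in>carrier GK. f (Z #>\<^bsub>GK\<^esub> x, Z #>\<^bsub>GK\<^esub> y) = pullback GK (\<lambda>x. x) F (x, y)"
    by (rule KA.Cq.descend_cocycle[OF GKc.pullback_Z2[OF G.is_group iK F(1)]])
      (use inv1 inv2 K.mem_carrier KA.Cq.B_mem in simp_all)
  then obtain g where g: "g \<in> KA.Cq.Q.Z2" "\<And>x y. x \<in> K \<Longrightarrow> y \<in> K \<Longrightarrow> g (Z #>\<^bsub>G\<^esub> x, Z #>\<^bsub>G\<^esub> y) = F (x, y)" by auto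
  interpret T': comm_group T' by (rule comm_group_ab_tensor[OF GHg.is_group GKg.is_group])
  obtain \<theta> where \<theta>: "\<theta> \<in> hom T' D" "\<And>h k. h \<in> H \<Longrightarrow> k \<in> K \<Longrightarrow> \<theta> (ab_tens GH GK h k) = F (h, k) \<otimes>\<^bsub>D\<^esub> inv\<^bsub>D\<^esub> F (k, h)"
    using ab_tens_universal[OF GHg.is_group GKg.is_group D.comm_group_axioms commutator_pairing[OF F(1)]] by auto
  have t: "ab_tens GH GK h k \<in> carrier T'" if "h \<in> H" "k \<in> K" for h k
    using bimult_ab_tens[OF GHg.is_group GKg.is_group] that unfolding bimult_def by simp
  have "adapted_cocycle f g (restrict \<theta> (carrier T')) F"
    unfolding adapted_cocycle_def using F(1) f(2) g(2) \<theta>(2) t by simp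
  then show ?thesis
    using f(1) g(1) restrict_in_hom_group[OF T'.is_group D.comm_group_axioms \<theta>(1)] F(2) F0(2) by blast
qed

text \<open>Trivializations of one cocycle may be multiplied by characters. Here \<open>F\<close> is
  a plain function, because a cocycle of \<open>G\<close> is not extensional over
  \<open>H x H\<close> and so is no element of the cocycle group of \<open>H\<close>.\<close>

lemma twist_cob:
  assumes "cohomology P D" and F: "\<And>x y. x \<in> carrier P \<Longrightarrow> y \<in> carrier P \<Longrightarrow> F (x, y) \<in> carrier D"
    and "cobounds P D F u" "\<psi> \<in> hom P D"
  shows "cobounds P D F (\<lambda>x. u x \<otimes>\<^bsub>D\<^esub> \<psi> x)"
proof -
  interpret P: cohomology P D by fact
  note c = P.cobounds_closed[OF assms(3)] hom_in_carrier[OF assms(4)] F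
  show ?thesis
  proof (rule P.coboundsI)
    fix x y assume xy: "x \<in> carrier P" "y \<in> carrier P"
    show "F (x, y) \<otimes>\<^bsub>D\<^esub> (u (x \<otimes>\<^bsub>P\<^esub> y) \<otimes>\<^bsub>D\<^esub> \<psi> (x \<otimes>\<^bsub>P\<^esub> y)) = u x \<otimes>\<^bsub>D\<^esub> \<psi> x \<otimes>\<^bsub>D\<^esub> (u y \<otimes>\<^bsub>D\<^esub> \<psi> y)"
      using xy P.coboundsD[OF assms(3) xy] D.mult_mult_swap[of "u x" "\<psi> x" "u y" "\<psi> y"]
      by (simp add: c hom_mult[OF assms(4)] D.m_assoc[symmetric])
  qed (use c in simp)
qed

text \<open>A trivialization amounts to a splitting of the extension given by \<open>F\<close>. The
  splittings over \<open>H\<close> and \<open>K\<close> agree on \<open>A\<close>, and by symmetry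
  of \<open>F\<close> the lifted groups commute elementwise, so their product is a splitting over
  \<open>G\<close>.\<close>

lemma glue_cobs:
  assumes F: "F \<in> GG.Z2" and sym: "\<And>h k. h \<in> H \<Longrightarrow> k \<in> K \<Longrightarrow> F (h, k) = F (k, h)"
    and u: "cobounds GH D F u" and v: "cobounds GK D F v" and uv: "\<And>a. a \<in> A \<Longrightarrow> u a = v a"
  shows "\<exists>w. cobounds G D F w"
proof -
  have uc: "u h \<in> carrier D" if "h \<in> H" for h using GHc.cobounds_closed[OF u] that by simp
  have vc: "v k \<in> carrier D" if "k \<in> K" for k using GKc.cobounds_closed[OF v] that by simp
  have uD: "F (h, h') \<otimes>\<^bsub>D\<^esub> u (h \<otimes>\<^bsub>G\<^esub> h') = u h \<otimes>\<^bsub>D\<^esub> u h'" if "h \<in> H" "h' \<in> H" for h h'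
    using GHc.coboundsD[OF u] that by simp
  have vD: "F (k, k') \<otimes>\<^bsub>D\<^esub> v (k \<otimes>\<^bsub>G\<^esub> k') = v k \<otimes>\<^bsub>D\<^esub> v k'" if "k \<in> K" "k' \<in> K" for k k'
    using GKc.coboundsD[OF v] that by simp
  note Fc = GG.Z2_closed[OF F]
  \<comment> \<open>The value is forced: it solves the coboundary equation at \<open>(h, k)\<close>.
    That it depends on the product only follows from the cocycle identity at
    \<open>(h, a, k)\<close> and from \<open>u a = v a\<close>.\<close>
  have "\<exists>w. \<forall>h\<in>H. \<forall>k\<in>K. w (h \<otimes>\<^bsub>G\<^esub> k) = (u h \<otimes>\<^bsub>D\<^esub> v k) \<otimes>\<^bsub>D\<^esub> inv\<^bsub>D\<^esub> F (h, k)"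
  proof (rule glue)
    fix h k a assume c: "h \<in> H" "k \<in> K" "a \<in> A"
    have aH: "a \<in> H" and aK: "a \<in> K" using c by auto
    have ha: "h \<otimes>\<^bsub>G\<^esub> a \<in> H" and ak: "a \<otimes>\<^bsub>G\<^esub> k \<in> K" using c by auto
    note cc = H.mem_carrier[OF c(1)] K.mem_carrier[OF c(2)] H.mem_carrier[OF aH]
    note cl = Fc cc G.m_closed uc[OF c(1)] uc[OF aH] uc[OF ha] vc[OF c(2)] vc[OF ak]
    \<comment> \<open>The factor needed to apply the coboundary equations at \<open>(h, a)\<close>
      and \<open>(a, k)\<close>; it reappears on the other side and cancels.\<close>
    let ?e = "F (h, a) \<otimes>\<^bsub>D\<^esub> F (a, k)"
    have "(u (h \<otimes>\<^bsub>G\<^esub> a) \<otimes>\<^bsub>D\<^esub> v k \<otimes>\<^bsub>D\<^esub> F (h, a \<otimes>\<^bsub>G\<^esub> k)) \<otimes>\<^bsub>D\<^esub> ?e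
        = (F (h, a) \<otimes>\<^bsub>D\<^esub> u (h \<otimes>\<^bsub>G\<^esub> a)) \<otimes>\<^bsub>D\<^esub> v k \<otimes>\<^bsub>D\<^esub> (F (a, k) \<otimes>\<^bsub>D\<^esub> F (h, a \<otimes>\<^bsub>G\<^esub> k))"
      by (simp add: cl D.m_ac)
    also have "\<dots> = (u h \<otimes>\<^bsub>D\<^esub> u a) \<otimes>\<^bsub>D\<^esub> v k \<otimes>\<^bsub>D\<^esub> (F (h \<otimes>\<^bsub>G\<^esub> a, k) \<otimes>\<^bsub>D\<^esub> F (h, a))"
      unfolding uD[OF c(1) aH] GG.Z2_cocycle[OF F cc(1,3,2)] ..
    also have "\<dots> = u h \<otimes>\<^bsub>D\<^esub> (u a \<otimes>\<^bsub>D\<^esub> v k) \<otimes>\<^bsub>D\<^esub> (F (h \<otimes>\<^bsub>G\<^esub> a, k) \<otimes>\<^bsub>D\<^esub> F (h, a))"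
      by (simp add: cl D.m_ac)
    also have "\<dots> = u h \<otimes>\<^bsub>D\<^esub> (F (a, k) \<otimes>\<^bsub>D\<^esub> v (a \<otimes>\<^bsub>G\<^esub> k)) \<otimes>\<^bsub>D\<^esub> (F (h \<otimes>\<^bsub>G\<^esub> a, k) \<otimes>\<^bsub>D\<^esub> F (h, a))"
      unfolding uv[OF c(3)] vD[OF aK c(2)] ..
    also have "\<dots> = (u h \<otimes>\<^bsub>D\<^esub> v (a \<otimes>\<^bsub>G\<^esub> k) \<otimes>\<^bsub>D\<^esub> F (h \<otimes>\<^bsub>G\<^esub> a, k)) \<otimes>\<^bsub>D\<^esub> ?e"
      by (simp add: cl D.m_ac)
    finally have key: "u (h \<otimes>\<^bsub>G\<^esub> a) \<otimes>\<^bsub>D\<^esub> v k \<otimes>\<^bsub>D\<^esub> F (h, a \<otimes>\<^bsub>G\<^esub> k) = u h \<otimes>\<^bsub>D\<^esub> v (a \<otimes>\<^bsub>G\<^esub> k) \<otimes>\<^bsub>D\<^esub> F (h \<otimes>\<^bsub>G\<^esub> a, k)"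
      by (simp add: cl)
    have "(u (h \<otimes>\<^bsub>G\<^esub> a) \<otimes>\<^bsub>D\<^esub> v k) \<otimes>\<^bsub>D\<^esub> inv\<^bsub>D\<^esub> F (h \<otimes>\<^bsub>G\<^esub> a, k) \<otimes>\<^bsub>D\<^esub> F (h, a \<otimes>\<^bsub>G\<^esub> k)
        = (u (h \<otimes>\<^bsub>G\<^esub> a) \<otimes>\<^bsub>D\<^esub> v k \<otimes>\<^bsub>D\<^esub> F (h, a \<otimes>\<^bsub>G\<^esub> k)) \<otimes>\<^bsub>D\<^esub> inv\<^bsub>D\<^esub> F (h \<otimes>\<^bsub>G\<^esub> a, k)"
      by (simp add: cl D.m_ac)
    also have "\<dots> = u h \<otimes>\<^bsub>D\<^esub> v (a \<otimes>\<^bsub>G\<^esub> k)" unfolding key by (simp add: cl D.m_assoc)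
    finally show "(u (h \<otimes>\<^bsub>G\<^esub> a) \<otimes>\<^bsub>D\<^esub> v k) \<otimes>\<^bsub>D\<^esub> inv\<^bsub>D\<^esub> F (h \<otimes>\<^bsub>G\<^esub> a, k)
        = (u h \<otimes>\<^bsub>D\<^esub> v (a \<otimes>\<^bsub>G\<^esub> k)) \<otimes>\<^bsub>D\<^esub> inv\<^bsub>D\<^esub> F (h, a \<otimes>\<^bsub>G\<^esub> k)"
      by (subst D.div_eq_iff) (simp_all add: cl)
  qed
  then obtain w where w: "\<And>h k. h \<in> H \<Longrightarrow> k \<in> K \<Longrightarrow> w (h \<otimes>\<^bsub>G\<^esub> k) = (u h \<otimes>\<^bsub>D\<^esub> v k) \<otimes>\<^bsub>D\<^esub> inv\<^bsub>D\<^esub> F (h, k)" by blast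
  have wc: "w (h \<otimes>\<^bsub>G\<^esub> k) \<in> carrier D" if "h \<in> H" "k \<in> K" for h k
    using w[OF that] uc[OF that(1)] vc[OF that(2)] Fc H.mem_carrier K.mem_carrier that by simp
  have wF: "F (h, k) \<otimes>\<^bsub>D\<^esub> w (h \<otimes>\<^bsub>G\<^esub> k) = u h \<otimes>\<^bsub>D\<^esub> v k" if "h \<in> H" "k \<in> K" for h k
    unfolding w[OF that] using uc[OF that(1)] vc[OF that(2)] Fc H.mem_carrier[OF that(1)] K.mem_carrier[OF that(2)]
    by (simp add: D.m_comm[of "F (h, k)"] D.m_assoc)
  have "cobounds G D F w"
  proof (rule GG.coboundsI)
    show "w \<in> carrier G \<rightarrow> carrier D"
    proof
      fix x assume "x \<in> carrier G"
      then obtain h k where "h \<in> H" "k \<in> K" "x = h \<otimes>\<^bsub>G\<^esub> k" using HK_cases by blast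
      then show "w x \<in> carrier D" using wc by simp
    qed
    fix x y assume "x \<in> carrier G" "y \<in> carrier G"
    then obtain h k h' k' where c: "h \<in> H" "k \<in> K" "x = h \<otimes>\<^bsub>G\<^esub> k" "h' \<in> H" "k' \<in> K" "y = h' \<otimes>\<^bsub>G\<^esub> k'"
      by (elim HK_cases)
    note cc = H.mem_carrier[OF c(1)] K.mem_carrier[OF c(2)] H.mem_carrier[OF c(4)] K.mem_carrier[OF c(5)]
    have hh: "h \<otimes>\<^bsub>G\<^esub> h' \<in> H" and kk: "k \<otimes>\<^bsub>G\<^esub> k' \<in> K" using c by auto
    note cl = Fc cc G.m_closed uc[OF c(1)] uc[OF c(4)] uc[OF hh] vc[OF c(2)] vc[OF c(5)] vc[OF kk]
      wc[OF c(1,2)] wc[OF c(4,5)] wc[OF hh kk]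
    have kh': "k \<otimes>\<^bsub>G\<^esub> h' = h' \<otimes>\<^bsub>G\<^esub> k" using commute[OF c(4,2)] by simp
    \<comment> \<open>\<open>l\<close> and \<open>r\<close> arrive at the same product; together
      they express the reordering of \<open>h k h' k'\<close> into \<open>h h' k k'\<close> in the
      extension. Symmetry is used once, to exchange \<open>k\<close> and \<open>h'\<close>.\<close>
    have l: "F (h \<otimes>\<^bsub>G\<^esub> k, h' \<otimes>\<^bsub>G\<^esub> k') \<otimes>\<^bsub>D\<^esub> F (h, k) \<otimes>\<^bsub>D\<^esub> F (h', k')
        = F (h' \<otimes>\<^bsub>G\<^esub> k, k') \<otimes>\<^bsub>D\<^esub> F (h', k) \<otimes>\<^bsub>D\<^esub> F (h, h' \<otimes>\<^bsub>G\<^esub> (k \<otimes>\<^bsub>G\<^esub> k'))"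
    proof -
      have assoc: "k \<otimes>\<^bsub>G\<^esub> (h' \<otimes>\<^bsub>G\<^esub> k') = h' \<otimes>\<^bsub>G\<^esub> (k \<otimes>\<^bsub>G\<^esub> k')" using kh' cc by (simp add: G.m_assoc[symmetric])
      have "F (h \<otimes>\<^bsub>G\<^esub> k, h' \<otimes>\<^bsub>G\<^esub> k') \<otimes>\<^bsub>D\<^esub> F (h, k) \<otimes>\<^bsub>D\<^esub> F (h', k')
          = (F (k, h' \<otimes>\<^bsub>G\<^esub> k') \<otimes>\<^bsub>D\<^esub> F (h, h' \<otimes>\<^bsub>G\<^esub> (k \<otimes>\<^bsub>G\<^esub> k'))) \<otimes>\<^bsub>D\<^esub> F (h', k')"
        using GG.Z2_cocycle[OF F cc(1,2) G.m_closed[OF cc(3,4)]] assoc by simp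
      also have "\<dots> = (F (h', k') \<otimes>\<^bsub>D\<^esub> F (k, h' \<otimes>\<^bsub>G\<^esub> k')) \<otimes>\<^bsub>D\<^esub> F (h, h' \<otimes>\<^bsub>G\<^esub> (k \<otimes>\<^bsub>G\<^esub> k'))" by (simp add: cl D.m_ac)
      also have "\<dots> = (F (h' \<otimes>\<^bsub>G\<^esub> k, k') \<otimes>\<^bsub>D\<^esub> F (h', k)) \<otimes>\<^bsub>D\<^esub> F (h, h' \<otimes>\<^bsub>G\<^esub> (k \<otimes>\<^bsub>G\<^esub> k'))"
        using GG.Z2_cocycle[OF F cc(2,3,4)] kh' sym[OF c(4,2)] by simp
      finally show ?thesis .
    qed
    have r: "F (h, h') \<otimes>\<^bsub>D\<^esub> F (k, k') \<otimes>\<^bsub>D\<^esub> F (h \<otimes>\<^bsub>G\<^esub> h', k \<otimes>\<^bsub>G\<^esub> k')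
        = F (h' \<otimes>\<^bsub>G\<^esub> k, k') \<otimes>\<^bsub>D\<^esub> F (h', k) \<otimes>\<^bsub>D\<^esub> F (h, h' \<otimes>\<^bsub>G\<^esub> (k \<otimes>\<^bsub>G\<^esub> k'))"
    proof -
      have "F (h, h') \<otimes>\<^bsub>D\<^esub> F (k, k') \<otimes>\<^bsub>D\<^esub> F (h \<otimes>\<^bsub>G\<^esub> h', k \<otimes>\<^bsub>G\<^esub> k')
          = F (k, k') \<otimes>\<^bsub>D\<^esub> (F (h \<otimes>\<^bsub>G\<^esub> h', k \<otimes>\<^bsub>G\<^esub> k') \<otimes>\<^bsub>D\<^esub> F (h, h'))" by (simp add: cl D.m_ac)
      also have "\<dots> = F (k, k') \<otimes>\<^bsub>D\<^esub> (F (h', k \<otimes>\<^bsub>G\<^esub> k') \<otimes>\<^bsub>D\<^esub> F (h, h' \<otimes>\<^bsub>G\<^esub> (k \<otimes>\<^bsub>G\<^esub> k')))"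
        using GG.Z2_cocycle[OF F cc(1,3) G.m_closed[OF cc(2,4)]] by simp
      also have "\<dots> = (F (k, k') \<otimes>\<^bsub>D\<^esub> F (h', k \<otimes>\<^bsub>G\<^esub> k')) \<otimes>\<^bsub>D\<^esub> F (h, h' \<otimes>\<^bsub>G\<^esub> (k \<otimes>\<^bsub>G\<^esub> k'))" by (simp add: cl D.m_assoc)
      also have "\<dots> = (F (h' \<otimes>\<^bsub>G\<^esub> k, k') \<otimes>\<^bsub>D\<^esub> F (h', k)) \<otimes>\<^bsub>D\<^esub> F (h, h' \<otimes>\<^bsub>G\<^esub> (k \<otimes>\<^bsub>G\<^esub> k'))"
        using GG.Z2_cocycle[OF F cc(3,2,4)] by simp
      finally show ?thesis .
    qed
    let ?W = "w ((h \<otimes>\<^bsub>G\<^esub> h') \<otimes>\<^bsub>G\<^esub> (k \<otimes>\<^bsub>G\<^esub> k'))"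
    let ?e = "F (h, k) \<otimes>\<^bsub>D\<^esub> F (h', k')"
    have "(F (x, y) \<otimes>\<^bsub>D\<^esub> w (x \<otimes>\<^bsub>G\<^esub> y)) \<otimes>\<^bsub>D\<^esub> ?e
        = (F (h \<otimes>\<^bsub>G\<^esub> k, h' \<otimes>\<^bsub>G\<^esub> k') \<otimes>\<^bsub>D\<^esub> F (h, k) \<otimes>\<^bsub>D\<^esub> F (h', k')) \<otimes>\<^bsub>D\<^esub> ?W"
      unfolding c(3,6) HK_mult[OF c(1,2,4,5)] by (simp add: cl D.m_ac)
    also have "\<dots> = (F (h, h') \<otimes>\<^bsub>D\<^esub> F (k, k') \<otimes>\<^bsub>D\<^esub> F (h \<otimes>\<^bsub>G\<^esub> h', k \<otimes>\<^bsub>G\<^esub> k')) \<otimes>\<^bsub>D\<^esub> ?W" unfolding l r ..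
    also have "\<dots> = (F (h, h') \<otimes>\<^bsub>D\<^esub> F (k, k')) \<otimes>\<^bsub>D\<^esub> (F (h \<otimes>\<^bsub>G\<^esub> h', k \<otimes>\<^bsub>G\<^esub> k') \<otimes>\<^bsub>D\<^esub> ?W)" by (simp add: cl D.m_assoc)
    also have "\<dots> = (F (h, h') \<otimes>\<^bsub>D\<^esub> F (k, k')) \<otimes>\<^bsub>D\<^esub> (u (h \<otimes>\<^bsub>G\<^esub> h') \<otimes>\<^bsub>D\<^esub> v (k \<otimes>\<^bsub>G\<^esub> k'))" unfolding wF[OF hh kk] ..
    also have "\<dots> = (F (h, h') \<otimes>\<^bsub>D\<^esub> u (h \<otimes>\<^bsub>G\<^esub> h')) \<otimes>\<^bsub>D\<^esub> (F (k, k') \<otimes>\<^bsub>D\<^esub> v (k \<otimes>\<^bsub>G\<^esub> k'))"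
      by (rule D.mult_mult_swap) (simp_all add: cl)
    also have "\<dots> = (u h \<otimes>\<^bsub>D\<^esub> u h') \<otimes>\<^bsub>D\<^esub> (v k \<otimes>\<^bsub>D\<^esub> v k')" unfolding uD[OF c(1,4)] vD[OF c(2,5)] ..
    also have "\<dots> = (u h \<otimes>\<^bsub>D\<^esub> v k) \<otimes>\<^bsub>D\<^esub> (u h' \<otimes>\<^bsub>D\<^esub> v k')" by (rule D.mult_mult_swap) (simp_all add: cl)
    also have "\<dots> = (F (h, k) \<otimes>\<^bsub>D\<^esub> w x) \<otimes>\<^bsub>D\<^esub> (F (h', k') \<otimes>\<^bsub>D\<^esub> w y)" unfolding c(3,6) wF[OF c(1,2)] wF[OF c(4,5)] ..
    also have "\<dots> = (w x \<otimes>\<^bsub>D\<^esub> w y) \<otimes>\<^bsub>D\<^esub> ?e" unfolding c(3,6) by (simp add: cl D.m_ac)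
    finally show "F (x, y) \<otimes>\<^bsub>D\<^esub> w (x \<otimes>\<^bsub>G\<^esub> y) = w x \<otimes>\<^bsub>D\<^esub> w y"
      unfolding c(3,6) HK_mult[OF c(1,2,4,5)] by (simp add: cl)
  qed
  then show ?thesis by blast
qed

text \<open>One trivialization \<open>w\<close> over \<open>G\<close> serves both factors, so both
  restrictions give the character \<open>w / w 1\<close> of \<open>Z\<close>, and symmetry on
  commuting pairs kills the pairing. For the converse, the trivializations found over
  \<open>H\<close> and \<open>K\<close> can be compared on \<open>A\<close>, since both belong to
  the same cocycle \<open>F\<close> there.\<close>

lemma adapted_cocycle_trivial_iff:
  assumes f: "f \<in> HA.Cq.Q.Z2" and g: "g \<in> KA.Cq.Q.Z2" and \<theta>: "\<theta> \<in> hom T' D" and E: "adapted_cocycle f g \<theta> F"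
  shows "(\<exists>w. cobounds G D F w) \<longleftrightarrow> (H2_class RH D f, H2_class RK D g) \<in> N' \<and> (\<forall>t\<in>carrier T'. \<theta> t = \<one>\<^bsub>D\<^esub>)"
proof -
  have F: "F \<in> GG.Z2" and Ff: "\<And>h h'. h \<in> H \<Longrightarrow> h' \<in> H \<Longrightarrow> F (h, h') = f (Z #>\<^bsub>G\<^esub> h, Z #>\<^bsub>G\<^esub> h')"
    and Fg: "\<And>k k'. k \<in> K \<Longrightarrow> k' \<in> K \<Longrightarrow> F (k, k') = g (Z #>\<^bsub>G\<^esub> k, Z #>\<^bsub>G\<^esub> k')"
    and F\<theta>: "\<And>h k. h \<in> H \<Longrightarrow> k \<in> K \<Longrightarrow> \<theta> (ab_tens GH GK h k) = F (h, k) \<otimes>\<^bsub>D\<^esub> inv\<^bsub>D\<^esub> F (k, h)"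
    using E unfolding adapted_cocycle_def by blast+
  note Fc = GG.Z2_closed[OF F]
  show ?thesis
  proof
    assume "\<exists>w. cobounds G D F w"
    then obtain w where w: "cobounds G D F w" by blast
    note wc = GG.cobounds_closed[OF w]
    have sym: "F (h, k) = F (k, h)" if c: "h \<in> H" "k \<in> K" for h k
    proof -
      note cc = H.mem_carrier[OF c(1)] K.mem_carrier[OF c(2)]
      have "F (h, k) \<otimes>\<^bsub>D\<^esub> w (h \<otimes>\<^bsub>G\<^esub> k) = F (k, h) \<otimes>\<^bsub>D\<^esub> w (h \<otimes>\<^bsub>G\<^esub> k)"
        using GG.coboundsD[OF w cc] GG.coboundsD[OF w cc(2,1)] commute[OF c] wc cc by (simp add: D.m_comm)
      then show ?thesis using Fc wc cc by simp
    qed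
    have 1: "\<theta> t = \<one>\<^bsub>D\<^esub>" if t: "t \<in> carrier T'" for t
    proof (rule ab_tens_generate[OF GHg.is_group GKg.is_group D.is_group \<theta> _ t])
      fix h k assume "h \<in> carrier GH" "k \<in> carrier GK"
      then have c: "h \<in> H" "k \<in> K" by auto
      show "\<theta> (ab_tens GH GK h k) = \<one>\<^bsub>D\<^esub>"
        unfolding F\<theta>[OF c] sym[OF c] using Fc K.mem_carrier[OF c(2)] H.mem_carrier[OF c(1)] by simp
    qed
    have cu: "cobounds GH D (pullback GH (\<lambda>x. Z #>\<^bsub>GH\<^esub> x) f) w"
      by (rule GHc.coboundsI) (use wc H.mem_carrier GG.coboundsD[OF w] in \<open>auto simp: Ff[symmetric]\<close>)
    have cv: "cobounds GK D (pullback GK (\<lambda>x. Z #>\<^bsub>GK\<^esub> x) g) w"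
      by (rule GKc.coboundsI) (use wc K.mem_carrier GG.coboundsD[OF w] in \<open>auto simp: Fg[symmetric]\<close>)
    let ?\<chi> = "\<lambda>a. w a \<otimes>\<^bsub>D\<^esub> inv\<^bsub>D\<^esub> w \<one>\<^bsub>G\<^esub>"
    have "?\<chi> \<in> homZ" "transgresses GH Z D f ?\<chi> w" using HA.Cq.cobounds_imp_transgresses[OF f cu] by simp_all
    moreover have "transgresses GK Z D g ?\<chi> w" using KA.Cq.cobounds_imp_transgresses(2)[OF g cv] by simp
    ultimately have "transgresses_Z f g ?\<chi>" unfolding transgresses_Z_def using f g by blast
    then have "(H2_class RH D f, H2_class RK D g) \<in> N'" unfolding N'_def by blast
    then show "(H2_class RH D f, H2_class RK D g) \<in> N' \<and> (\<forall>t\<in>carrier T'. \<theta> t = \<one>\<^bsub>D\<^esub>)" using 1 by blast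
  next
    assume asm: "(H2_class RH D f, H2_class RK D g) \<in> N' \<and> (\<forall>t\<in>carrier T'. \<theta> t = \<one>\<^bsub>D\<^esub>)"
    then obtain f1 g1 \<chi> where fg: "H2_class RH D f = H2_class RH D f1" "H2_class RK D g = H2_class RK D g1" "transgresses_Z f1 g1 \<chi>"
      unfolding N'_def by blast
    then obtain u1 v1 where t1: "f1 \<in> HA.Cq.Q.Z2" "g1 \<in> KA.Cq.Q.Z2" "\<chi> \<in> homZ" "transgresses GH Z D f1 \<chi> u1" "transgresses GK Z D g1 \<chi> v1"
      unfolding transgresses_Z_def by blast
    \<comment> \<open>Membership in \<open>N'\<close> concerns classes only; the character is
      carried over from \<open>f1\<close> and \<open>g1\<close> to the given cocycles.\<close>
    obtain u where u: "transgresses GH Z D f \<chi> u" using HA.Cq.transgresses_cls_cong[unfolded GHZ, OF f t1(1) fg(1) t1(4,3)] by blast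
    obtain v where v: "transgresses GK Z D g \<chi> v" using KA.Cq.transgresses_cls_cong[unfolded GKZ, OF g t1(2) fg(2) t1(5,3)] by blast
    note uD = HA.Cq.transgressesD(1-3)[OF u, simplified] and vD = KA.Cq.transgressesD(1-3)[OF v, simplified]
    have cu: "cobounds GH D F u" by (rule GHc.coboundsI) (use uD Ff in auto)
    have cv: "cobounds GK D F v" by (rule GKc.coboundsI) (use vD Fg in auto)
    have uvF: "F (a, b) \<otimes>\<^bsub>D\<^esub> u (a \<otimes>\<^bsub>G\<^esub> b) = u a \<otimes>\<^bsub>D\<^esub> u b" "F (a, b) \<otimes>\<^bsub>D\<^esub> v (a \<otimes>\<^bsub>G\<^esub> b) = v a \<otimes>\<^bsub>D\<^esub> v b"
      if "a \<in> A" "b \<in> A" for a b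
      using GHc.coboundsD[OF cu, of a b] GKc.coboundsD[OF cv, of a b] that by simp_all
    have Ac: "a \<in> carrier G" "u a \<in> carrier D" "v a \<in> carrier D" if "a \<in> A" for a
      using that uD(1) vD(1) H.mem_carrier by auto
    have oneA: "\<one>\<^bsub>G\<^esub> \<in> A" using subgroup.one_closed[OF A_subgroup] .
    \<comment> \<open>On \<open>A\<close> the functions \<open>u\<close> and \<open>v\<close>
      trivialize the same cocycle, so \<open>F\<close> cancels in their quotient and a character
      remains.\<close>
    let ?\<psi> = "\<lambda>a. u a \<otimes>\<^bsub>D\<^esub> inv\<^bsub>D\<^esub> v a"
    have \<psi>: "?\<psi> \<in> homA"
    proof (rule homI)
      fix a b assume "a \<in> carrier (G\<lparr>carrier := A\<rparr>)" "b \<in> carrier (G\<lparr>carrier := A\<rparr>)"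
      then have ab: "a \<in> A" "b \<in> A" by auto
      have abA: "a \<otimes>\<^bsub>G\<^esub> b \<in> A" using subgroup.m_closed[OF A_subgroup ab] .
      note cl = Ac[OF ab(1)] Ac[OF ab(2)] Ac[OF abA] Fc[OF Ac(1)[OF ab(1)] Ac(1)[OF ab(2)]]
      show "?\<psi> a \<in> carrier D" using cl by simp
      have "?\<psi> a \<otimes>\<^bsub>D\<^esub> ?\<psi> b = (F (a, b) \<otimes>\<^bsub>D\<^esub> u (a \<otimes>\<^bsub>G\<^esub> b)) \<otimes>\<^bsub>D\<^esub> inv\<^bsub>D\<^esub> (F (a, b) \<otimes>\<^bsub>D\<^esub> v (a \<otimes>\<^bsub>G\<^esub> b))"
        unfolding uvF[OF ab] by (rule D.div_mult_div) (use cl in simp_all)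
      also have "\<dots> = (F (a, b) \<otimes>\<^bsub>D\<^esub> inv\<^bsub>D\<^esub> F (a, b)) \<otimes>\<^bsub>D\<^esub> ?\<psi> (a \<otimes>\<^bsub>G\<^esub> b)"
        by (rule D.div_mult_div[symmetric]) (use cl in simp_all)
      also have "\<dots> = ?\<psi> (a \<otimes>\<^bsub>G\<^esub> b)" using cl by simp
      finally show "?\<psi> (a \<otimes>\<^bsub>G\<lparr>carrier := A\<rparr>\<^esub> b) = ?\<psi> a \<otimes>\<^bsub>D\<^esub> ?\<psi> b" by simp
    qed
    \<comment> \<open>Both equal \<open>F (1, 1)\<close>. Hence a common character on
      \<open>Z\<close> means \<open>u = v\<close> on \<open>Z\<close>, with no constant left
      over.\<close>
    have u1v1: "u \<one>\<^bsub>G\<^esub> = v \<one>\<^bsub>G\<^esub>"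
      using uvF[OF oneA oneA] Ac[OF oneA] Fc[OF G.one_closed G.one_closed] by simp
    have triv: "?\<psi> z = \<one>\<^bsub>D\<^esub>" if z: "z \<in> Z" for z
    proof -
      have zA: "z \<in> A" using z Z_A by blast
      have "u z = v z" using uD(3)[of "\<one>\<^bsub>G\<^esub>" z] vD(3)[of "\<one>\<^bsub>G\<^esub>" z] z oneA u1v1 Ac(1)[OF zA] by simp
      then show ?thesis using Ac[OF zA] by simp
    qed
    obtain \<psi>1 \<psi>2 where p: "\<psi>1 \<in> hom GH D" "\<psi>2 \<in> hom GK D" "\<And>a. a \<in> A \<Longrightarrow> ?\<psi> a = \<psi>1 a \<otimes>\<^bsub>D\<^esub> \<psi>2 a"
      using split_character[OF \<psi> triv] by blast
    have i1: "(\<lambda>x. inv\<^bsub>D\<^esub> \<psi>1 x) \<in> hom GH D" by (rule hom_inv_closed[OF GHg.is_group D.comm_group_axioms p(1)])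
    have cu': "cobounds GH D F (\<lambda>x. u x \<otimes>\<^bsub>D\<^esub> inv\<^bsub>D\<^esub> \<psi>1 x)"
      by (rule twist_cob[OF GHc.cohomology_axioms _ cu i1]) (use Fc H.mem_carrier in simp)
    have cv': "cobounds GK D F (\<lambda>x. v x \<otimes>\<^bsub>D\<^esub> \<psi>2 x)"
      by (rule twist_cob[OF GKc.cohomology_axioms _ cv p(2)]) (use Fc K.mem_carrier in simp)
    have uv: "u a \<otimes>\<^bsub>D\<^esub> inv\<^bsub>D\<^esub> \<psi>1 a = v a \<otimes>\<^bsub>D\<^esub> \<psi>2 a" if a: "a \<in> A" for a
    proof -
      have c: "\<psi>1 a \<in> carrier D" "\<psi>2 a \<in> carrier D"
        using a hom_in_carrier[OF p(1), of a] hom_in_carrier[OF p(2), of a] by auto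
      have "(\<psi>1 a \<otimes>\<^bsub>D\<^esub> \<psi>2 a) \<otimes>\<^bsub>D\<^esub> v a = u a"
        using p(3)[OF a] c Ac[OF a] D.div_eq_iff[of "\<psi>1 a \<otimes>\<^bsub>D\<^esub> \<psi>2 a" "u a" "v a"] by simp
      then have "v a \<otimes>\<^bsub>D\<^esub> \<psi>2 a = u a \<otimes>\<^bsub>D\<^esub> inv\<^bsub>D\<^esub> \<psi>1 a"
        using c Ac[OF a] by (subst D.div_eq_iff) (simp_all add: D.m_ac)
      then show ?thesis by simp
    qed
    have sym: "F (h, k) = F (k, h)" if c: "h \<in> H" "k \<in> K" for h k
    proof -
      have "ab_tens GH GK h k \<in> carrier T'"
        using bimult_ab_tens[OF GHg.is_group GKg.is_group] c unfolding bimult_def by simp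
      then have "\<one>\<^bsub>D\<^esub> = F (h, k) \<otimes>\<^bsub>D\<^esub> inv\<^bsub>D\<^esub> F (k, h)" using asm F\<theta>[OF c] by simp
      then show ?thesis using D.div_eq_iff[of "\<one>\<^bsub>D\<^esub>" "F (h, k)" "F (k, h)"] Fc H.mem_carrier[OF c(1)] K.mem_carrier[OF c(2)] by simp
    qed
    show "\<exists>w. cobounds G D F w" by (rule glue_cobs[OF F sym cu' cv' uv])
  qed
qed

lemma adapted_cocycle_div:
  assumes "f \<in> HA.Cq.Q.Z2" "g \<in> KA.Cq.Q.Z2" "f' \<in> HA.Cq.Q.Z2" "g' \<in> KA.Cq.Q.Z2"
    and \<theta>: "\<theta> \<in> carrier (hom_group T' D)" "\<theta>' \<in> carrier (hom_group T' D)"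
    and E: "adapted_cocycle f g \<theta> F" "adapted_cocycle f' g' \<theta>' F'"
  shows "adapted_cocycle (f \<otimes>\<^bsub>cocycle_group RH D\<^esub> inv\<^bsub>cocycle_group RH D\<^esub> f') (g \<otimes>\<^bsub>cocycle_group RK D\<^esub> inv\<^bsub>cocycle_group RK D\<^esub> g')
    (\<theta> \<otimes>\<^bsub>hom_group T' D\<^esub> inv\<^bsub>hom_group T' D\<^esub> \<theta>') (F \<otimes>\<^bsub>cocycle_group G D\<^esub> inv\<^bsub>cocycle_group G D\<^esub> F')"
proof -
  have FZ: "F \<in> GG.Z2" "F' \<in> GG.Z2" using E by (simp_all add: adapted_cocycle_def)
  interpret T': comm_group T' by (rule comm_group_ab_tensor[OF GHg.is_group GKg.is_group])
  have cH: "Z #>\<^bsub>G\<^esub> h \<in> carrier RH" if "h \<in> H" for h using HA.Cq.proj_closed[of h] that by simp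
  have cK: "Z #>\<^bsub>G\<^esub> h \<in> carrier RK" if "h \<in> K" for h using KA.Cq.proj_closed[of h] that by simp
  show ?thesis unfolding adapted_cocycle_def
  proof (intro conjI ballI)
    show "F \<otimes>\<^bsub>cocycle_group G D\<^esub> inv\<^bsub>cocycle_group G D\<^esub> F' \<in> GG.Z2" using FZ by simp
  next
    fix h h' assume c: "h \<in> H" "h' \<in> H"
    then have "F (h, h') = f (Z #>\<^bsub>G\<^esub> h, Z #>\<^bsub>G\<^esub> h')" "F' (h, h') = f' (Z #>\<^bsub>G\<^esub> h, Z #>\<^bsub>G\<^esub> h')"
      using E unfolding adapted_cocycle_def by blast+
    then show "(F \<otimes>\<^bsub>cocycle_group G D\<^esub> inv\<^bsub>cocycle_group G D\<^esub> F') (h, h') =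
      (f \<otimes>\<^bsub>cocycle_group RH D\<^esub> inv\<^bsub>cocycle_group RH D\<^esub> f') (Z #>\<^bsub>G\<^esub> h, Z #>\<^bsub>G\<^esub> h')"
      unfolding GG.div_cocycle_group[OF FZ H.mem_carrier[OF c(1)] H.mem_carrier[OF c(2)]]
        HA.Cq.Q.div_cocycle_group[OF assms(1,3) cH[OF c(1)] cH[OF c(2)]] by simp
  next
    fix h h' assume c: "h \<in> K" "h' \<in> K"
    then have "F (h, h') = g (Z #>\<^bsub>G\<^esub> h, Z #>\<^bsub>G\<^esub> h')" "F' (h, h') = g' (Z #>\<^bsub>G\<^esub> h, Z #>\<^bsub>G\<^esub> h')"
      using E unfolding adapted_cocycle_def by blast+
    then show "(F \<otimes>\<^bsub>cocycle_group G D\<^esub> inv\<^bsub>cocycle_group G D\<^esub> F') (h, h') =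
      (g \<otimes>\<^bsub>cocycle_group RK D\<^esub> inv\<^bsub>cocycle_group RK D\<^esub> g') (Z #>\<^bsub>G\<^esub> h, Z #>\<^bsub>G\<^esub> h')"
      unfolding GG.div_cocycle_group[OF FZ K.mem_carrier[OF c(1)] K.mem_carrier[OF c(2)]]
        KA.Cq.Q.div_cocycle_group[OF assms(2,4) cK[OF c(1)] cK[OF c(2)]] by simp
  next
    fix h k assume c: "h \<in> H" "k \<in> K"
    note cc = H.mem_carrier[OF c(1)] K.mem_carrier[OF c(2)]
    have t: "ab_tens GH GK h k \<in> carrier T'"
      using bimult_ab_tens[OF GHg.is_group GKg.is_group] c unfolding bimult_def by simp
    have e: "\<theta> (ab_tens GH GK h k) = F (h, k) \<otimes>\<^bsub>D\<^esub> inv\<^bsub>D\<^esub> F (k, h)" "\<theta>' (ab_tens GH GK h k) = F' (h, k) \<otimes>\<^bsub>D\<^esub> inv\<^bsub>D\<^esub> F' (k, h)"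
      using E c unfolding adapted_cocycle_def by blast+
    note cl = GG.Z2_closed[OF FZ(1)] GG.Z2_closed[OF FZ(2)] cc
    have sw: "(a \<otimes>\<^bsub>D\<^esub> inv\<^bsub>D\<^esub> b) \<otimes>\<^bsub>D\<^esub> inv\<^bsub>D\<^esub> (c \<otimes>\<^bsub>D\<^esub> inv\<^bsub>D\<^esub> d) = (a \<otimes>\<^bsub>D\<^esub> inv\<^bsub>D\<^esub> c) \<otimes>\<^bsub>D\<^esub> inv\<^bsub>D\<^esub> (b \<otimes>\<^bsub>D\<^esub> inv\<^bsub>D\<^esub> d)"
      if "a \<in> carrier D" "b \<in> carrier D" "c \<in> carrier D" "d \<in> carrier D" for a b c d
      using that by (simp add: D.inv_mult D.m_ac)
    show "(\<theta> \<otimes>\<^bsub>hom_group T' D\<^esub> inv\<^bsub>hom_group T' D\<^esub> \<theta>') (ab_tens GH GK h k) =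
      (F \<otimes>\<^bsub>cocycle_group G D\<^esub> inv\<^bsub>cocycle_group G D\<^esub> F') (h, k) \<otimes>\<^bsub>D\<^esub>
      inv\<^bsub>D\<^esub> (F \<otimes>\<^bsub>cocycle_group G D\<^esub> inv\<^bsub>cocycle_group G D\<^esub> F') (k, h)"
      unfolding hom_group_div_apply[OF T'.is_group D.comm_group_axioms \<theta> t] e
        GG.div_cocycle_group[OF FZ cc] GG.div_cocycle_group[OF FZ cc(2,1)]
      by (rule sw) (simp_all add: cl)
  qed
qed

text \<open>Every class has adapted data. The coboundary criterion for adapted cocycles shows that
  these data modulo \<open>N'\<close> depend on the class alone and that they separate
  classes.\<close>

lemma embedding_of_H2: "embeds (H2 G D) ((S' Mod N') \<times>\<times> hom_group T' D)"
proof -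
  interpret Nn: normal N' S' by (rule S'.subgroup_imp_normal[OF N'_subgroup])
  interpret T': comm_group T' by (rule comm_group_ab_tensor[OF GHg.is_group GKg.is_group])
  let ?W = "hom_group T' D"
  interpret W: comm_group ?W by (rule comm_group_hom_group[OF T'.is_group D.comm_group_axioms])
  interpret SN: group "S' Mod N'" by (rule Nn.factorgroup_is_group)
  define R where "R c y \<longleftrightarrow> (\<exists>f\<in>HA.Cq.Q.Z2. \<exists>g\<in>KA.Cq.Q.Z2. \<exists>\<theta>\<in>carrier ?W. \<exists>F. adapted_cocycle f g \<theta> F \<and>
      y = (N' #>\<^bsub>S'\<^esub> (H2_class RH D f, H2_class RK D g), \<theta>) \<and> c = H2_class G D F)" for y c
  have pc: "(H2_class RH D f, H2_class RK D g) \<in> carrier S'" if "f \<in> HA.Cq.Q.Z2" "g \<in> KA.Cq.Q.Z2" for f g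
    using HA.Cq.Q.H2_class_carrier[OF that(1)] KA.Cq.Q.H2_class_carrier[OF that(2)] by simp
  show ?thesis
  proof (rule embeds_by_relation[of _ _ R])
    show "group ((S' Mod N') \<times>\<times> ?W)" by (rule DirProd_group[OF SN.is_group W.is_group])
    show "group (H2 G D)" by (rule GG.H.is_group)
  next
    fix c assume "c \<in> carrier (H2 G D)"
    then show "\<exists>y. R c y" using adapted_cocycle_exists[of c] unfolding R_def by blast
  next
    fix c y assume "R c y"
    then obtain f g \<theta> F where y: "f \<in> HA.Cq.Q.Z2" "g \<in> KA.Cq.Q.Z2" "\<theta> \<in> carrier ?W" "adapted_cocycle f g \<theta> F"
      "y = (N' #>\<^bsub>S'\<^esub> (H2_class RH D f, H2_class RK D g), \<theta>)" "c = H2_class G D F" unfolding R_def by blast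
    have "N' #>\<^bsub>S'\<^esub> (H2_class RH D f, H2_class RK D g) \<in> carrier (S' Mod N')"
      unfolding carrier_FactGroup using pc[OF y(1,2)] by (rule imageI)
    moreover have "F \<in> GG.Z2" using y(4) by (simp add: adapted_cocycle_def)
    ultimately show "c \<in> carrier (H2 G D) \<and> y \<in> carrier ((S' Mod N') \<times>\<times> ?W)"
      unfolding y(5,6) carrier_DirProd using y(3) GG.H2_class_carrier by blast
  next
    fix c y c' y' assume r: "R c y" "R c' y'"
    obtain f g \<theta> F where y: "f \<in> HA.Cq.Q.Z2" "g \<in> KA.Cq.Q.Z2" "\<theta> \<in> carrier ?W" "adapted_cocycle f g \<theta> F"
      "y = (N' #>\<^bsub>S'\<^esub> (H2_class RH D f, H2_class RK D g), \<theta>)" "c = H2_class G D F" using r(1) unfolding R_def by blast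
    obtain f' g' \<theta>' F' where y': "f' \<in> HA.Cq.Q.Z2" "g' \<in> KA.Cq.Q.Z2" "\<theta>' \<in> carrier ?W" "adapted_cocycle f' g' \<theta>' F'"
      "y' = (N' #>\<^bsub>S'\<^esub> (H2_class RH D f', H2_class RK D g'), \<theta>')" "c' = H2_class G D F'" using r(2) unfolding R_def by blast
    have FZ: "F \<in> GG.Z2" "F' \<in> GG.Z2" using y(4) y'(4) by (simp_all add: adapted_cocycle_def)
    have m: "N' #>\<^bsub>S'\<^esub> (H2_class RH D f', H2_class RK D g') \<in> carrier (S' Mod N')"
      unfolding carrier_FactGroup using pc[OF y'(1,2)] by (rule imageI)
    have e: "y \<otimes>\<^bsub>(S' Mod N') \<times>\<times> ?W\<^esub> inv\<^bsub>(S' Mod N') \<times>\<times> ?W\<^esub> y' =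
       (N' #>\<^bsub>S'\<^esub> (H2_class RH D (f \<otimes>\<^bsub>cocycle_group RH D\<^esub> inv\<^bsub>cocycle_group RH D\<^esub> f'), H2_class RK D (g \<otimes>\<^bsub>cocycle_group RK D\<^esub> inv\<^bsub>cocycle_group RK D\<^esub> g')),
        \<theta> \<otimes>\<^bsub>?W\<^esub> inv\<^bsub>?W\<^esub> \<theta>')"
      unfolding y(5) y'(5) inv_DirProd[OF SN.is_group W.is_group m y'(3)] mult_DirProd
        Nn.rcos_div[OF pc[OF y(1,2)] pc[OF y'(1,2)]] S'_div[OF y(1,2) y'(1,2)] ..
    show "R (c \<otimes>\<^bsub>H2 G D\<^esub> inv\<^bsub>H2 G D\<^esub> c') (y \<otimes>\<^bsub>(S' Mod N') \<times>\<times> ?W\<^esub> inv\<^bsub>(S' Mod N') \<times>\<times> ?W\<^esub> y')"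
      unfolding e y(6) y'(6) GG.H2_class_div[OF FZ] R_def
    proof (intro bexI exI conjI)
      show "adapted_cocycle (f \<otimes>\<^bsub>cocycle_group RH D\<^esub> inv\<^bsub>cocycle_group RH D\<^esub> f') (g \<otimes>\<^bsub>cocycle_group RK D\<^esub> inv\<^bsub>cocycle_group RK D\<^esub> g')
        (\<theta> \<otimes>\<^bsub>?W\<^esub> inv\<^bsub>?W\<^esub> \<theta>') (F \<otimes>\<^bsub>cocycle_group G D\<^esub> inv\<^bsub>cocycle_group G D\<^esub> F')"
        by (rule adapted_cocycle_div[OF y(1,2) y'(1,2) y(3) y'(3) y(4) y'(4)])
    qed (use y y' in simp_all)
  next
    fix c y assume "R c y"
    then obtain f g \<theta> F where y: "f \<in> HA.Cq.Q.Z2" "g \<in> KA.Cq.Q.Z2" "\<theta> \<in> carrier ?W" "adapted_cocycle f g \<theta> F"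
      "y = (N' #>\<^bsub>S'\<^esub> (H2_class RH D f, H2_class RK D g), \<theta>)" "c = H2_class G D F" unfolding R_def by blast
    have FZ: "F \<in> GG.Z2" using y(4) by (simp add: adapted_cocycle_def)
    have \<theta>: "\<theta> \<in> hom T' D" using y(3) by (simp add: hom_group_carrier_iff)
    show "c = \<one>\<^bsub>H2 G D\<^esub> \<longleftrightarrow> y = \<one>\<^bsub>(S' Mod N') \<times>\<times> ?W\<^esub>"
      unfolding y(5,6) GG.H2_class_one_iff[OF FZ] adapted_cocycle_trivial_iff[OF y(1,2) \<theta> y(4)]
        hom_group_one_iff[OF T'.is_group D.comm_group_axioms y(3), symmetric]
        Nn.rcos_eq_self_iff[OF pc[OF y(1,2)], symmetric] by simp
  qed
qed

end

theorem theoremB: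
  fixes G :: "('g, 'm) monoid_scheme" and D :: "('d, 'n) monoid_scheme"
    and H K :: "'g set"
  assumes "group G"
    and "H \<lhd> G" and "K \<lhd> G"
    and "H <#>\<^bsub>G\<^esub> K = carrier G"
    and "\<forall>h\<in>H. \<forall>k\<in>K. h \<otimes>\<^bsub>G\<^esub> k = k \<otimes>\<^bsub>G\<^esub> h"
    and "comm_group D" and "divisible_group D"
  shows
    "let A = H \<inter> K;
         Z = derived G H \<inter> derived G K;
         GH = G\<lparr>carrier := H\<rparr>; GK = G\<lparr>carrier := K\<rparr>; GZ = G\<lparr>carrier := Z\<rparr>;
         HA = GH Mod A; HZ = GH Mod Z; KA = GK Mod A; KZ = GK Mod Z;
         L = kernel (H2 HA D) (H2 HZ D) (infl HZ HA D (quot_map G H Z A));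
         M = kernel (H2 KA D) (H2 KZ D) (infl KZ KA D (quot_map G K Z A));
         S = (H2 HA D Mod L) \<times>\<times> (H2 KA D Mod M);
         S' = H2 HZ D \<times>\<times> H2 KZ D
     in (H2 HA D)\<lparr>carrier := L\<rparr> \<cong> hom_group ((G\<lparr>carrier := A \<inter> derived G H\<rparr>) Mod Z) D
      \<and> (H2 KA D)\<lparr>carrier := M\<rparr> \<cong> hom_group ((G\<lparr>carrier := A \<inter> derived G K\<rparr>) Mod Z) D
      \<and> (\<exists>N. subgroup N S \<and> S\<lparr>carrier := N\<rparr> \<cong> hom_group GZ D
             \<and> embeds ((S Mod N) \<times>\<times> hom_group (ab_tensor HA KA) D) (H2 G D))
      \<and> (\<exists>N'. subgroup N' S' \<and> S'\<lparr>carrier := N'\<rparr> \<cong> hom_group GZ D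
             \<and> embeds (H2 G D) ((S' Mod N') \<times>\<times> hom_group (ab_tensor GH GK) D))"
proof -
  interpret central_product G D H K
    using assms by (intro central_product.intro central_product_axioms.intro) auto
  have sub: "G\<lparr>carrier := H, carrier := A \<inter> derived G H\<rparr> = G\<lparr>carrier := A \<inter> derived G H\<rparr>"
    "G\<lparr>carrier := K, carrier := A \<inter> derived G K\<rparr> = G\<lparr>carrier := A \<inter> derived G K\<rparr>" by simp_all
  show ?thesis
    unfolding Let_def HA.L_def[symmetric] KA.L_def[symmetric]
    using HA.L_iso[unfolded derived_GH sub] KA.L_iso[unfolded derived_GK sub]
      N_subgroup N_iso embedding_into_H2 N'_subgroup N'_iso embedding_of_H2
    by (intro conjI exI)
qed

end
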